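(* Consider the unitary brick-wall circuit on $n$ modes with its $n$ columns, initialized so that its realized single-particle unitary $W$ is distributed according to $\mathrm{Haar}(U(n))$ (sample $W$ from Haar measure and compute the angles by Givens decomposition, with the residual diagonal of the decomposition placed in the front phase layer). Let $M=n_pn_q$ with $p\neq q$, let $\mathcal L=\langle\psi(x)|\Lambda^k(W)^\dagger M\Lambda^k(W)|\psi(x)\rangle$, and let $\phi_j$ be one of the $n$ phases of the front $R_z$ layer (the first gates the circuit applies). Then $$\frac{\partial\mathcal L}{\partial\phi_j}=D_{\hat n_j}\mathcal L:=\frac{d}{ds}\mathcal L(We^{-is\hat n_j};x)\Big|_{s=0},\qquad \hat n_j=|e_j\rangle\langle e_j|.$$ Consequently, for every $x$, $\mathbb E[\partial_{\phi_j}\mathcal L]=0$, $$\mathrm{Var}[\partial_{\phi_j}\mathcal L]=\frac{4\|B\|_F^2+2\|\Gamma(B)\|_F^2}{n^2(n^2-1)},\qquad B=[\,d\Lambda^2(\hat n_j),\rho_{2,\mathfrak g_2}(x)\,],\quad \Gamma(B)=(k-1)[\hat n_j,\rho_1(x)],$$ and $\mathrm{Var}[\partial_{\phi_j}\mathcal L]=\Theta(k^3/n^5)$ whenever $k\ge2$ and $n-2k=\Omega(n)$.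
   Context: Encoding. $n=2^K$ modes labelled $0,\dots,n-1$; $k\ge 2$ even with $2k\le n$; $f_j^\dagger,f_j$ fermionic creation/annihilation operators, $n_j=f_j^\dagger f_j$. The $k$-particle space is $\Lambda^k\mathbb C^n$; $W\in U(n)$ acts on it as $\Lambda^k(W)$. $|\Psi_{\rm in}\rangle=\prod_{b=0}^{k/2-1}\frac{1}{\sqrt2}(f^\dagger_{4b}f^\dagger_{4b+1}+f^\dagger_{4b+2}f^\dagger_{4b+3})|\mathrm{vac}\rangle$; $H_{pq}=(-1)^{\langle p,q\rangle}/\sqrt n$ is the normalized Walsh--Hadamard matrix ($\langle p,q\rangle$ = mod-2 inner product of binary expansions); data $x$ enters through arbitrary real angles $\varphi_j(x)$, $D(x)=\mathrm{diag}(e^{-i\varphi_j(x)})$, and $|\psi(x)\rangle=\Lambda^k(D(x)H)|\Psi_{\rm in}\rangle$. $\rho_1(x)_{pq}=\langle\psi(x)|f_q^\dagger f_p|\psi(x)\rangle$; $\rho_2(x)$ is the operator on $\Lambda^2\mathbb C^n$ with kernel $(\rho_2)^{pq}_{rs}=\langle\psi(x)|f_r^\dagger f_s^\dagger f_qf_p|\psi(x)\rangle$; $\rho_{2,\mathfrak g_2}=\rho_2-\frac{\mathrm{tr}\rho_2}{\binom n2}I$. Operators on $\Lambda^2\mathbb C^n$ are identified with kernels $Y^{pq}_{rs}$ antisymmetric in upper and lower pairs, $\mathrm{tr}(YZ)=\frac14\sum Y^{pq}_{rs}Z^{rs}_{pq}$; $\Gamma(Y)^p{}_r=\sum_qY^{pq}_{rq}$;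 $d\Lambda^2(g)(u\wedge v)=(gu)\wedge v+u\wedge(gv)$; $\|\cdot\|_F$ is the Frobenius norm. Brick-wall (single-particle picture): $W=U^{(n)}\cdots U^{(1)}$, where $U^{(\ell)}=R_\ell\,\mathrm{diag}(e^{-i\phi_\ell^{(0)}},\dots,e^{-i\phi_\ell^{(n-1)}})$ and $R_\ell$ is a product of real rotations $\begin{pmatrix}\cos\theta&-\sin\theta\\ \sin\theta&\cos\theta\end{pmatrix}$ on the disjoint pairs $(0,1),(2,3),\dots$ for odd $\ell$ and $(1,2),(3,4),\dots,(n-1,0)$ for even $\ell$. The front phase layer is the diagonal factor of $U^{(1)}$, with phases $\phi_j=\phi_1^{(j)}$ (global phases are irrelevant). Asymptotics are for $n\to\infty$ (powers of two), uniform in $x$ and $j$. *)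

theory Defs
  imports "HOL-Probability.Probability" "Jordan_Normal_Form.Schur_Decomposition"
begin

unbundle no vec_syntax
hide_const (open) Finite_Cartesian_Product.vec Finite_Cartesian_Product.mat

subsection \<open>Fermionic Fock space\<close>

(* A Fock vector over the modes {..<n} is its family of amplitudes in the occupation basis
     |S> = f\<^sup>\<dagger>_{s_1} ... f\<^sup>\<dagger>_{s_m} |vac>,   S = {s_1 < ... < s_m};
   only the amplitudes at S \<subseteq> {..<n} matter.  Moving f_j past the smaller occupied modes
   gives the Jordan-Wigner sign. *)

type_synonym fock = "nat set \<Rightarrow> complex"

definition jw_sign :: "nat \<Rightarrow> nat set \<Rightarrow> complex" where
  "jw_sign j S = (- 1) ^ card {i \<in> S. i < j}"

definition create :: "nat \<Rightarrow> fock \<Rightarrow> fock" where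
  "create j \<psi> = (\<lambda>S. if j \<in> S then jw_sign j S * \<psi> (S - {j}) else 0)"

definition annih :: "nat \<Rightarrow> fock \<Rightarrow> fock" where
  "annih j \<psi> = (\<lambda>S. if j \<in> S then 0 else jw_sign j S * \<psi> (insert j S))"

definition num_op :: "nat \<Rightarrow> fock \<Rightarrow> fock" where
  "num_op j \<psi> = create j (annih j \<psi>)"

definition vac :: fock where
  "vac = (\<lambda>S. if S = {} then 1 else 0)"

definition fock_inner :: "nat \<Rightarrow> fock \<Rightarrow> fock \<Rightarrow> complex" where
  "fock_inner n \<psi> \<chi> = (\<Sum>S\<in>Pow {..<n}. cnj (\<psi> S) * \<chi> S)"

(* u \<and> (...) for a single-particle vector u *)
definition create_vec :: "nat \<Rightarrow> complex vec \<Rightarrow> fock \<Rightarrow> fock" where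
  "create_vec n u \<psi> = (\<lambda>S. \<Sum>i<n. u $ i * create i \<psi> S)"

definition wedge :: "nat \<Rightarrow> complex vec list \<Rightarrow> fock" where
  "wedge n us = foldr (create_vec n) us vac"

(* e_{s_1} \<and> ... \<and> e_{s_k} \<mapsto> W e_{s_1} \<and> ... \<and> W e_{s_k}, extended linearly *)
definition ext_power :: "nat \<Rightarrow> nat \<Rightarrow> complex mat \<Rightarrow> fock \<Rightarrow> fock" where
  "ext_power n k W \<psi> = (\<lambda>S. \<Sum>T | T \<subseteq> {..<n} \<and> card T = k.
     \<psi> T * wedge n (map (\<lambda>s. W *\<^sub>v unit_vec n s) (sorted_list_of_set T)) S)"


subsection \<open>The encoded state\<close>

definition pair_factor :: "nat \<Rightarrow> fock \<Rightarrow> fock" where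
  "pair_factor b \<psi> = (\<lambda>S. (1 / sqrt 2) *
     (create (4*b) (create (4*b+1) \<psi>) S + create (4*b+2) (create (4*b+3) \<psi>) S))"

definition psi_in :: "nat \<Rightarrow> fock" where
  "psi_in k = foldr pair_factor [0..<k div 2] vac"

definition hadamard :: "nat \<Rightarrow> complex mat" where
  "hadamard n = Matrix.mat n n
     (\<lambda>(p, q). (- 1) ^ card {b. bit p b \<and> bit q b} / complex_of_real (sqrt (real n)))"

definition phase_diag :: "nat \<Rightarrow> (nat \<Rightarrow> real) \<Rightarrow> complex mat" where
  "phase_diag n a = mat_diag n (\<lambda>j. exp (- \<i> * complex_of_real (a j)))"

(* The data point x enters only through its angles a j = \<phi>_j(x). *)
definition psi :: "nat \<Rightarrow> nat \<Rightarrow> (nat \<Rightarrow> real) \<Rightarrow> fock" where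
  "psi n k a = ext_power n k (phase_diag n a * hadamard n) (psi_in k)"

definition rho1 :: "nat \<Rightarrow> nat \<Rightarrow> (nat \<Rightarrow> real) \<Rightarrow> complex mat" where
  "rho1 n k a = Matrix.mat n n
     (\<lambda>(p, q). fock_inner n (psi n k a) (create q (annih p (psi n k a))))"


subsection \<open>Operators on the two-particle space\<close>

(* Y p q r s is the kernel Y^{pq}_{rs}: the operator sends e_r \<and> e_s to
   1/2 \<Sum>_{p,q} Y^{pq}_{rs} e_p \<and> e_q.  Every basis vector e_p \<and> e_q (p < q) occurs twice in an
   unrestricted sum over p, q, whence the factors 1/2 and 1/4. *)

type_synonym kernel2 = "nat \<Rightarrow> nat \<Rightarrow> nat \<Rightarrow> nat \<Rightarrow> complex"

definition k2_id :: kernel2 where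
  "k2_id p q r s = of_bool (p = r \<and> q = s) - of_bool (p = s \<and> q = r)"

definition k2_mult :: "nat \<Rightarrow> kernel2 \<Rightarrow> kernel2 \<Rightarrow> kernel2" where
  "k2_mult n Y Z p q r s = (\<Sum>a<n. \<Sum>b<n. Y p q a b * Z a b r s) / 2"

definition k2_comm :: "nat \<Rightarrow> kernel2 \<Rightarrow> kernel2 \<Rightarrow> kernel2" where
  "k2_comm n Y Z p q r s = k2_mult n Y Z p q r s - k2_mult n Z Y p q r s"

definition k2_adjoint :: "kernel2 \<Rightarrow> kernel2" where
  "k2_adjoint Y p q r s = cnj (Y r s p q)"

(* tr (Y Z) *)
definition k2_trace_prod :: "nat \<Rightarrow> kernel2 \<Rightarrow> kernel2 \<Rightarrow> complex" where
  "k2_trace_prod n Y Z = (\<Sum>p<n. \<Sum>q<n. \<Sum>r<n. \<Sum>s<n. Y p q r s * Z r s p q) / 4"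

definition k2_trace :: "nat \<Rightarrow> kernel2 \<Rightarrow> complex" where
  "k2_trace n Y = k2_trace_prod n Y k2_id"

definition k2_frobenius :: "nat \<Rightarrow> kernel2 \<Rightarrow> real" where
  "k2_frobenius n Y = sqrt (Re (k2_trace_prod n (k2_adjoint Y) Y))"

definition contraction :: "nat \<Rightarrow> kernel2 \<Rightarrow> complex mat" where
  "contraction n Y = Matrix.mat n n (\<lambda>(p, r). \<Sum>q<n. Y p q r q)"

definition mat_frobenius :: "complex mat \<Rightarrow> real" where
  "mat_frobenius A = sqrt (\<Sum>i<dim_row A. \<Sum>j<dim_col A. (cmod (A $$ (i, j)))\<^sup>2)"

(* components of u \<and> v = 1/2 \<Sum>_{p,q} (u \<and> v)^{pq} e_p \<and> e_q *)
definition wedge2 :: "complex vec \<Rightarrow> complex vec \<Rightarrow> nat \<Rightarrow> nat \<Rightarrow> complex" where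
  "wedge2 u v p q = u $ p * v $ q - u $ q * v $ p"

definition dLambda2 :: "nat \<Rightarrow> complex mat \<Rightarrow> kernel2" where
  "dLambda2 n g p q r s =
     wedge2 (g *\<^sub>v unit_vec n r) (unit_vec n s) p q + wedge2 (unit_vec n r) (g *\<^sub>v unit_vec n s) p q"

definition rho2 :: "nat \<Rightarrow> nat \<Rightarrow> (nat \<Rightarrow> real) \<Rightarrow> kernel2" where
  "rho2 n k a p q r s =
     fock_inner n (psi n k a) (create r (create s (annih q (annih p (psi n k a)))))"

definition rho2_g2 :: "nat \<Rightarrow> nat \<Rightarrow> (nat \<Rightarrow> real) \<Rightarrow> kernel2" where
  "rho2_g2 n k a p q r s =
     rho2 n k a p q r s - k2_trace n (rho2 n k a) / of_nat (n choose 2) * k2_id p q r s"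

definition proj_mode :: "nat \<Rightarrow> nat \<Rightarrow> complex mat" where
  "proj_mode n j = Matrix.mat n n (\<lambda>(a, b). of_bool (a = j \<and> b = j))"

definition B_op :: "nat \<Rightarrow> nat \<Rightarrow> (nat \<Rightarrow> real) \<Rightarrow> nat \<Rightarrow> kernel2" where
  "B_op n k a j = k2_comm n (dLambda2 n (proj_mode n j)) (rho2_g2 n k a)"


subsection \<open>Brick-wall circuit\<close>

definition rotation :: "nat \<Rightarrow> nat \<Rightarrow> nat \<Rightarrow> real \<Rightarrow> complex mat" where
  "rotation n a b t = Matrix.mat n n (\<lambda>(i, l).
     if i = a \<and> l = a \<or> i = b \<and> l = b then complex_of_real (cos t)
     else if i = a \<and> l = b then - complex_of_real (sin t)
     else if i = b \<and> l = a then complex_of_real (sin t)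
     else of_bool (i = l))"

(* The m-th pair of column l; in even columns the last pair is (n - 1, 0). *)
definition brick_pair :: "nat \<Rightarrow> nat \<Rightarrow> nat \<Rightarrow> nat \<times> nat" where
  "brick_pair n l m = (if odd l then (2*m, 2*m+1) else (2*m+1, (2*m+2) mod n))"

(* Circuit parameters (\<theta>, \<phi>): \<theta> l m is the angle of the m-th rotation of column l, and
   \<phi> l j is the phase on mode j in column l, with columns counted from 1. *)
type_synonym params = "(nat \<Rightarrow> nat \<Rightarrow> real) \<times> (nat \<Rightarrow> nat \<Rightarrow> real)"

definition rotation_column :: "nat \<Rightarrow> params \<Rightarrow> nat \<Rightarrow> complex mat" where
  "rotation_column n \<omega> l = foldr (*)
     (map (\<lambda>m. case brick_pair n l m of (a, b) \<Rightarrow> rotation n a b (fst \<omega> l m)) [0..<n div 2]) (1\<^sub>m n)"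

definition column :: "nat \<Rightarrow> params \<Rightarrow> nat \<Rightarrow> complex mat" where
  "column n \<omega> l = rotation_column n \<omega> l * phase_diag n (snd \<omega> l)"

fun columns :: "nat \<Rightarrow> params \<Rightarrow> nat \<Rightarrow> complex mat" where
  "columns n \<omega> 0 = 1\<^sub>m n"
| "columns n \<omega> (Suc l) = column n \<omega> (Suc l) * columns n \<omega> l"

definition circuit :: "nat \<Rightarrow> params \<Rightarrow> complex mat" where
  "circuit n \<omega> = columns n \<omega> n"

definition set_front_phase :: "nat \<Rightarrow> real \<Rightarrow> params \<Rightarrow> params" where
  "set_front_phase j t \<omega> = (fst \<omega>, (snd \<omega>)(1 := ((snd \<omega> 1)(j := t))))"


subsection \<open>Loss and its derivatives\<close>

definition loss :: "nat \<Rightarrow> nat \<Rightarrow> (nat \<Rightarrow> real) \<Rightarrow> nat \<Rightarrow> nat \<Rightarrow> complex mat \<Rightarrow> real" where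
  "loss n k a p q W =
     Re (fock_inner n (ext_power n k W (psi n k a))
          (num_op p (num_op q (ext_power n k W (psi n k a)))))"

lemma num_op_apply: "num_op j \<psi> S = (if j \<in> S then \<psi> S else 0)"
proof -
  have "{i \<in> S - {j}. i < j} = {i \<in> S. i < j}" by auto
  moreover have "jw_sign j S * jw_sign j S = 1"
    by (simp add: jw_sign_def flip: power_add)
  ultimately show ?thesis
    by (auto simp: num_op_def create_def annih_def jw_sign_def insert_absorb
        simp flip: mult.assoc)
qed

(* The expectation value is real, so taking the real part in loss loses nothing. *)
lemma of_real_loss:
  "complex_of_real (loss n k a p q W) =
     fock_inner n (ext_power n k W (psi n k a))
       (num_op p (num_op q (ext_power n k W (psi n k a))))"
proof -
  have "cnj (fock_inner n \<chi> (num_op p (num_op q \<chi>))) = fock_inner n \<chi> (num_op p (num_op q \<chi>))" for \<chi>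
    unfolding fock_inner_def by (auto simp: num_op_apply mult.commute intro!: sum.cong)
  then show ?thesis
    by (metis loss_def Reals_cnj_iff of_real_Re)
qed

definition mat_exp :: "complex mat \<Rightarrow> complex mat" where
  "mat_exp A = Matrix.mat (dim_row A) (dim_row A) (\<lambda>ij. \<Sum>m. (A ^\<^sub>m m) $$ ij / fact m)"

definition loss_along_mode ::
  "nat \<Rightarrow> nat \<Rightarrow> (nat \<Rightarrow> real) \<Rightarrow> nat \<Rightarrow> nat \<Rightarrow> nat \<Rightarrow> complex mat \<Rightarrow> real \<Rightarrow> real" where
  "loss_along_mode n k a p q j W s =
     loss n k a p q (W * mat_exp ((- \<i> * complex_of_real s) \<cdot>\<^sub>m proj_mode n j))"

(* D_{n_j} L at W *)
definition mode_deriv ::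
  "nat \<Rightarrow> nat \<Rightarrow> (nat \<Rightarrow> real) \<Rightarrow> nat \<Rightarrow> nat \<Rightarrow> nat \<Rightarrow> complex mat \<Rightarrow> real" where
  "mode_deriv n k a p q j W = deriv (loss_along_mode n k a p q j W) 0"

definition loss_front_phase ::
  "nat \<Rightarrow> nat \<Rightarrow> (nat \<Rightarrow> real) \<Rightarrow> nat \<Rightarrow> nat \<Rightarrow> nat \<Rightarrow> params \<Rightarrow> real \<Rightarrow> real" where
  "loss_front_phase n k a p q j \<omega> t = loss n k a p q (circuit n (set_front_phase j t \<omega>))"

definition phase_deriv ::
  "nat \<Rightarrow> nat \<Rightarrow> (nat \<Rightarrow> real) \<Rightarrow> nat \<Rightarrow> nat \<Rightarrow> nat \<Rightarrow> params \<Rightarrow> real" where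
  "phase_deriv n k a p q j \<omega> = deriv (loss_front_phase n k a p q j \<omega>) (snd \<omega> 1 j)"


subsection \<open>Haar measure and initialization\<close>

definition unitary_group :: "nat \<Rightarrow> complex mat set" where
  "unitary_group n = {W \<in> carrier_mat n n. mat_adjoint W * W = 1\<^sub>m n}"

(* the Borel sets of U(n), generated by the matrix entries *)
definition unitary_borel :: "nat \<Rightarrow> complex mat measure" where
  "unitary_borel n = sigma (unitary_group n)
     {{W \<in> unitary_group n. W $$ (i, j) \<in> A} | i j A. i < n \<and> j < n \<and> open A}"

definition is_haar :: "nat \<Rightarrow> complex mat measure \<Rightarrow> bool" where
  "is_haar n \<mu> \<longleftrightarrow> prob_space \<mu> \<and> sets \<mu> = sets (unitary_borel n) \<and>
     (\<forall>V\<in>unitary_group n. distr \<mu> \<mu> (\<lambda>W. V * W) = \<mu> \<and> distr \<mu> \<mu> (\<lambda>W. W * V) = \<mu>)"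

(* P is the law of the initial parameters.  Sampling W from Haar measure and decomposing it as
   W = circuit n \<omega> is one instance; nothing beyond the law of the realized W is assumed. *)
definition haar_initialized :: "nat \<Rightarrow> params measure \<Rightarrow> bool" where
  "haar_initialized n P \<longleftrightarrow> prob_space P \<and> circuit n \<in> measurable P (unitary_borel n) \<and>
     is_haar n (distr P (unitary_borel n) (circuit n))"

definition admissible :: "nat \<Rightarrow> nat \<Rightarrow> bool" where
  "admissible n k \<longleftrightarrow> (\<exists>K. n = 2 ^ K) \<and> even k \<and> 2 \<le> k \<and> 2 * k \<le> n"

end

theory Submission
  imports Defs
begin

text \<open>The front phases act on the input side of the circuit, so shifting \<open>\<phi>\<^sub>j\<close> multiplies \<open>W\<close> from the
  right by \<open>exp (-\<i> s n\<^sub>j)\<close>. Since annihilators pull back through \<open>\<Lambda>(W)\<close>, the loss is the quadratic form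
  \<open>\<langle>v, \<rho>\<^sub>2 v\<rangle>\<close> in the 2x2 minors \<open>v\<^sub>a\<^sub>b\<close> of rows \<open>p\<close>, \<open>q\<close> of \<open>W\<close>, and its gradient is \<open>2 Re g\<close>, where \<open>g\<close>
  collects the terms \<open>v\<^sub>j\<^sub>d cnj v\<^sub>b\<^sub>c\<close> with \<open>b, c, d \<noteq> j\<close>. Right invariance of Haar measure under a phase on mode
  \<open>j\<close> gives \<open>E g = E g\<^sup>2 = 0\<close>, so the variance is \<open>2 E |g|\<^sup>2\<close>. This needs only fourth moments of minors, which
  are determined by invariance under diagonal phases, permutations and a single rotation by \<open>\<pi>/4\<close>, together
  with the Pluecker relation and \<open>\<Sum> |v\<^sub>a\<^sub>b|\<^sup>2 = 2\<close>.

  For the asymptotics, \<open>\<rho>\<^sub>1\<close> is half a projection of rank \<open>2k\<close> in a flat basis, which gives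
  \<open>\<parallel>\<Gamma>(B)\<parallel>\<^sup>2 = (k-1)\<^sup>2 k (n - 2k) / n\<^sup>2\<close> exactly, while \<open>\<parallel>B\<parallel>\<^sup>2 \<le> k\<^sup>3/n\<close> follows from
  \<open>\<parallel>f(w)\<parallel> \<le> \<parallel>w\<parallel>\<close> for annihilators.\<close>

subsection \<open>Second quantization\<close>

text \<open>The constant \<open>n^2 * (n^2 - 1)\<close> is a dimension. The minors are the Pluecker
  coordinates of a decomposable unit 2-vector v, so v tensor v lies in the irreducible component of
  shape (2,2), of dimension n^2 (n^2 - 1) / 12, and the Haar average of its projector is the
  projection onto that component divided by this number. The proof reaches the same values by
  elementary means: the moments of |v_ab|^2 |v_cd|^2 with two, one or no shared modes stand in the
  ratio 6 : 3 : 2. Minors are not independent, since the Pluecker relation couples v_jd v_bc with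
  v_jb v_dc. This coupling is what produces the contraction term besides the norm of B. The
  contraction is computable exactly and alone supplies the lower bound, so B only has to be bounded
  from above. Fock space identities are proved by removing particles one at a time, with the number
  operator in the role of Cauchy-Binet. The factor one half in the one-body matrix reflects that the
  two fillings of each input block have equal weight.\<close>

definition fock_supp :: "nat \<Rightarrow> nat \<Rightarrow> fock \<Rightarrow> bool" where
  "fock_supp n m \<psi> \<longleftrightarrow> (\<forall>S. \<psi> S \<noteq> 0 \<longrightarrow> S \<subseteq> {..<n} \<and> card S = m)"

lemma jw_sign_insert:
  "j \<notin> S \<Longrightarrow> jw_sign i (insert j S) = (if j < i then - 1 else 1) * jw_sign i S"
proof -
  assume j: "j \<notin> S"
  have "{l \<in> insert j S. l < i} = (if j < i then insert j {l \<in> S. l < i} else {l \<in> S. l < i})"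
    by auto
  moreover have "finite {l \<in> S. l < i}" by (rule finite_subset[of _ "{..<i}"]) auto
  ultimately show ?thesis using j by (auto simp: jw_sign_def)
qed

lemma jw_sign_remove:
  "j \<in> S \<Longrightarrow> jw_sign i (S - {j}) = (if j < i then - 1 else 1) * jw_sign i S"
  using jw_sign_insert[of j "S - {j}" i] by (auto simp: insert_absorb)

lemma jw_sign_sq [simp]: "jw_sign i S * jw_sign i S = 1"
  by (simp add: jw_sign_def flip: power_add)

lemma jw_sign_sq_left [simp]: "jw_sign i S * (jw_sign i S * x) = x"
  by (simp flip: mult.assoc)

lemma cnj_jw_sign [simp]: "cnj (jw_sign i S) = jw_sign i S"
  by (simp add: jw_sign_def)

text \<open>The canonical anticommutation relations, here and in the next two lemmas, amplitude by
  amplitude. For distinct modes the string of the larger one gains or loses exactly one occupied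
  mode, which is the minus sign; for equal modes it is occupation bookkeeping.\<close>

lemma annih_create:
  "annih i (create j \<psi>) S = (if i = j then \<psi> S else 0) - create j (annih i \<psi>) S"
  by (cases "i = j")
     (auto simp: annih_def create_def jw_sign_insert jw_sign_remove insert_absorb insert_Diff_if)

lemma create_create: "create i (create j \<psi>) S = - create j (create i \<psi>) S"
  by (cases "i = j")
     (auto simp: create_def jw_sign_remove Diff_insert2[symmetric] insert_commute)

lemma annih_annih: "annih i (annih j \<psi>) S = - annih j (annih i \<psi>) S"
  by (cases "i = j") (auto simp: annih_def jw_sign_insert insert_commute)

lemma annih_sum: "annih i (\<lambda>S. \<Sum>x\<in>X. c x * \<psi> x S) S = (\<Sum>x\<in>X. c x * annih i (\<psi> x) S)"
  by (auto simp: annih_def sum_distrib_left algebra_simps intro!: sum.cong)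

lemma create_sum: "create i (\<lambda>S. \<Sum>x\<in>X. c x * \<psi> x S) S = (\<Sum>x\<in>X. c x * create i (\<psi> x) S)"
  by (auto simp: create_def sum_distrib_left algebra_simps intro!: sum.cong)

lemma annih_supp: "fock_supp n (Suc m) \<psi> \<Longrightarrow> fock_supp n m (annih i \<psi>)"
proof (unfold fock_supp_def, intro allI impI)
  fix S assume *: "\<forall>S. \<psi> S \<noteq> 0 \<longrightarrow> S \<subseteq> {..<n} \<and> card S = Suc m" and "annih i \<psi> S \<noteq> 0"
  then have "i \<notin> S" "\<psi> (insert i S) \<noteq> 0" by (auto simp: annih_def split: if_splits)
  then have a: "insert i S \<subseteq> {..<n}" "card (insert i S) = Suc m" using * by auto
  then have "finite S" using finite_subset by (metis finite_insert finite_lessThan)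
  then show "S \<subseteq> {..<n} \<and> card S = m" using a \<open>i \<notin> S\<close> by simp
qed

lemma fock_supp_sum:
  "(\<And>x. x \<in> X \<Longrightarrow> fock_supp n m (\<psi> x)) \<Longrightarrow> fock_supp n m (\<lambda>S. \<Sum>x\<in>X. c x * \<psi> x S)"
  unfolding fock_supp_def
  by (metis (mono_tags, lifting) mult_eq_0_iff sum.neutral)

text \<open>Removing \<open>j\<close> matches the sets that contain \<open>j\<close> with those that
  do not, and the sign of \<open>j\<close> does not see \<open>j\<close> itself. The bound on
  \<open>j\<close> keeps the matching inside the subsets of the modes.\<close>

lemma fock_inner_create:
  assumes "j < n"
  shows "fock_inner n \<psi> (create j \<chi>) = fock_inner n (annih j \<psi>) \<chi>"
proof -
  have "fock_inner n \<psi> (create j \<chi>)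
      = (\<Sum>S\<in>{S\<in>Pow {..<n}. j \<in> S}. cnj (\<psi> S) * (jw_sign j S * \<chi> (S - {j})))"
    unfolding fock_inner_def create_def by (rule sum.mono_neutral_cong_right) auto
  also have "\<dots> = (\<Sum>S\<in>{S\<in>Pow {..<n}. j \<notin> S}. cnj (jw_sign j S * \<psi> (insert j S)) * \<chi> S)"
    by (rule sum.reindex_bij_witness[of _ "insert j" "\<lambda>S. S - {j}"])
       (use assms in \<open>auto simp: insert_absorb jw_sign_insert jw_sign_remove\<close>)
  also have "\<dots> = fock_inner n (annih j \<psi>) \<chi>"
    unfolding fock_inner_def annih_def by (rule sum.mono_neutral_cong_left) auto
  finally show ?thesis .
qed

lemma fock_inner_sum_right:
  "fock_inner n \<psi> (\<lambda>S. \<Sum>x\<in>X. c x * \<chi> x S) = (\<Sum>x\<in>X. c x * fock_inner n \<psi> (\<chi> x))"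
  by (simp add: fock_inner_def sum_distrib_left mult.left_commute) (rule sum.swap)

lemma fock_inner_sum_left:
  "fock_inner n (\<lambda>S. \<Sum>x\<in>X. c x * \<chi> x S) \<psi> = (\<Sum>x\<in>X. cnj (c x) * fock_inner n (\<chi> x) \<psi>)"
  by (simp add: fock_inner_def sum_distrib_left sum_distrib_right mult.assoc) (rule sum.swap)

lemma cnj_fock_inner: "cnj (fock_inner n \<psi> \<chi>) = fock_inner n \<chi> \<psi>"
  by (simp add: fock_inner_def mult.commute)

lemma fock_inner_self: "fock_inner n \<psi> \<psi> = of_real (\<Sum>S\<in>Pow {..<n}. (cmod (\<psi> S))\<^sup>2)"
  by (simp add: fock_inner_def complex_norm_square mult.commute del: of_real_power)

lemma number_operator:
  assumes "fock_supp n m \<psi>"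
  shows "(\<Sum>p<n. num_op p \<psi> S) = of_nat m * \<psi> S"
proof (cases "\<psi> S = 0")
  case False
  then have "S \<subseteq> {..<n}" "card S = m" using assms by (auto simp: fock_supp_def)
  have "(\<Sum>p<n. num_op p \<psi> S) = (\<Sum>p\<in>S. \<psi> S)"
    unfolding num_op_apply by (rule sum.mono_neutral_cong_right) (use \<open>S \<subseteq> _\<close> in auto)
  with \<open>card S = m\<close> show ?thesis by simp
qed (simp add: num_op_apply)

text \<open>The number operator reduces an inner product of m-particle vectors to vectors with one
  particle fewer. This drives the induction behind \<open>fock_inner_ext_power\<close> and evaluates
  partial traces.\<close>

lemma fock_inner_number:
  assumes "fock_supp n m \<psi>"
  shows "(\<Sum>p<n. fock_inner n (annih p \<chi>) (annih p \<psi>)) = of_nat m * fock_inner n \<chi> \<psi>"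
proof -
  have "(\<Sum>p<n. fock_inner n (annih p \<chi>) (annih p \<psi>)) = (\<Sum>p<n. fock_inner n \<chi> (num_op p \<psi>))"
    by (auto simp: num_op_def fock_inner_create intro!: sum.cong)
  also have "\<dots> = fock_inner n \<chi> (\<lambda>S. \<Sum>p<n. 1 * num_op p \<psi> S)"
    by (subst fock_inner_sum_right) simp
  \<comment> \<open>The scalar is written as a one-term sum so that
    \<open>fock_inner_sum_right\<close> can extract it.\<close>
  also have "\<dots> = fock_inner n \<chi> (\<lambda>S. \<Sum>p\<in>{..<1::nat}. of_nat m * \<psi> S)"
    using number_operator[OF assms] by simp
  also have "\<dots> = of_nat m * fock_inner n \<chi> \<psi>" by (subst fock_inner_sum_right) simp
  finally show ?thesis .
qed

text \<open>Linear in \<open>w\<close>, without conjugation, so that a row of \<open>W\<close> can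
  be inserted as it stands.\<close>

definition annih_vec :: "nat \<Rightarrow> (nat \<Rightarrow> complex) \<Rightarrow> fock \<Rightarrow> fock" where
  "annih_vec n w \<psi> = (\<lambda>S. \<Sum>a<n. w a * annih a \<psi> S)"

lemma annih_vec_supp: "fock_supp n (Suc m) \<psi> \<Longrightarrow> fock_supp n m (annih_vec n w \<psi>)"
  unfolding annih_vec_def by (intro fock_supp_sum annih_supp)

lemma annih_create_vec:
  assumes "p < n"
  shows "annih p (create_vec n u \<psi>) S = u $ p * \<psi> S - create_vec n u (annih p \<psi>) S"
proof -
  have "annih p (create_vec n u \<psi>) S = (\<Sum>i<n. u $ i * ((if p = i then \<psi> S else 0) - create i (annih p \<psi>) S))"
    unfolding create_vec_def by (simp add: annih_sum annih_create)
  also have "\<dots> = (\<Sum>i<n. (if p = i then u $ i * \<psi> S else 0)) - create_vec n u (annih p \<psi>) S"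
    unfolding create_vec_def sum_subtractf[symmetric] by (intro sum.cong) (auto simp: algebra_simps)
  finally show ?thesis using assms by simp
qed

lemma create_supp: "i < n \<Longrightarrow> fock_supp n m \<psi> \<Longrightarrow> fock_supp n (Suc m) (create i \<psi>)"
proof (unfold fock_supp_def, intro allI impI)
  fix S assume *: "i < n" "\<forall>S. \<psi> S \<noteq> 0 \<longrightarrow> S \<subseteq> {..<n} \<and> card S = m" "create i \<psi> S \<noteq> 0"
  then have a: "i \<in> S" "\<psi> (S - {i}) \<noteq> 0" by (auto simp: create_def split: if_splits)
  then have b: "S - {i} \<subseteq> {..<n}" "card (S - {i}) = m" using * by auto
  then have "finite S" by (metis finite_Diff2 finite.emptyI finite_insert finite_lessThan finite_subset)
  then have "card S = Suc m" using a b by (metis card.remove)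
  then show "S \<subseteq> {..<n} \<and> card S = Suc m" using a b *(1) by auto
qed

lemma wedge_supp: "fock_supp n (length us) (wedge n us)"
proof (induction us)
  case Nil
  then show ?case by (auto simp: wedge_def vac_def fock_supp_def)
next
  case (Cons u us)
  have "wedge n (u # us) = (\<lambda>S. \<Sum>i<n. u $ i * create i (wedge n us) S)"
    by (simp add: wedge_def create_vec_def)
  with Cons show ?case by (auto intro!: fock_supp_sum create_supp)
qed

lemma ext_power_supp: "fock_supp n k (ext_power n k W \<psi>)"
  unfolding ext_power_def by (rule fock_supp_sum) (use wedge_supp[of n "map _ (sorted_list_of_set _)"] in auto)

lemma sorted_list_of_set_insert_min:
  "finite A \<Longrightarrow> \<forall>a\<in>A. b < a \<Longrightarrow> sorted_list_of_set (insert b A) = b # sorted_list_of_set A"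
  by (subst sorted_list_of_set_insert) (auto simp: insort_is_Cons less_imp_le)

text \<open>Anticommuting \<open>annih p\<close> through the product of creators is Laplace
  expansion along a row. The induction adds a new smallest element because the smallest mode stands
  leftmost in the wedge.\<close>

lemma annih_wedge:
  assumes "finite T" "p < n"
  shows "annih p (wedge n (map f (sorted_list_of_set T))) S =
    (\<Sum>t\<in>T. jw_sign t T * f t $ p * wedge n (map f (sorted_list_of_set (T - {t}))) S)"
  using assms(1)
proof (induction T arbitrary: S rule: finite_linorder_min_induct)
  case empty
  then show ?case by (simp add: wedge_def annih_def vac_def)
next
  case (insert b A)
  let ?w = "\<lambda>T. wedge n (map f (sorted_list_of_set T))"
  have b: "b \<notin> A" using insert by auto
  have rec: "?w (insert b A) = create_vec n (f b) (?w A)" if "finite A" "\<forall>a\<in>A. b < a" for A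
    using sorted_list_of_set_insert_min[OF that] by (simp add: wedge_def del: sorted_list_of_set_insert_remove)
  have "annih p (?w (insert b A)) S = f b $ p * ?w A S - create_vec n (f b) (annih p (?w A)) S"
    by (simp add: rec insert.hyps annih_create_vec assms del: sorted_list_of_set_insert_remove)
  also have "annih p (?w A) = (\<lambda>S. \<Sum>t\<in>A. jw_sign t A * f t $ p * ?w (A - {t}) S)"
    by (rule ext) (rule insert.IH)
  also have "create_vec n (f b) \<dots> S = (\<Sum>t\<in>A. jw_sign t A * f t $ p * create_vec n (f b) (?w (A - {t})) S)"
    unfolding create_vec_def create_sum sum_distrib_left
    by (subst sum.swap) (simp add: algebra_simps)
  also have "\<dots> = (\<Sum>t\<in>A. jw_sign t A * f t $ p * ?w (insert b A - {t}) S)"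
  proof (intro sum.cong refl arg_cong2[where f="(*)"])
    fix t assume "t \<in> A"
    then have "insert b A - {t} = insert b (A - {t})" using b by auto
    then show "create_vec n (f b) (?w (A - {t})) S = ?w (insert b A - {t}) S"
      using rec[of "A - {t}"] insert.hyps by simp
  qed
  \<comment> \<open>The new smallest mode \<open>b\<close> flips the sign of every later
    \<open>t\<close>, which absorbs the minus of the anticommutation.\<close>
  also have "\<dots> = - (\<Sum>t\<in>A. jw_sign t (insert b A) * f t $ p * ?w (insert b A - {t}) S)"
    using insert.hyps b by (auto simp: jw_sign_insert sum_negf[symmetric] intro!: sum.cong)
  also have "f b $ p * ?w A S = jw_sign b (insert b A) * f b $ p * ?w (insert b A - {b}) S"
  proof -
    have "{i \<in> insert b A. i < b} = {}" using insert.hyps by auto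
    then show ?thesis using b by (simp add: jw_sign_def del: Collect_empty_eq)
  qed
  finally show ?case using insert.hyps b by simp
qed

text \<open>The intertwining relation f_p Lambda(W) = Lambda(W) f(row p of W). Both sides range over
  the same data: a set with a marked element on the left, the smaller set with a marked absent mode
  on the right.\<close>

lemma annih_ext_power:
  assumes "p < n" and W: "W \<in> carrier_mat n n"
  shows "annih p (ext_power n (Suc m) W \<psi>) S = ext_power n m W (annih_vec n (\<lambda>a. W $$ (p, a)) \<psi>) S"
proof -
  let ?w = "\<lambda>T. wedge n (map (\<lambda>s. W *\<^sub>v unit_vec n s) (sorted_list_of_set T))"
  let ?D = "\<lambda>k. {T. T \<subseteq> {..<n} \<and> card T = k}"
  have fin: "finite (?D k)" for k by (rule finite_subset[of _ "Pow {..<n}"]) auto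
  have finT: "finite T" if "T \<in> ?D k" for T k using that finite_subset by blast
  have ent: "(W *\<^sub>v unit_vec n t) $ p = W $$ (p, t)" if "t < n" for t
    using that W assms(1) by simp
  have "annih p (ext_power n (Suc m) W \<psi>) S = (\<Sum>T\<in>?D (Suc m). \<psi> T * annih p (?w T) S)"
    unfolding ext_power_def by (rule annih_sum)
  also have "\<dots> = (\<Sum>T\<in>?D (Suc m). \<Sum>t\<in>T. \<psi> T * jw_sign t T * W $$ (p, t) * ?w (T - {t}) S)"
  proof (intro sum.cong refl)
    fix T assume T: "T \<in> ?D (Suc m)"
    then have "annih p (?w T) S = (\<Sum>t\<in>T. jw_sign t T * (W *\<^sub>v unit_vec n t) $ p * ?w (T - {t}) S)"
      using annih_wedge finT assms(1) by blast
    also have "\<dots> = (\<Sum>t\<in>T. jw_sign t T * W $$ (p, t) * ?w (T - {t}) S)"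
      using T by (intro sum.cong refl) (auto simp: ent subset_eq)
    finally show "\<psi> T * annih p (?w T) S = (\<Sum>t\<in>T. \<psi> T * jw_sign t T * W $$ (p, t) * ?w (T - {t}) S)"
      by (simp add: sum_distrib_left mult.assoc)
  qed
  also have "\<dots> = (\<Sum>(T, t)\<in>Sigma (?D (Suc m)) (\<lambda>T. T). \<psi> T * jw_sign t T * W $$ (p, t) * ?w (T - {t}) S)"
    by (rule sum.Sigma) (auto intro: fin finT)
  also have "\<dots> = (\<Sum>(T, a)\<in>Sigma (?D m) (\<lambda>T. {..<n} - T). W $$ (p, a) * (jw_sign a T * \<psi> (insert a T)) * ?w T S)"
  proof (rule sum.reindex_bij_witness[of _ "\<lambda>(T, a). (insert a T, a)" "\<lambda>(T, t). (T - {t}, t)"])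
    fix x assume "x \<in> Sigma (?D (Suc m)) (\<lambda>T. T)"
    then obtain T t where x: "x = (T, t)" "T \<subseteq> {..<n}" "card T = Suc m" "t \<in> T" by auto
    then have "finite T" using finT by blast
    with x show "(\<lambda>(T, t). (T - {t}, t)) x \<in> Sigma (?D m) (\<lambda>T. {..<n} - T)" by auto
  next
    fix x assume "x \<in> Sigma (?D m) (\<lambda>T. {..<n} - T)"
    then obtain T t where x: "x = (T, t)" "T \<subseteq> {..<n}" "card T = m" "t \<notin> T" "t < n" by auto
    then have "finite T" using finT by blast
    with x show "(\<lambda>(T, a). (insert a T, a)) x \<in> Sigma (?D (Suc m)) (\<lambda>T. T)" by auto
  qed (auto simp: insert_absorb jw_sign_remove)
  also have "\<dots> = (\<Sum>T\<in>?D m. \<Sum>a\<in>{..<n} - T. W $$ (p, a) * (jw_sign a T * \<psi> (insert a T)) * ?w T S)"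
    by (rule sum.Sigma[symmetric]) (auto intro: fin)
  also have "\<dots> = (\<Sum>T\<in>?D m. annih_vec n (\<lambda>a. W $$ (p, a)) \<psi> T * ?w T S)"
    unfolding annih_vec_def sum_distrib_right annih_def
    by (intro sum.cong[OF refl] sum.mono_neutral_cong_left) auto
  finally show ?thesis by (simp add: ext_power_def)
qed

lemma fock_inner_annih_vec:
  "fock_inner n (annih_vec n u \<psi>) (annih_vec n w \<chi>) =
    (\<Sum>a<n. \<Sum>b<n. cnj (u a) * w b * fock_inner n (annih a \<psi>) (annih b \<chi>))"
  unfolding annih_vec_def fock_inner_sum_left fock_inner_sum_right
  by (simp add: sum_distrib_left mult.assoc)

text \<open>Induction on the particle number: annihilate once, pull the annihilator back through
  \<open>W\<close>, and the orthonormal columns collapse the double sum to the number operator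
  again.\<close>

lemma fock_inner_ext_power:
  assumes W: "W \<in> carrier_mat n n"
    and uni: "\<And>a b. a < n \<Longrightarrow> b < n \<Longrightarrow> (\<Sum>p<n. cnj (W $$ (p, a)) * W $$ (p, b)) = of_bool (a = b)"
    and "fock_supp n m \<psi>" "fock_supp n m \<chi>"
  shows "fock_inner n (ext_power n m W \<psi>) (ext_power n m W \<chi>) = fock_inner n \<psi> \<chi>"
  using assms(3,4)
proof (induction m arbitrary: \<psi> \<chi>)
  case 0
  have "ext_power n 0 W \<phi> S = \<phi> {} * vac S" for \<phi> S
  proof -
    have "{T. T \<subseteq> {..<n} \<and> card T = 0} = {{}}"
      using finite_subset by fastforce
    then show ?thesis by (simp add: ext_power_def wedge_def)
  qed
  moreover have "\<phi> S = \<phi> {} * vac S" if "fock_supp n 0 \<phi>" for \<phi> S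
  proof -
    have "\<phi> S = 0" if "S \<noteq> {}"
      using \<open>fock_supp n 0 \<phi>\<close> that unfolding fock_supp_def
      by (metis card_eq_0_iff finite_lessThan finite_subset)
    then show ?thesis by (auto simp: vac_def)
  qed
  ultimately have "ext_power n 0 W \<psi> = \<psi>" "ext_power n 0 W \<chi> = \<chi>" using 0 by (auto intro!: ext)
  then show ?case by simp
next
  case (Suc m)
  let ?a = "\<lambda>p. annih_vec n (\<lambda>a. W $$ (p, a))"
  have "of_nat (Suc m) * fock_inner n (ext_power n (Suc m) W \<psi>) (ext_power n (Suc m) W \<chi>)
    = (\<Sum>p<n. fock_inner n (annih p (ext_power n (Suc m) W \<psi>)) (annih p (ext_power n (Suc m) W \<chi>)))"
    by (rule fock_inner_number[symmetric]) (rule ext_power_supp)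
  also have "\<dots> = (\<Sum>p<n. fock_inner n (ext_power n m W (?a p \<psi>)) (ext_power n m W (?a p \<chi>)))"
    using W by (intro sum.cong refl arg_cong2[where f="fock_inner n"] ext annih_ext_power) auto
  also have "\<dots> = (\<Sum>p<n. fock_inner n (?a p \<psi>) (?a p \<chi>))"
    by (intro sum.cong refl Suc.IH annih_vec_supp Suc.prems)
  also have "\<dots> = (\<Sum>a<n. \<Sum>b<n. (\<Sum>p<n. cnj (W $$ (p, a)) * W $$ (p, b)) * fock_inner n (annih a \<psi>) (annih b \<chi>))"
    unfolding fock_inner_annih_vec sum_distrib_right
    by (subst sum.swap) (intro sum.cong refl sum.swap)
  also have "\<dots> = (\<Sum>a<n. fock_inner n (annih a \<psi>) (annih a \<chi>))"
    by (intro sum.cong refl) (simp add: uni)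
  also have "\<dots> = of_nat (Suc m) * fock_inner n \<psi> \<chi>"
    by (rule fock_inner_number) (rule Suc.prems)
  finally show ?case by (simp del: of_nat_Suc)
qed

subsection \<open>Unitary matrices\<close>

lemma mat_mult_entry:
  "\<lbrakk>W \<in> carrier_mat n n; V \<in> carrier_mat n n; i < n; a < n\<rbrakk>
    \<Longrightarrow> (W * V) $$ (i, a) = (\<Sum>c<n. W $$ (i, c) * V $$ (c, a))"
  by (auto simp: scalar_prod_def lessThan_atLeast0 intro!: sum.cong)

lemma mat_adjoint_carrier: "V \<in> carrier_mat n n \<Longrightarrow> mat_adjoint V \<in> carrier_mat n n"
  by (auto simp: mat_adjoint_def)

lemma mat_adjoint_entry:
  "\<lbrakk>V \<in> carrier_mat n n; i < n; j < n\<rbrakk> \<Longrightarrow> mat_adjoint V $$ (i, j) = cnj (V $$ (j, i))"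
  by (auto simp: mat_adjoint_def mat_of_rows_index conjugate_complex_def)

lemma unitary_group_iff:
  "V \<in> unitary_group n \<longleftrightarrow> V \<in> carrier_mat n n \<and>
    (\<forall>a<n. \<forall>b<n. (\<Sum>i<n. cnj (V $$ (i, a)) * V $$ (i, b)) = of_bool (a = b))"
proof (cases "V \<in> carrier_mat n n")
  case True
  have "mat_adjoint V * V = 1\<^sub>m n \<longleftrightarrow> (\<forall>a<n. \<forall>b<n. (mat_adjoint V * V) $$ (a, b) = 1\<^sub>m n $$ (a, b))"
    using True mat_adjoint_carrier[OF True] by (auto intro!: eq_matI simp del: index_mult_mat(1))
  also have "\<dots> \<longleftrightarrow> (\<forall>a<n. \<forall>b<n. (\<Sum>i<n. cnj (V $$ (i, a)) * V $$ (i, b)) = of_bool (a = b))"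
    using True mat_adjoint_carrier[OF True]
    by (intro all_cong1 imp_cong refl) (auto simp: mat_mult_entry mat_adjoint_entry simp del: index_mult_mat)
  finally show ?thesis using True by (simp add: unitary_group_def)
qed (simp add: unitary_group_def)

text \<open>A left inverse of a square matrix is also a right inverse, so orthonormal columns give
  orthonormal rows.\<close>

lemma unitary_group_rows:
  assumes "V \<in> unitary_group n" "p < n" "q < n"
  shows "(\<Sum>a<n. V $$ (p, a) * cnj (V $$ (q, a))) = of_bool (p = q)"
proof -
  have V: "V \<in> carrier_mat n n" "mat_adjoint V * V = 1\<^sub>m n" using assms by (auto simp: unitary_group_def)
  have "V * mat_adjoint V = 1\<^sub>m n"
    by (rule mat_mult_left_right_inverse[OF mat_adjoint_carrier[OF V(1)] V(1) V(2)])
  then have "(V * mat_adjoint V) $$ (p, q) = of_bool (p = q)" using assms by simp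
  then show ?thesis
    using V mat_adjoint_carrier[OF V(1)] assms
    by (simp add: mat_mult_entry mat_adjoint_entry del: index_mult_mat)
qed

lemma unitary_group_mult:
  assumes "V \<in> unitary_group n" "W \<in> unitary_group n"
  shows "V * W \<in> unitary_group n"
proof -
  have c: "V \<in> carrier_mat n n" "W \<in> carrier_mat n n" using assms by (auto simp: unitary_group_def)
  have "(\<Sum>i<n. cnj ((V * W) $$ (i, a)) * (V * W) $$ (i, b)) = of_bool (a = b)" if "a < n" "b < n" for a b
  proof -
    have "(\<Sum>i<n. cnj ((V * W) $$ (i, a)) * (V * W) $$ (i, b))
      = (\<Sum>i<n. \<Sum>c<n. \<Sum>d<n. cnj (W $$ (c, a)) * W $$ (d, b) * (cnj (V $$ (i, c)) * V $$ (i, d)))"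
    proof (intro sum.cong refl)
      fix i assume "i \<in> {..<n}"
      then have "cnj ((V * W) $$ (i, a)) * (V * W) $$ (i, b)
        = (\<Sum>c<n. cnj (V $$ (i, c)) * cnj (W $$ (c, a))) * (\<Sum>d<n. V $$ (i, d) * W $$ (d, b))"
        using that c by (simp add: mat_mult_entry del: index_mult_mat)
      then show "cnj ((V * W) $$ (i, a)) * (V * W) $$ (i, b)
        = (\<Sum>c<n. \<Sum>d<n. cnj (W $$ (c, a)) * W $$ (d, b) * (cnj (V $$ (i, c)) * V $$ (i, d)))"
        unfolding sum_product by (simp add: mult_ac)
    qed
    also have "\<dots> = (\<Sum>c<n. \<Sum>d<n. cnj (W $$ (c, a)) * W $$ (d, b) * (\<Sum>i<n. cnj (V $$ (i, c)) * V $$ (i, d)))"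
      unfolding sum_distrib_left by (subst sum.swap) (intro sum.cong refl sum.swap)
    also have "\<dots> = (\<Sum>c<n. cnj (W $$ (c, a)) * W $$ (c, b))"
      using assms(1) by (intro sum.cong refl) (auto simp: unitary_group_iff if_distrib sum.delta cong: if_cong)
    finally show ?thesis using assms(2) that by (simp add: unitary_group_iff)
  qed
  then show ?thesis using c by (simp add: unitary_group_iff del: index_mult_mat)
qed

lemma phase_diag_carrier [simp]: "phase_diag n a \<in> carrier_mat n n"
  by (simp add: phase_diag_def mat_diag_def)

lemma phase_diag_unitary: "phase_diag n a \<in> unitary_group n"
proof -
  have "(\<Sum>i<n. cnj (phase_diag n a $$ (i, c)) * phase_diag n a $$ (i, d)) = of_bool (c = d)"
    if "c < n" "d < n" for c d
  proof -
    have "(\<Sum>i<n. cnj (phase_diag n a $$ (i, c)) * phase_diag n a $$ (i, d))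
      = (\<Sum>i<n. if i = c then of_bool (c = d) else 0)"
      using that
      by (intro sum.cong refl) (auto simp: phase_diag_def mat_diag_def exp_cnj mult_exp_exp)
    then show ?thesis using that by simp
  qed
  then show ?thesis by (simp add: unitary_group_iff)
qed

lemma mult_phase_diag_entry:
  "\<lbrakk>W \<in> carrier_mat n n; i < n; b < n\<rbrakk>
    \<Longrightarrow> (W * phase_diag n a) $$ (i, b) = W $$ (i, b) * exp (- \<i> * complex_of_real (a b))"
  unfolding phase_diag_def by (simp add: mat_diag_mult_right del: index_mult_mat)

lemma rotation_carrier [simp]: "rotation n a b t \<in> carrier_mat n n"
  by (simp add: rotation_def)

lemma mult_rotation_entry:
  assumes "W \<in> carrier_mat n n" "i < n" "l < n" "a < n" "b < n" "a \<noteq> b"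
  shows "(W * rotation n a b t) $$ (i, l) =
    (if l = a then complex_of_real (cos t) * W $$ (i, a) + complex_of_real (sin t) * W $$ (i, b)
     else if l = b then complex_of_real (cos t) * W $$ (i, b) - complex_of_real (sin t) * W $$ (i, a)
     else W $$ (i, l))"
proof -
  have "(W * rotation n a b t) $$ (i, l) = (\<Sum>c<n. W $$ (i, c) * rotation n a b t $$ (c, l))"
    using assms by (intro mat_mult_entry) auto
  also have "\<dots> = (\<Sum>c<n. (if c = a then W $$ (i, a) * rotation n a b t $$ (a, l) else 0)
      + (if c = b then W $$ (i, b) * rotation n a b t $$ (b, l) else 0)
      + (if c = l then (if l = a \<or> l = b then 0 else W $$ (i, l)) else 0))"
    using assms by (intro sum.cong refl) (auto simp: rotation_def)
  also have "\<dots> = W $$ (i, a) * rotation n a b t $$ (a, l) + W $$ (i, b) * rotation n a b t $$ (b, l)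
      + (if l = a \<or> l = b then 0 else W $$ (i, l))"
    using assms by (simp add: sum.distrib)
  finally show ?thesis using assms by (auto simp: rotation_def simp del: index_mult_mat)
qed

lemma rotation_unitary:
  assumes "a < n" "b < n" "a \<noteq> b"
  shows "rotation n a b t \<in> unitary_group n"
proof -
  let ?R = "rotation n a b t"
  let ?A = "mat_adjoint ?R"
  have A: "?A \<in> carrier_mat n n" by (intro mat_adjoint_carrier) simp
  have "(?A * ?R) $$ (i, l) = 1\<^sub>m n $$ (i, l)" if "i < n" "l < n" for i l
  proof -
    have "of_real (sin t) * of_real (sin t) + of_real (cos t) * of_real (cos t) = (1::complex)"
      by (metis of_real_1 of_real_add of_real_mult power2_eq_square sin_cos_squared_add)
    then have "of_real (cos t) * of_real (cos t) + of_real (sin t) * of_real (sin t) = (1::complex)"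
      by (simp add: add.commute)
    then show ?thesis
      using that assms unfolding mult_rotation_entry[OF A that assms]
      by (auto simp: mat_adjoint_entry[of _ n]) (auto simp: rotation_def)
  qed
  then have "?A * ?R = 1\<^sub>m n"
    using A rotation_carrier[of n a b t] by (intro eq_matI) (auto simp del: index_mult_mat(1) rotation_carrier)
  then show ?thesis by (simp add: unitary_group_def)
qed

definition perm_matrix :: "nat \<Rightarrow> (nat \<Rightarrow> nat) \<Rightarrow> complex mat" where
  "perm_matrix n \<sigma> = Matrix.mat n n (\<lambda>(i, j). of_bool (i = \<sigma> j))"

lemma perm_matrix_unitary:
  assumes "\<sigma> permutes {..<n}"
  shows "perm_matrix n \<sigma> \<in> unitary_group n"
proof -
  have "\<sigma> a < n" if "a < n" for a using permutes_in_image[OF assms, of a] that by auto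
  moreover have "\<sigma> a = \<sigma> b \<longleftrightarrow> a = b" for a b using permutes_inj[OF assms] by (auto dest: injD)
  moreover have "(\<Sum>i<n. cnj (of_bool (i = c)) * of_bool (i = d)) = (of_bool (c = d) :: complex)"
    if "c < n" for c d
  proof -
    have "(\<Sum>i<n. cnj (of_bool (i = c)) * of_bool (i = d)) = (\<Sum>i<n. if i = c then of_bool (c = d) else (0::complex))"
      by (intro sum.cong) auto
    then show ?thesis using that by simp
  qed
  ultimately show ?thesis
    by (simp add: unitary_group_iff perm_matrix_def)
qed

lemma mult_perm_matrix_entry:
  assumes "W \<in> carrier_mat n n" "\<sigma> permutes {..<n}" "i < n" "a < n"
  shows "(W * perm_matrix n \<sigma>) $$ (i, a) = W $$ (i, \<sigma> a)"
proof -
  have "\<sigma> a < n" using permutes_in_image[OF assms(2), of a] assms by auto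
  have "(W * perm_matrix n \<sigma>) $$ (i, a) = (\<Sum>c<n. W $$ (i, c) * perm_matrix n \<sigma> $$ (c, a))"
    using assms by (intro mat_mult_entry) (auto simp: perm_matrix_def)
  also have "\<dots> = W $$ (i, \<sigma> a)"
    using assms \<open>\<sigma> a < n\<close> by (simp add: perm_matrix_def of_bool_def if_distrib cong: if_cong)
  finally show ?thesis .
qed

text \<open>Built from transpositions: once the tails agree, swapping \<open>\<sigma> x\<close> with
  \<open>y\<close> leaves \<open>ys\<close> alone, as neither of the two occurs in it. The lemma is
  used to carry four distinct modes to any other four.\<close>

lemma permutes_extending:
  assumes "finite A" "distinct xs" "distinct ys" "length xs = length ys" "set xs \<subseteq> A" "set ys \<subseteq> A"
  shows "\<exists>\<sigma>. \<sigma> permutes A \<and> map \<sigma> xs = ys"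
  using assms(2-)
proof (induction xs ys rule: list_induct2')
  case (4 x xs y ys)
  then obtain \<sigma> where \<sigma>: "\<sigma> permutes A" "map \<sigma> xs = ys" by auto
  let ?\<tau> = "Transposition.transpose (\<sigma> x) y"
  have "\<sigma> x \<in> A" using 4 \<sigma> by (simp add: permutes_in_image)
  then have "?\<tau> \<circ> \<sigma> permutes A" using 4 \<sigma> by (intro permutes_compose permutes_swap_id) auto
  moreover have "map (?\<tau> \<circ> \<sigma>) (x # xs) = y # ys"
  proof -
    have "x \<notin> set xs" using 4(2) by simp
    then have "\<sigma> x \<notin> set (map \<sigma> xs)"
      using permutes_inj[OF \<sigma>(1)] by (simp add: inj_image_mem_iff)
    then have "\<sigma> x \<notin> set ys" unfolding \<sigma>(2) .
    then have "map ?\<tau> ys = ys"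
      using 4(3) by (intro map_idI) (auto simp: Transposition.transpose_def)
    then have "map (?\<tau> \<circ> \<sigma>) xs = ys" using \<sigma>(2) by (metis map_map)
    then show ?thesis by simp
  qed
  ultimately show ?case by (intro exI conjI)
qed (auto intro: permutes_id)

section \<open>Measurability on the unitary group\<close>

lemma unitary_borel_space: "space (unitary_borel n) = unitary_group n"
  unfolding unitary_borel_def by (rule space_measure_of) auto

lemma measurable_unitary_entry [measurable]:
  assumes "i < n" "j < n"
  shows "(\<lambda>W. W $$ (i, j)) \<in> borel_measurable (unitary_borel n)"
proof (rule borel_measurableI)
  fix A :: "complex set" assume "open A"
  then have "{W \<in> unitary_group n. W $$ (i, j) \<in> A} \<in> sets (unitary_borel n)"
    unfolding unitary_borel_def using assms by (intro sets.sigma_sets_eq in_measure_of) auto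
  moreover have "(\<lambda>W. W $$ (i, j)) -` A \<inter> space (unitary_borel n) = {W \<in> unitary_group n. W $$ (i, j) \<in> A}"
    by (auto simp: unitary_borel_space)
  ultimately show "(\<lambda>W. W $$ (i, j)) -` A \<inter> space (unitary_borel n) \<in> sets (unitary_borel n)" by simp
qed

lemma measurable_into_unitary_borel:
  assumes "\<And>x. x \<in> space M \<Longrightarrow> f x \<in> unitary_group n"
    and [measurable]: "\<And>i j. i < n \<Longrightarrow> j < n \<Longrightarrow> (\<lambda>x. f x $$ (i, j)) \<in> borel_measurable M"
  shows "f \<in> measurable M (unitary_borel n)"
  unfolding unitary_borel_def
proof (rule measurable_measure_of)
  fix y assume "y \<in> {{W \<in> unitary_group n. W $$ (i, j) \<in> A} | i j A. i < n \<and> j < n \<and> open A}"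
  then obtain i j A where y: "y = {W \<in> unitary_group n. W $$ (i, j) \<in> A}" "i < n" "j < n" "open A" by auto
  then have "f -` y \<inter> space M = (\<lambda>x. f x $$ (i, j)) -` A \<inter> space M" using assms(1) by auto
  then show "f -` y \<inter> space M \<in> sets M" using y by (auto intro: measurable_sets[OF assms(2)])
qed (use assms in auto)

text \<open>Pluecker coordinates of the plane spanned by rows \<open>p\<close> and \<open>q\<close>,
  that is, one row of the second exterior power of \<open>W\<close>.\<close>

definition row_minor :: "nat \<Rightarrow> nat \<Rightarrow> complex mat \<Rightarrow> nat \<Rightarrow> nat \<Rightarrow> complex" where
  "row_minor p q W a b = W $$ (p, a) * W $$ (q, b) - W $$ (p, b) * W $$ (q, a)"

lemma row_minor_phase:
  assumes "W \<in> carrier_mat n n" "p < n" "q < n" "a < n" "b < n"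
  shows "row_minor p q (W * phase_diag n t) a b =
    exp (- \<i> * complex_of_real (t a + t b)) * row_minor p q W a b"
proof -
  have "exp (- \<i> * complex_of_real (t a + t b)) =
      exp (- \<i> * complex_of_real (t a)) * exp (- \<i> * complex_of_real (t b))"
    by (simp add: mult_exp_exp distrib_left)
  then show ?thesis
    using assms by (simp add: row_minor_def mult_phase_diag_entry right_diff_distrib mult_ac del: index_mult_mat)
qed

lemma sum_of_bool_pair:
  fixes f :: "nat \<Rightarrow> nat \<Rightarrow> complex"
  assumes "finite J" "u \<in> J" "w \<in> J"
  shows "(\<Sum>a\<in>J. \<Sum>b\<in>J. f a b * of_bool (a = u \<and> b = w)) = f u w"
proof -
  have "(\<Sum>a\<in>J. \<Sum>b\<in>J. f a b * of_bool (a = u \<and> b = w)) = (\<Sum>a\<in>J. \<Sum>b\<in>J. if b = w then (if a = u then f u w else 0) else 0)"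
    by (intro sum.cong refl) auto
  then show ?thesis using assms by simp
qed

subsection \<open>Haar moments of minors\<close>

text \<open>The bound \<open>n4\<close> provides the four distinct modes needed for two disjoint
  index pairs.\<close>

locale haar_minors =
  fixes n :: nat and \<mu> :: "complex mat measure" and p q :: nat
  assumes haar: "is_haar n \<mu>" and p: "p < n" and q: "q < n" and p_neq_q: "p \<noteq> q" and n4: "4 \<le> n"
begin

abbreviation minor :: "complex mat \<Rightarrow> nat \<Rightarrow> nat \<Rightarrow> complex" where
  "minor \<equiv> row_minor p q"

text \<open>Bounded and measurable on a probability space means integrable, and the class is closed
  under the algebraic operations, so integrability never needs an argument of its own.\<close>

definition bounded_obs :: "(complex mat \<Rightarrow> complex) \<Rightarrow> bool" where
  "bounded_obs F \<longleftrightarrow> F \<in> borel_measurable \<mu> \<and> (\<exists>C. \<forall>W\<in>unitary_group n. cmod (F W) \<le> C)"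

lemma prob_space_\<mu>: "prob_space \<mu>" and sets_\<mu>: "sets \<mu> = sets (unitary_borel n)"
  using haar by (auto simp: is_haar_def)

lemma space_\<mu>: "space \<mu> = unitary_group n"
  using sets_eq_imp_space_eq[OF sets_\<mu>] by (simp add: unitary_borel_space)

lemma unitary_carrier: "W \<in> unitary_group n \<Longrightarrow> W \<in> carrier_mat n n"
  by (simp add: unitary_group_def)

lemma bounded_obs_const: "bounded_obs (\<lambda>W. c)"
  by (auto simp: bounded_obs_def)

lemma bounded_obs_cnj: "bounded_obs F \<Longrightarrow> bounded_obs (\<lambda>W. cnj (F W))"
  unfolding bounded_obs_def
  by (auto intro!: borel_measurable_continuous_on[of cnj] continuous_intros)

lemma bounded_obs_add:
  assumes "bounded_obs F" "bounded_obs G" shows "bounded_obs (\<lambda>W. F W + G W)"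
proof -
  obtain C D where "\<forall>W\<in>unitary_group n. cmod (F W) \<le> C" "\<forall>W\<in>unitary_group n. cmod (G W) \<le> D"
    using assms by (auto simp: bounded_obs_def)
  then have "\<forall>W\<in>unitary_group n. cmod (F W + G W) \<le> C + D"
    by (meson add_mono norm_triangle_ineq order_trans)
  then show ?thesis using assms by (auto simp: bounded_obs_def)
qed

lemma bounded_obs_mult:
  assumes "bounded_obs F" "bounded_obs G" shows "bounded_obs (\<lambda>W. F W * G W)"
proof -
  obtain C D where "\<forall>W\<in>unitary_group n. cmod (F W) \<le> C" "\<forall>W\<in>unitary_group n. cmod (G W) \<le> D"
    using assms by (auto simp: bounded_obs_def)
  then have "cmod (F W * G W) \<le> C * D" if "W \<in> unitary_group n" for W
    unfolding norm_mult using that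
    by (intro mult_mono) (auto intro: order_trans[OF norm_ge_zero])
  then show ?thesis using assms by (auto simp: bounded_obs_def)
qed

lemma bounded_obs_diff: "bounded_obs F \<Longrightarrow> bounded_obs G \<Longrightarrow> bounded_obs (\<lambda>W. F W - G W)"
  using bounded_obs_add[OF _ bounded_obs_mult[OF bounded_obs_const[of "-1"], of G], of F] by simp

lemma bounded_obs_power: "bounded_obs F \<Longrightarrow> bounded_obs (\<lambda>W. F W ^ m)"
  by (induction m) (auto intro: bounded_obs_const bounded_obs_mult)

lemma bounded_obs_sum:
  "(\<And>x. x \<in> X \<Longrightarrow> bounded_obs (F x)) \<Longrightarrow> bounded_obs (\<lambda>W. \<Sum>x\<in>X. F x W)"
  by (induction X rule: infinite_finite_induct) (auto intro: bounded_obs_const bounded_obs_add)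

lemma bounded_obs_entry:
  assumes "i < n" "a < n" shows "bounded_obs (\<lambda>W. W $$ (i, a))"
proof -
  have "cmod (W $$ (i, a)) \<le> 1" if "W \<in> unitary_group n" for W
  proof -
    have "complex_of_real (\<Sum>a<n. (cmod (W $$ (i, a)))\<^sup>2) = of_real 1"
      using unitary_group_rows[OF that assms(1) assms(1)]
      by (simp add: complex_norm_square del: of_real_power)
    then have "(\<Sum>a<n. (cmod (W $$ (i, a)))\<^sup>2) = 1" by (simp only: of_real_eq_iff)
    moreover have "(cmod (W $$ (i, a)))\<^sup>2 \<le> (\<Sum>a<n. (cmod (W $$ (i, a)))\<^sup>2)"
      by (rule member_le_sum) (use assms in auto)
    ultimately have "(cmod (W $$ (i, a)))\<^sup>2 \<le> 1\<^sup>2" by simp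
    then show ?thesis by (rule power2_le_imp_le) simp
  qed
  moreover have "(\<lambda>W. W $$ (i, a)) \<in> borel_measurable \<mu>"
    using measurable_unitary_entry[OF assms] measurable_cong_sets[OF sets_\<mu> refl] by blast
  ultimately show ?thesis by (auto simp: bounded_obs_def)
qed

lemma bounded_obs_minor: "a < n \<Longrightarrow> b < n \<Longrightarrow> bounded_obs (\<lambda>W. minor W a b)"
  unfolding row_minor_def using p q by (intro bounded_obs_diff bounded_obs_mult bounded_obs_entry)

lemmas bounded_obs_intros = bounded_obs_const bounded_obs_cnj bounded_obs_add bounded_obs_mult
  bounded_obs_diff bounded_obs_power bounded_obs_sum bounded_obs_minor

lemma bounded_obs_integrable:
  assumes "bounded_obs F" shows "integrable \<mu> F"
proof -
  interpret prob_space \<mu> by (rule prob_space_\<mu>)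
  show ?thesis using assms
    by (auto simp: bounded_obs_def space_\<mu> intro!: integrable_const_bound AE_I2)
qed

lemma measurable_translate:
  assumes "V \<in> unitary_group n" shows "(\<lambda>W. W * V) \<in> measurable \<mu> \<mu>"
proof -
  have "(\<lambda>W. W * V) \<in> measurable \<mu> (unitary_borel n)"
  proof (rule measurable_into_unitary_borel)
    fix i j assume ij: "i < n" "j < n"
    have "(\<lambda>W. (W * V) $$ (i, j)) \<in> borel_measurable \<mu> \<longleftrightarrow>
        (\<lambda>W. \<Sum>c<n. W $$ (i, c) * V $$ (c, j)) \<in> borel_measurable \<mu>"
      by (rule measurable_cong)
        (use ij assms in \<open>auto simp: space_\<mu> unitary_carrier mat_mult_entry simp del: index_mult_mat\<close>)
    moreover have "bounded_obs (\<lambda>W. \<Sum>c<n. W $$ (i, c) * V $$ (c, j))"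
      using ij by (intro bounded_obs_intros bounded_obs_entry) auto
    ultimately show "(\<lambda>W. (W * V) $$ (i, j)) \<in> borel_measurable \<mu>"
      by (simp add: bounded_obs_def)
  qed (use assms unitary_group_mult space_\<mu> in auto)
  then show ?thesis using measurable_cong_sets[OF refl sets_\<mu>] by blast
qed

text \<open>Invariance in the shape of a rewrite: it suffices to compute how \<open>F\<close>
  changes under \<open>V\<close>. The equation is asked for on the group only, because the entry
  formulas for products concern carrier matrices.\<close>

lemma integral_translate:
  assumes "bounded_obs F" "V \<in> unitary_group n"
    and "\<And>W. W \<in> unitary_group n \<Longrightarrow> F (W * V) = G W"
  shows "integral\<^sup>L \<mu> G = integral\<^sup>L \<mu> F"
proof -
  have "integral\<^sup>L \<mu> G = (\<integral>W. F (W * V) \<partial>\<mu>)"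
    by (rule Bochner_Integration.integral_cong) (auto simp: space_\<mu> assms(3))
  also have "\<dots> = integral\<^sup>L (distr \<mu> \<mu> (\<lambda>W. W * V)) F"
    using assms by (intro integral_distr[symmetric] measurable_translate) (auto simp: bounded_obs_def)
  finally show ?thesis using haar assms(2) by (simp add: is_haar_def)
qed

lemma minor_phase:
  assumes "W \<in> unitary_group n" "a < n" "b < n"
  shows "minor (W * phase_diag n t) a b = exp (- \<i> * complex_of_real (t a + t b)) * minor W a b"
  using assms p q unitary_carrier by (intro row_minor_phase)

lemma minor_perm:
  assumes "W \<in> unitary_group n" "\<sigma> permutes {..<n}" "a < n" "b < n"
  shows "minor (W * perm_matrix n \<sigma>) a b = minor W (\<sigma> a) (\<sigma> b)"
  using assms p q unitary_carrier[OF assms(1)]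
  by (simp add: row_minor_def mult_perm_matrix_entry del: index_mult_mat)

text \<open>Only column \<open>b\<close> matters, and the rotation replaces it by the normalized sum
  of columns \<open>b\<close> and \<open>c\<close>. The angle pi/4 gives both the same
  weight.\<close>

lemma minor_rotation:
  assumes "W \<in> unitary_group n" "a < n" "b < n" "c < n" "a \<noteq> b" "a \<noteq> c" "b \<noteq> c"
  shows "minor (W * rotation n b c (pi / 4)) a b = (minor W a b + minor W a c) / complex_of_real (sqrt 2)"
proof -
  have "sqrt 2 / 2 = 1 / sqrt 2" by (simp add: field_simps)
  then have "complex_of_real (cos (pi / 4)) = 1 / complex_of_real (sqrt 2)"
    "complex_of_real (sin (pi / 4)) = 1 / complex_of_real (sqrt 2)"
    unfolding cos_45 sin_45 by (metis of_real_1 of_real_divide)+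
  then show ?thesis
    using assms p q unitary_carrier[OF assms(1)]
    by (simp add: row_minor_def mult_rotation_entry algebra_simps add_divide_distrib diff_divide_distrib del: index_mult_mat)
qed

lemma minor_antisym: "minor W b a = - minor W a b"
  by (simp add: row_minor_def)

lemma minor_self [simp]: "minor W a a = 0"
  by (simp add: row_minor_def)

lemma minor_pluecker:
  "minor W a b * minor W c d - minor W a c * minor W b d + minor W a d * minor W b c = 0"
  by (simp add: row_minor_def algebra_simps)

text \<open>By invariance the mean equals \<open>z\<close> times itself.\<close>

lemma integral_phase_zero:
  assumes "bounded_obs F" "z \<noteq> 1"
    "\<And>W. W \<in> unitary_group n \<Longrightarrow> F (W * phase_diag n t) = z * F W"
  shows "integral\<^sup>L \<mu> F = 0"
proof -
  have "integral\<^sup>L \<mu> (\<lambda>W. z * F W) = integral\<^sup>L \<mu> F"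
    by (rule integral_translate[OF assms(1) phase_diag_unitary assms(3)])
  then show ?thesis using assms(2) by simp
qed

section \<open>Fourth moments of the moduli of minors\<close>

definition sqm :: "nat \<Rightarrow> nat \<Rightarrow> complex mat \<Rightarrow> complex" where
  "sqm a b W = minor W a b * cnj (minor W a b)"

lemma sqm_commute: "sqm a b W = sqm b a W"
  by (simp add: sqm_def minor_antisym[of W b a])

lemma sqm_self [simp]: "sqm a a W = 0"
  by (simp add: sqm_def)

lemma bounded_obs_sqm: "a < n \<Longrightarrow> b < n \<Longrightarrow> bounded_obs (sqm a b)"
  unfolding sqm_def[abs_def] by (intro bounded_obs_intros)

text \<open>One representative for each number of modes shared by the two index pairs: two, one,
  none. Permutation invariance carries every such moment to one of the three.\<close>

definition \<alpha> :: complex where "\<alpha> = integral\<^sup>L \<mu> (\<lambda>W. sqm 0 1 W * sqm 0 1 W)"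
definition \<beta> :: complex where "\<beta> = integral\<^sup>L \<mu> (\<lambda>W. sqm 0 1 W * sqm 0 2 W)"
definition \<gamma> :: complex where "\<gamma> = integral\<^sup>L \<mu> (\<lambda>W. sqm 0 1 W * sqm 2 3 W)"

text \<open>The positions \<open>x\<close>, \<open>y\<close>, \<open>z\<close>, \<open>w\<close>
  select entries of a list of four distinct modes, so one statement serves all three overlap
  patterns.\<close>

lemma integral_sqm_permute:
  assumes "distinct [a, b, c, d]" "a < n" "b < n" "c < n" "d < n" "distinct [a', b', c', d']"
    "a' < n" "b' < n" "c' < n" "d' < n" "x < 4" "y < 4" "z < 4" "w < 4"
  shows "integral\<^sup>L \<mu> (\<lambda>W. sqm ([a, b, c, d] ! x) ([a, b, c, d] ! y) W * sqm ([a, b, c, d] ! z) ([a, b, c, d] ! w) W)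
    = integral\<^sup>L \<mu> (\<lambda>W. sqm ([a', b', c', d'] ! x) ([a', b', c', d'] ! y) W * sqm ([a', b', c', d'] ! z) ([a', b', c', d'] ! w) W)"
    (is "integral\<^sup>L \<mu> ?G = integral\<^sup>L \<mu> ?F")
proof -
  obtain \<sigma> where \<sigma>: "\<sigma> permutes {..<n}" "map \<sigma> [a', b', c', d'] = [a, b, c, d]"
    using permutes_extending[of "{..<n}" "[a', b', c', d']" "[a, b, c, d]"] assms(1-10) by auto
  note m = assms(11-)
  have lt: "[a', b', c', d'] ! i < n" if "i < 4" for i
  proof -
    have "[a', b', c', d'] ! i \<in> set [a', b', c', d']" using that by (intro nth_mem) simp
    moreover have "set [a', b', c', d'] \<subseteq> {..<n}" using assms(7-10) by simp
    ultimately show ?thesis by blast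
  qed
  have s: "\<sigma> ([a', b', c', d'] ! i) = [a, b, c, d] ! i" if "i < 4" for i
    using that nth_map[of i "[a', b', c', d']" \<sigma>] unfolding \<sigma>(2) by simp
  show ?thesis
  proof (rule integral_translate[OF _ perm_matrix_unitary[OF \<sigma>(1)]])
    show "bounded_obs ?F" using m lt by (intro bounded_obs_mult bounded_obs_sqm)
    fix W assume "W \<in> unitary_group n"
    then show "?F (W * perm_matrix n \<sigma>) = ?G W"
      using m by (simp only: sqm_def minor_perm[OF _ \<sigma>(1)] lt s)
  qed
qed

lemma ex_distinct_extension:
  assumes "a < n" "b < n" "c < n"
  obtains d where "d < n" "d \<noteq> a" "d \<noteq> b" "d \<noteq> c"
proof -
  have "card {a, b, c} < card {..<n}"
    using n4 card_length[of "[a, b, c]"] by simp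
  then have "\<not> {..<n} \<subseteq> {a, b, c}" by (metis card_mono finite.emptyI finite_insert leD)
  then show ?thesis using that by blast
qed

lemma integral_sqm_two:
  assumes "a < n" "b < n" "a \<noteq> b"
  shows "integral\<^sup>L \<mu> (\<lambda>W. sqm a b W * sqm a b W) = \<alpha>"
proof -
  obtain c where c: "c < n" "c \<noteq> a" "c \<noteq> b" using ex_distinct_extension[of a b b] assms by metis
  obtain d where d: "d < n" "d \<noteq> a" "d \<noteq> b" "d \<noteq> c" using ex_distinct_extension[of a b c] assms c by metis
  show ?thesis
    using integral_sqm_permute[of a b c d 0 1 2 3 0 1 0 1] assms c d n4 by (simp add: \<alpha>_def)
qed

lemma integral_sqm_three:
  assumes "a < n" "b < n" "c < n" "distinct [a, b, c]"
  shows "integral\<^sup>L \<mu> (\<lambda>W. sqm a b W * sqm a c W) = \<beta>"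
proof -
  obtain d where d: "d < n" "d \<noteq> a" "d \<noteq> b" "d \<noteq> c" using ex_distinct_extension[of a b c] assms by metis
  then have "d \<noteq> a" "d \<noteq> b" "d \<noteq> c" "a \<noteq> d" "b \<noteq> d" "c \<noteq> d" by auto
  then show ?thesis
    using integral_sqm_permute[of a b c d 0 1 2 3 0 1 0 2] assms d(1) n4 by (simp add: \<beta>_def)
qed

lemma integral_sqm_four:
  assumes "a < n" "b < n" "c < n" "d < n" "distinct [a, b, c, d]"
  shows "integral\<^sup>L \<mu> (\<lambda>W. sqm a b W * sqm c d W) = \<gamma>"
  using integral_sqm_permute[of a b c d 0 1 2 3 0 1 2 3] assms n4 by (simp add: \<gamma>_def eval_nat_numeral)

lemma integral_add: "bounded_obs F \<Longrightarrow> bounded_obs G \<Longrightarrow>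
    integral\<^sup>L \<mu> (\<lambda>W. F W + G W) = integral\<^sup>L \<mu> F + integral\<^sup>L \<mu> G"
  by (intro Bochner_Integration.integral_add bounded_obs_integrable)

lemma integral_diff: "bounded_obs F \<Longrightarrow> bounded_obs G \<Longrightarrow>
    integral\<^sup>L \<mu> (\<lambda>W. F W - G W) = integral\<^sup>L \<mu> F - integral\<^sup>L \<mu> G"
  by (intro Bochner_Integration.integral_diff bounded_obs_integrable)

lemma integral_sum: "(\<And>x. x \<in> X \<Longrightarrow> bounded_obs (F x)) \<Longrightarrow>
    integral\<^sup>L \<mu> (\<lambda>W. \<Sum>x\<in>X. F x W) = (\<Sum>x\<in>X. integral\<^sup>L \<mu> (F x))"
  by (intro Bochner_Integration.integral_sum bounded_obs_integrable)

lemma integral_sum2: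
  assumes "\<And>x y. x \<in> X \<Longrightarrow> y \<in> Y x \<Longrightarrow> bounded_obs (F x y)"
  shows "integral\<^sup>L \<mu> (\<lambda>W. \<Sum>x\<in>X. \<Sum>y\<in>Y x. F x y W) = (\<Sum>x\<in>X. \<Sum>y\<in>Y x. integral\<^sup>L \<mu> (F x y))"
  using assms by (subst integral_sum) (auto intro!: sum.cong integral_sum bounded_obs_sum)

lemma integral_const: "integral\<^sup>L \<mu> (\<lambda>W. c :: complex) = c"
proof -
  interpret prob_space \<mu> by (rule prob_space_\<mu>)
  show ?thesis by (simp add: prob_space)
qed

section \<open>Relations among the three moments, and their values\<close>

lemma minor_phase_at:
  assumes "W \<in> unitary_group n" "a < n" "b < n"
  shows "minor (W * phase_diag n (\<lambda>i. if i = c then s else 0)) a b =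
    (if a = c then exp (- \<i> * complex_of_real s) else 1) *
    (if b = c then exp (- \<i> * complex_of_real s) else 1) * minor W a b"
proof -
  have "exp (- \<i> * complex_of_real (x + y)) = exp (- \<i> * complex_of_real x) * exp (- \<i> * complex_of_real y)"
    for x y by (simp add: mult_exp_exp distrib_left)
  then show ?thesis using minor_phase[OF assms, of "\<lambda>i. if i = c then s else 0"] by auto
qed

lemma exp_quarters:
  "exp (- \<i> * complex_of_real 0) = 1" "exp (- \<i> * complex_of_real pi) = - 1"
  "exp (- \<i> * complex_of_real (pi / 2)) = - \<i>" "exp (- \<i> * complex_of_real (- pi / 2)) = \<i>"
proof -
  show "exp (- \<i> * complex_of_real (pi / 2)) = - \<i>"
    using cis_conv_exp[of "- pi / 2"] by (simp add: mult.commute complex_eq_iff)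
  show "exp (- \<i> * complex_of_real (- pi / 2)) = \<i>"
    using cis_conv_exp[of "pi / 2"] by (simp add: mult.commute complex_eq_iff)
  show "exp (- \<i> * complex_of_real pi) = - 1"
    by (simp add: exp_minus)
qed simp

text \<open>Rotate modes 1 and 2 by \<open>\<pi>/4\<close> and average over the phases \<open>1, -1, \<i>, -\<i>\<close> to remove the cross terms.\<close>

lemma \<alpha>_eq: "\<alpha> = 2 * \<beta>"
proof -
  let ?X = "\<lambda>W. minor W 0 1" and ?Y = "\<lambda>W. minor W 0 2"
  let ?F = "\<lambda>u W. ((?X W + u * ?Y W) * cnj (?X W + u * ?Y W))\<^sup>2"
  have n: "0 < n" "1 < n" "2 < n" using n4 by auto
  have bo: "bounded_obs (?F u)" for u
    by (intro bounded_obs_intros n)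
  have ph: "integral\<^sup>L \<mu> (?F (exp (- \<i> * complex_of_real s))) = integral\<^sup>L \<mu> (?F 1)" for s
    by (rule integral_translate[OF bo phase_diag_unitary[of n "\<lambda>i. if i = 2 then s else 0"]])
      (use n in \<open>simp only: minor_phase_at, simp\<close>)
  have F: "integral\<^sup>L \<mu> (?F u) = integral\<^sup>L \<mu> (?F 1)" if "u \<in> {1, -1, - \<i>, \<i>}" for u
    using that ph[of 0] ph[of pi] ph[of "pi / 2"] ph[of "- pi / 2"] unfolding exp_quarters by blast
  have "integral\<^sup>L \<mu> (\<lambda>W. 1 / 4 * ?F 1 W) = integral\<^sup>L \<mu> (\<lambda>W. sqm 0 1 W * sqm 0 1 W)"
  proof (rule integral_translate[OF _ rotation_unitary[of 1 n 2 "pi / 4"]])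
    show "bounded_obs (\<lambda>W. sqm 0 1 W * sqm 0 1 W)" using n by (intro bounded_obs_mult bounded_obs_sqm)
    fix W assume W: "W \<in> unitary_group n"
    have "complex_of_real (sqrt 2) * complex_of_real (sqrt 2) = 2"
      by (metis of_real_mult of_real_numeral real_sqrt_mult_self abs_numeral)
    then have "complex_of_real (sqrt 2) ^ 4 = 4"
      by (simp add: power4_eq_xxxx mult.assoc)
    then show "sqm 0 1 (W * rotation n 1 2 (pi / 4)) * sqm 0 1 (W * rotation n 1 2 (pi / 4)) = 1 / 4 * ?F 1 W"
      using n W by (simp add: sqm_def minor_rotation power2_eq_square field_simps power4_eq_xxxx)
  qed (use n in auto)
  then have 1: "integral\<^sup>L \<mu> (?F 1) = 4 * \<alpha>" by (simp add: \<alpha>_def)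
  \<comment> \<open>In the average of |X + u Y|^4 over the four phases the terms carrying u or u^2,
    and their conjugates, cancel. What remains is |X|^4 + |Y|^4 + 4 |X|^2 |Y|^2, so that 16 \<alpha>
    = 8 \<alpha> + 16 \<beta>.\<close>
  have "?F 1 W + ?F (- 1) W + ?F (- \<i>) W + ?F \<i> W =
      4 * (sqm 0 1 W * sqm 0 1 W) + 4 * (sqm 0 2 W * sqm 0 2 W) + 16 * (sqm 0 1 W * sqm 0 2 W)" for W
    unfolding sqm_def by (simp add: power2_eq_square algebra_simps)
  then have "integral\<^sup>L \<mu> (\<lambda>W. ?F 1 W + ?F (- 1) W + ?F (- \<i>) W + ?F \<i> W) =
     integral\<^sup>L \<mu> (\<lambda>W. 4 * (sqm 0 1 W * sqm 0 1 W) + 4 * (sqm 0 2 W * sqm 0 2 W) + 16 * (sqm 0 1 W * sqm 0 2 W))"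
    by simp
  also have "\<dots> = 4 * integral\<^sup>L \<mu> (\<lambda>W. sqm 0 1 W * sqm 0 1 W) + 4 * integral\<^sup>L \<mu> (\<lambda>W. sqm 0 2 W * sqm 0 2 W)
      + 16 * integral\<^sup>L \<mu> (\<lambda>W. sqm 0 1 W * sqm 0 2 W)"
    using n by (subst integral_add integral_mult_right_zero | intro bounded_obs_intros bounded_obs_sqm | simp)+
  also have "\<dots> = 8 * \<alpha> + 16 * \<beta>"
    using n integral_sqm_two[of 0 1] integral_sqm_two[of 0 2] integral_sqm_three[of 0 1 2] by simp
  also have "integral\<^sup>L \<mu> (\<lambda>W. ?F 1 W + ?F (- 1) W + ?F (- \<i>) W + ?F \<i> W) =
     integral\<^sup>L \<mu> (?F 1) + integral\<^sup>L \<mu> (?F (- 1)) + integral\<^sup>L \<mu> (?F (- \<i>)) + integral\<^sup>L \<mu> (?F \<i>)"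
    by (simp only: integral_add bo bounded_obs_add)
  also have "\<dots> = 16 * \<alpha>" using F[of "- 1"] F[of "- \<i>"] F[of \<i>] 1 by simp
  finally show ?thesis by simp
qed

text \<open>Rotating modes 1 and 2 in |v_10|^2 |v_13|^2 and averaging over phases leaves |v_01 v_23
  + v_02 v_13|^2 besides two squares. Its interference term is not a moment of moduli, but the
  difference v_02 v_13 - v_01 v_23 equals v_03 v_12 by the Pluecker relation, so the parallelogram
  law removes it. The outcome is 16 \<beta> = 8 \<beta> + 12 \<gamma>.\<close>

lemma \<gamma>_eq: "3 * \<gamma> = 2 * \<beta>"
proof -
  let ?A = "\<lambda>u W. (minor W 0 1 + u * minor W 0 2) * (minor W 1 3 + u * minor W 2 3)"
  let ?F = "\<lambda>u W. ?A u W * cnj (?A u W)"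
  have n: "0 < n" "1 < n" "2 < n" "3 < n" using n4 by auto
  have bo: "bounded_obs (?F u)" for u
    by (intro bounded_obs_intros n)
  have ph: "integral\<^sup>L \<mu> (?F (exp (- \<i> * complex_of_real s))) = integral\<^sup>L \<mu> (?F 1)" for s
    by (rule integral_translate[OF bo phase_diag_unitary[of n "\<lambda>i. if i = 2 then s else 0"]])
      (use n in \<open>simp only: minor_phase_at, simp\<close>)
  have F: "integral\<^sup>L \<mu> (?F u) = integral\<^sup>L \<mu> (?F 1)" if "u \<in> {1, -1, - \<i>, \<i>}" for u
    using that ph[of 0] ph[of pi] ph[of "pi / 2"] ph[of "- pi / 2"] unfolding exp_quarters by blast
  have "integral\<^sup>L \<mu> (\<lambda>W. 1 / 4 * ?F 1 W) = integral\<^sup>L \<mu> (\<lambda>W. sqm 1 0 W * sqm 1 3 W)"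
  proof (rule integral_translate[OF _ rotation_unitary[of 1 n 2 "pi / 4"]])
    show "bounded_obs (\<lambda>W. sqm 1 0 W * sqm 1 3 W)" using n by (intro bounded_obs_mult bounded_obs_sqm)
    fix W assume W: "W \<in> unitary_group n"
    have rr: "complex_of_real (sqrt 2) * complex_of_real (sqrt 2) = 2"
      by (metis of_real_mult of_real_numeral real_sqrt_mult_self abs_numeral)
    have s: "sqm 0 1 (W * rotation n 1 2 (pi / 4)) = (minor W 0 1 + minor W 0 2) * cnj (minor W 0 1 + minor W 0 2) / 2"
      using n W by (simp add: sqm_def minor_rotation rr)
    have "minor (W * rotation n 1 2 (pi / 4)) 1 3 = (minor W 1 3 + minor W 2 3) / complex_of_real (sqrt 2)"
      using minor_rotation[OF W n(4) n(2) n(3)] minor_antisym[of "W * rotation n 1 2 (pi / 4)" 1 3]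
        minor_antisym[of W 1 3] minor_antisym[of W 2 3] by (simp add: field_simps)
    then have t: "sqm 1 3 (W * rotation n 1 2 (pi / 4)) = (minor W 1 3 + minor W 2 3) * cnj (minor W 1 3 + minor W 2 3) / 2"
      by (simp add: sqm_def rr)
    show "sqm 1 0 (W * rotation n 1 2 (pi / 4)) * sqm 1 3 (W * rotation n 1 2 (pi / 4)) = 1 / 4 * ?F 1 W"
      unfolding sqm_commute[of 1 0] s t by simp
  qed (use n in auto)
  then have 1: "integral\<^sup>L \<mu> (?F 1) = 4 * \<beta>"
    using integral_sqm_three[of 1 0 3] n by simp
  have "?F 1 W + ?F (- 1) W + ?F (- \<i>) W + ?F \<i> W =
      4 * (sqm 1 0 W * sqm 1 3 W) + 4 * (sqm 2 0 W * sqm 2 3 W)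
      + 8 * (sqm 0 1 W * sqm 2 3 W) + 8 * (sqm 0 2 W * sqm 1 3 W) - 4 * (sqm 0 3 W * sqm 1 2 W)" for W
  proof -
    have pl: "minor W 0 3 * minor W 1 2 = minor W 0 2 * minor W 1 3 - minor W 0 1 * minor W 2 3"
      using minor_pluecker[of W 0 1 2 3] by (simp add: algebra_simps)
    have "sqm 0 3 W * sqm 1 2 W = (minor W 0 3 * minor W 1 2) * cnj (minor W 0 3 * minor W 1 2)"
      by (simp add: sqm_def)
    also have "\<dots> = (minor W 0 2 * minor W 1 3 - minor W 0 1 * minor W 2 3)
        * cnj (minor W 0 2 * minor W 1 3 - minor W 0 1 * minor W 2 3)"
      unfolding pl ..
    finally have e: "sqm 0 3 W * sqm 1 2 W = \<dots>" .
    show ?thesis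
      unfolding e sqm_commute[of 1 0] sqm_commute[of 2 0] by (simp add: sqm_def algebra_simps)
  qed
  then have "integral\<^sup>L \<mu> (\<lambda>W. ?F 1 W + ?F (- 1) W + ?F (- \<i>) W + ?F \<i> W) =
     integral\<^sup>L \<mu> (\<lambda>W. 4 * (sqm 1 0 W * sqm 1 3 W) + 4 * (sqm 2 0 W * sqm 2 3 W)
      + 8 * (sqm 0 1 W * sqm 2 3 W) + 8 * (sqm 0 2 W * sqm 1 3 W) - 4 * (sqm 0 3 W * sqm 1 2 W))"
    by simp
  also have "\<dots> = 4 * integral\<^sup>L \<mu> (\<lambda>W. sqm 1 0 W * sqm 1 3 W) + 4 * integral\<^sup>L \<mu> (\<lambda>W. sqm 2 0 W * sqm 2 3 W)
      + 8 * integral\<^sup>L \<mu> (\<lambda>W. sqm 0 1 W * sqm 2 3 W) + 8 * integral\<^sup>L \<mu> (\<lambda>W. sqm 0 2 W * sqm 1 3 W)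
      - 4 * integral\<^sup>L \<mu> (\<lambda>W. sqm 0 3 W * sqm 1 2 W)"
    using n by (subst integral_add integral_diff integral_mult_right_zero | intro bounded_obs_intros bounded_obs_sqm | simp)+
  also have "\<dots> = 8 * \<beta> + 12 * \<gamma>"
    using n integral_sqm_three[of 1 0 3] integral_sqm_three[of 2 0 3]
      integral_sqm_four[of 0 1 2 3] integral_sqm_four[of 0 2 1 3] integral_sqm_four[of 0 3 1 2] by simp
  also have "integral\<^sup>L \<mu> (\<lambda>W. ?F 1 W + ?F (- 1) W + ?F (- \<i>) W + ?F \<i> W) =
     integral\<^sup>L \<mu> (?F 1) + integral\<^sup>L \<mu> (?F (- 1)) + integral\<^sup>L \<mu> (?F (- \<i>)) + integral\<^sup>L \<mu> (?F \<i>)"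
    by (simp only: integral_add bo bounded_obs_add)
  also have "\<dots> = 16 * \<beta>" using F[of "- 1"] F[of "- \<i>"] F[of \<i>] 1 by simp
  finally show ?thesis by simp
qed

text \<open>Lagrange's identity for two orthonormal rows. The sum runs over ordered pairs, so every
  minor occurs twice and the total is 2 instead of 1.\<close>

lemma sum_sqm:
  assumes W: "W \<in> unitary_group n"
  shows "(\<Sum>a<n. \<Sum>b<n. sqm a b W) = 2"
proof -
  let ?P = "\<lambda>i a. W $$ (i, a)"
  have "(\<Sum>a<n. \<Sum>b<n. sqm a b W) =
     (\<Sum>a<n. \<Sum>b<n. ?P p a * cnj (?P p a) * (?P q b * cnj (?P q b)) + ?P q a * cnj (?P q a) * (?P p b * cnj (?P p b))
       - ?P p a * cnj (?P q a) * (?P q b * cnj (?P p b)) - ?P q a * cnj (?P p a) * (?P p b * cnj (?P q b)))"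
    by (intro sum.cong refl) (simp add: sqm_def row_minor_def algebra_simps)
  also have "\<dots> = 2"
    using unitary_group_rows[OF W p p] unitary_group_rows[OF W q q] unitary_group_rows[OF W p q]
      unitary_group_rows[OF W q p] p_neq_q
    by (simp add: sum.distrib sum_subtractf sum_distrib_left[symmetric] sum_distrib_right[symmetric])
  finally show ?thesis .
qed

text \<open>The values 3 \<gamma>, 3/2 \<gamma> and \<gamma> for two, one and no shared modes are
  interpolated by a polynomial in the indicator \<open>s\<close> of {a, b}, so that sums over
  \<open>c\<close> and \<open>d\<close> need no case split. The last term corrects the diagonal
  \<open>c = d\<close>, where the minor vanishes.\<close>

lemma integral_sqm_product:
  assumes "a < n" "b < n" "a \<noteq> b" "c < n" "d < n"
  defines "s \<equiv> \<lambda>c. of_bool (c = a) + of_bool (c = b)"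
  shows "integral\<^sup>L \<mu> (\<lambda>W. sqm a b W * sqm c d W) =
    \<gamma> * (1 + (s c + s d) / 2 + s c * s d) - (if c = d then \<gamma> * (1 + 2 * s c) else 0)"
proof -
  have \<beta>: "\<beta> = 3 / 2 * \<gamma>" and \<alpha>: "\<alpha> = 3 * \<gamma>" using \<alpha>_eq \<gamma>_eq by auto
  consider "c = d" | "c \<noteq> d" "c = a" "d = b" | "c \<noteq> d" "c = b" "d = a"
    | "c \<noteq> d" "c = a" "d \<noteq> b" "d \<noteq> a" | "c \<noteq> d" "c = b" "d \<noteq> a" "d \<noteq> b"
    | "c \<noteq> d" "d = a" "c \<noteq> b" "c \<noteq> a" | "c \<noteq> d" "d = b" "c \<noteq> a" "c \<noteq> b"
    | "distinct [a, b, c, d]"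
    using assms by auto
  then show ?thesis
  proof cases
    case 1
    then show ?thesis using assms(3) by (auto simp: s_def algebra_simps)
  next
    case 2
    then show ?thesis using integral_sqm_two[of a b] assms by (simp add: s_def \<alpha>)
  next
    case 3
    then show ?thesis using integral_sqm_two[of a b] assms by (simp add: s_def \<alpha> sqm_commute[of b a])
  next
    case 4
    then show ?thesis using integral_sqm_three[of a b d] assms by (simp add: s_def \<beta>)
  next
    case 5
    then show ?thesis using integral_sqm_three[of b a d] assms by (simp add: s_def \<beta> sqm_commute[of b a])
  next
    case 6
    then show ?thesis using integral_sqm_three[of a b c] assms by (simp add: s_def \<beta> sqm_commute[of c a])
  next
    case 7
    then show ?thesis using integral_sqm_three[of b a c] assms by (simp add: s_def \<beta> sqm_commute[of b a] sqm_commute[of c b])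
  next
    case 8
    then show ?thesis using integral_sqm_four[of a b c d] assms by (auto simp: s_def)
  qed
qed

text \<open>Normalization: the square of \<open>sum_sqm\<close> integrates to 4. Each of the n (n -
  1) ordered pairs contributes \<gamma> (n^2 + n), whence 4 = \<gamma> n^2 (n^2 - 1), and \<beta> =
  3/2 \<gamma>.\<close>

lemma \<beta>_value: "\<beta> = complex_of_real (6 / (real n ^ 2 * (real n ^ 2 - 1)))"
proof -
  let ?n = "complex_of_nat n"
  have row: "integral\<^sup>L \<mu> (\<lambda>W. sqm a b W * 2) = (if a = b then 0 else \<gamma> * (?n\<^sup>2 + ?n))" if "a < n" "b < n" for a b
  proof (cases "a = b")
    case False
    define u where "u = (\<lambda>c. of_bool (c = a) + of_bool (c = b) :: complex)"
    have u: "(\<Sum>c<n. u c) = 2" using that by (simp add: u_def sum.distrib)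
    \<comment> \<open>Stated for an abstract \<open>t\<close>, so that only its total 2 is used and
      the indicator is not unfolded.\<close>
    have gen: "(\<Sum>c<n. \<Sum>d<n. \<gamma> + \<gamma> / 2 * t c + \<gamma> / 2 * t d + \<gamma> * t c * t d) - (\<Sum>c<n. \<gamma> + 2 * \<gamma> * t c)
        = \<gamma> * (?n\<^sup>2 + ?n)" if "(\<Sum>c<n. t c) = 2" for t :: "nat \<Rightarrow> complex"
    proof -
      have "(\<Sum>c<n. \<Sum>d<n. \<gamma> + \<gamma> / 2 * t c + \<gamma> / 2 * t d + \<gamma> * t c * t d)
          = (\<Sum>c<n. (?n * \<gamma> + \<gamma>) + (?n * (\<gamma> / 2) + 2 * \<gamma>) * t c)"
        by (intro sum.cong refl)
          (simp only: sum.distrib sum_distrib_left[symmetric] that sum_constant, simp add: algebra_simps)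
      also have "\<dots> = ?n * (?n * \<gamma> + \<gamma>) + (?n * (\<gamma> / 2) + 2 * \<gamma>) * 2"
        by (simp only: sum.distrib sum_distrib_left[symmetric] that sum_constant) (simp add: distrib_left)
      finally have s1: "(\<Sum>c<n. \<Sum>d<n. \<gamma> + \<gamma> / 2 * t c + \<gamma> / 2 * t d + \<gamma> * t c * t d) =
        ?n * (?n * \<gamma> + \<gamma>) + (?n * (\<gamma> / 2) + 2 * \<gamma>) * 2" .
      have s2: "(\<Sum>c<n. \<gamma> + 2 * \<gamma> * t c) = ?n * \<gamma> + 2 * \<gamma> * 2"
        by (simp only: sum.distrib sum_distrib_left[symmetric] that sum_constant) simp
      show ?thesis unfolding s1 s2 by (simp add: field_simps power2_eq_square)
    qed
    have "integral\<^sup>L \<mu> (\<lambda>W. sqm a b W * 2) = integral\<^sup>L \<mu> (\<lambda>W. \<Sum>c<n. \<Sum>d<n. sqm a b W * sqm c d W)"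
      by (rule Bochner_Integration.integral_cong) (auto simp: space_\<mu> sum_sqm sum_distrib_left[symmetric])
    also have "\<dots> = (\<Sum>c<n. \<Sum>d<n. integral\<^sup>L \<mu> (\<lambda>W. sqm a b W * sqm c d W))"
      using that by (intro integral_sum2 bounded_obs_mult bounded_obs_sqm) auto
    also have "\<dots> = (\<Sum>c<n. \<Sum>d<n. \<gamma> * (1 + (u c + u d) / 2 + u c * u d) - (if c = d then \<gamma> * (1 + 2 * u c) else 0))"
      unfolding u_def using that False by (intro sum.cong refl integral_sqm_product) auto
    also have "\<dots> = (\<Sum>c<n. \<Sum>d<n. \<gamma> * (1 + (u c + u d) / 2 + u c * u d)) - (\<Sum>c<n. \<gamma> * (1 + 2 * u c))"
      by (simp add: sum_subtractf)
    also have "\<dots> = (\<Sum>c<n. \<Sum>d<n. \<gamma> + \<gamma> / 2 * u c + \<gamma> / 2 * u d + \<gamma> * u c * u d) - (\<Sum>c<n. \<gamma> + 2 * \<gamma> * u c)"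
      by (intro arg_cong2[where f = "(-)"] sum.cong refl) (simp_all add: field_simps)
    also have "\<dots> = \<gamma> * (?n\<^sup>2 + ?n)"
      by (rule gen[OF u])
    finally show ?thesis using False by simp
  qed simp
  have "4 = integral\<^sup>L \<mu> (\<lambda>W. \<Sum>a<n. \<Sum>b<n. sqm a b W * 2)"
  proof -
    have "integral\<^sup>L \<mu> (\<lambda>W. \<Sum>a<n. \<Sum>b<n. sqm a b W * 2) = integral\<^sup>L \<mu> (\<lambda>W. 4)"
      by (rule Bochner_Integration.integral_cong) (auto simp: space_\<mu> sum_sqm sum_distrib_right[symmetric])
    then show ?thesis by (simp only: integral_const)
  qed
  also have "\<dots> = (\<Sum>a<n. \<Sum>b<n. integral\<^sup>L \<mu> (\<lambda>W. sqm a b W * 2))"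
    by (intro integral_sum2 bounded_obs_mult bounded_obs_const bounded_obs_sqm) auto
  also have "\<dots> = (\<Sum>a<n. \<Sum>b<n. \<gamma> * (?n\<^sup>2 + ?n) - (if a = b then \<gamma> * (?n\<^sup>2 + ?n) else 0))"
    by (intro sum.cong refl, subst row) auto
  also have "\<dots> = \<gamma> * (?n\<^sup>2 + ?n) * (?n\<^sup>2 - ?n)"
    by (simp add: sum_subtractf power2_eq_square algebra_simps)
  also have "\<dots> = \<gamma> * (?n\<^sup>2 * (?n\<^sup>2 - 1))"
    by (simp add: power2_eq_square algebra_simps)
  finally have *: "\<gamma> * (?n\<^sup>2 * (?n\<^sup>2 - 1)) = 4" by simp
  then have nz: "?n\<^sup>2 * (?n\<^sup>2 - 1) \<noteq> 0" using n4 by auto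
  have "\<beta> = 3 / 2 * \<gamma>" using \<gamma>_eq by simp
  also have "\<gamma> = 4 / (?n\<^sup>2 * (?n\<^sup>2 - 1))" using * nz by (metis nonzero_mult_div_cancel_right)
  finally show ?thesis by simp
qed

section \<open>Mixed fourth moments with a common mode\<close>

definition mixed_moment :: "nat \<Rightarrow> nat \<Rightarrow> nat \<Rightarrow> nat \<Rightarrow> nat \<Rightarrow> nat \<Rightarrow> nat \<Rightarrow> complex" where
  "mixed_moment j x y z x' y' z' =
     integral\<^sup>L \<mu> (\<lambda>W. minor W j x * minor W y z * cnj (minor W j x' * minor W y' z'))"

lemma mixed_moment_swap_left: "mixed_moment j x y z x' y' z' = - mixed_moment j x z y x' y' z'"
  unfolding mixed_moment_def Bochner_Integration.integral_minus[symmetric]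
  by (simp add: minor_antisym[of _ y z])

lemma mixed_moment_swap_right: "mixed_moment j x y z x' y' z' = - mixed_moment j x y z x' z' y'"
  unfolding mixed_moment_def Bochner_Integration.integral_minus[symmetric]
  by (simp add: minor_antisym[of _ y' z'])

text \<open>These moments come from |g|^2 after collecting the plain minors on one side and the
  conjugated ones on the other, so \<open>j\<close> cancels. A phase s on mode \<open>m\<close>
  multiplies the integrand by exp (- i s (c - c')), where c and c' count \<open>m\<close> on the two
  sides.\<close>

lemma mixed_moment_unmatched:
  assumes "j < n" "x < n" "y < n" "z < n" "x' < n" "y' < n" "z' < n"
    and cnt: "of_bool (x = m) + of_bool (y = m) + of_bool (z = m) \<noteq>
      (of_bool (x' = m) + of_bool (y' = m) + of_bool (z' = m) :: real)" (is "?c \<noteq> ?c'")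
  shows "mixed_moment j x y z x' y' z' = 0"
  unfolding mixed_moment_def
proof (rule integral_phase_zero[where z = "- 1"])
  \<comment> \<open>Chosen so that the total phase is pi and the factor is -1.\<close>
  let ?s = "pi / (?c - ?c')"
  let ?t = "\<lambda>i. if i = m then ?s else 0"
  have t: "?t i = ?s * of_bool (i = m)" for i by simp
  fix W assume W: "W \<in> unitary_group n"
  have e: "exp (- \<i> * complex_of_real a) * exp (- \<i> * complex_of_real b) *
      (cnj (exp (- \<i> * complex_of_real c) * exp (- \<i> * complex_of_real d))) =
      exp (- \<i> * complex_of_real (a + b - c - d))" for a b c d
    by (simp add: exp_cnj mult_exp_exp algebra_simps)
  have "?t j + ?t x + (?t y + ?t z) - (?t j + ?t x') - (?t y' + ?t z') = ?s * (?c - ?c')"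
    unfolding t by (simp only: algebra_simps)
  also have "\<dots> = pi" using cnt by simp
  finally have pi: "?t j + ?t x + (?t y + ?t z) - (?t j + ?t x') - (?t y' + ?t z') = pi" .
  have "minor (W * phase_diag n ?t) j x * minor (W * phase_diag n ?t) y z *
      cnj (minor (W * phase_diag n ?t) j x' * minor (W * phase_diag n ?t) y' z') =
    (exp (- \<i> * complex_of_real (?t j + ?t x)) * exp (- \<i> * complex_of_real (?t y + ?t z)) *
      (cnj (exp (- \<i> * complex_of_real (?t j + ?t x')) * exp (- \<i> * complex_of_real (?t y' + ?t z'))))) *
    (minor W j x * minor W y z * cnj (minor W j x' * minor W y' z'))"
    unfolding minor_phase[OF W assms(1,2)] minor_phase[OF W assms(3,4)] minor_phase[OF W assms(1,5)]
      minor_phase[OF W assms(6,7)] complex_cnj_mult by (simp only: mult_ac)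
  also have "\<dots> = - 1 * (minor W j x * minor W y z * cnj (minor W j x' * minor W y' z'))"
    unfolding e pi exp_quarters(2) ..
  finally show "minor (W * phase_diag n ?t) j x * minor (W * phase_diag n ?t) y z *
      cnj (minor (W * phase_diag n ?t) j x' * minor (W * phase_diag n ?t) y' z') =
    - 1 * (minor W j x * minor W y z * cnj (minor W j x' * minor W y' z'))" .
qed (use assms in \<open>auto intro!: bounded_obs_intros\<close>)

lemma mixed_moment_diag:
  assumes "j < n" "x < n" "y < n" "z < n" "distinct [j, x, y, z]"
  shows "mixed_moment j x y z x y z = \<gamma>"
proof -
  have "mixed_moment j x y z x y z = integral\<^sup>L \<mu> (\<lambda>W. sqm j x W * sqm y z W)"
    by (simp add: mixed_moment_def sqm_def mult_ac)
  then show ?thesis using integral_sqm_four[OF assms] by simp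
qed

lemma mixed_moment_pair:
  assumes "j < n" "x < n" "z < n" "distinct [j, x, z]"
  shows "mixed_moment j x x z x x z = \<beta>"
proof -
  have "mixed_moment j x x z x x z = integral\<^sup>L \<mu> (\<lambda>W. sqm x j W * sqm x z W)"
    by (simp add: mixed_moment_def sqm_commute[of x j]) (simp add: sqm_def mult_ac)
  then show ?thesis using integral_sqm_three[of x j z] assms by simp
qed

text \<open>The Pluecker relation makes the cross moment half a diagonal one: with \<open>p1 = p2 - p3\<close> the
  parallelogram law gives \<open>2 Re E[p1 cnj p2] = \<gamma>\<close>, and exchanging \<open>x\<close> and \<open>y\<close> shows that it is real.\<close>

lemma mixed_moment_cross:
  assumes "j < n" "x < n" "y < n" "z < n" "distinct [j, x, y, z]"
  shows "2 * mixed_moment j x y z y x z = \<gamma>"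
proof -
  let ?p1 = "\<lambda>W. minor W j x * minor W y z"
  let ?p2 = "\<lambda>W. minor W j y * minor W x z"
  have sym: "mixed_moment j x y z y x z = mixed_moment j y x z x y z"
    unfolding mixed_moment_def
  proof (rule integral_translate[OF _ perm_matrix_unitary[of "Transposition.transpose x y"]])
    show \<sigma>: "Transposition.transpose x y permutes {..<n}" using assms by (intro permutes_swap_id) auto
    fix W assume "W \<in> unitary_group n"
    then show "minor (W * perm_matrix n (Transposition.transpose x y)) j y *
        minor (W * perm_matrix n (Transposition.transpose x y)) x z *
        cnj (minor (W * perm_matrix n (Transposition.transpose x y)) j x *
          minor (W * perm_matrix n (Transposition.transpose x y)) y z) =
        minor W j x * minor W y z * cnj (minor W j y * minor W x z)"
      using assms by (simp only: minor_perm[OF _ \<sigma>]) (simp add: Transposition.transpose_def)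
  qed (use assms in \<open>intro bounded_obs_intros\<close>)
  have bo: "bounded_obs (\<lambda>W. ?p1 W * cnj (?p2 W))" "bounded_obs (\<lambda>W. ?p2 W * cnj (?p1 W))"
    "bounded_obs (\<lambda>W. ?p1 W * cnj (?p1 W))" "bounded_obs (\<lambda>W. ?p2 W * cnj (?p2 W))"
    using assms by (intro bounded_obs_intros; simp)+
  have "mixed_moment j z x y z x y =
    integral\<^sup>L \<mu> (\<lambda>W. ?p1 W * cnj (?p1 W) + ?p2 W * cnj (?p2 W) - (?p1 W * cnj (?p2 W) + ?p2 W * cnj (?p1 W)))"
    unfolding mixed_moment_def
  proof (intro Bochner_Integration.integral_cong refl)
    fix W
    have "minor W j z * minor W x y = ?p2 W - ?p1 W"
      using minor_pluecker[of W j x y z] by (simp add: algebra_simps)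
    then show "minor W j z * minor W x y * cnj (minor W j z * minor W x y) =
      ?p1 W * cnj (?p1 W) + ?p2 W * cnj (?p2 W) - (?p1 W * cnj (?p2 W) + ?p2 W * cnj (?p1 W))"
      by (simp only:) (simp add: algebra_simps)
  qed
  also have "\<dots> = mixed_moment j x y z x y z + mixed_moment j y x z y x z
      - (mixed_moment j x y z y x z + mixed_moment j y x z x y z)"
    unfolding mixed_moment_def by (simp only: integral_add integral_diff bo bounded_obs_add)
  finally have "mixed_moment j z x y z x y = mixed_moment j x y z x y z + mixed_moment j y x z y x z
      - (mixed_moment j x y z y x z + mixed_moment j y x z x y z)" .
  moreover have "mixed_moment j z x y z x y = \<gamma>" "mixed_moment j x y z x y z = \<gamma>"
    "mixed_moment j y x z y x z = \<gamma>"
    using assms by (auto intro!: mixed_moment_diag)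
  ultimately show ?thesis using sym by (simp add: algebra_simps)
qed

text \<open>Equal multiplicities make one triple a permutation of the other, and testing the values
  \<open>x\<close>, \<open>y\<close>, \<open>z\<close> already detects this. The multiplicities are
  real because they serve as phase exponents.\<close>

lemma triple_match_cases:
  assumes "y \<noteq> z" "y' \<noteq> z'"
    "\<And>m. of_bool (x = m) + of_bool (y = m) + of_bool (z = m) =
      (of_bool (x' = m) + of_bool (y' = m) + of_bool (z' = m) :: real)"
  shows "(x', y', z') \<in> {(x, y, z), (x, z, y), (y, x, z), (y, z, x), (z, x, y), (z, y, x)}"
  using assms(1,2) assms(3)[of x] assms(3)[of y] assms(3)[of z]
  by (auto simp: of_bool_def split: if_splits)

lemma triple_mismatch:
  fixes f :: "nat \<Rightarrow> real"
  assumes "f x + f y + f z \<noteq> f x' + f y' + f z'"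
  shows "\<not> (x = x' \<and> y = y' \<and> z = z')" "\<not> (x = x' \<and> y = z' \<and> z = y')"
    "\<not> (x = y' \<and> y = x' \<and> z = z')" "\<not> (x = y' \<and> y = z' \<and> z = x')"
    "\<not> (x = z' \<and> y = x' \<and> z = y')" "\<not> (x = z' \<and> y = y' \<and> z = x')"
  using assms by (auto simp: add_ac)

text \<open>Up to scale this is the kernel, on a vector tensor a 2-vector over the modes other than
  \<open>j\<close>, of the projection that kills the totally antisymmetric part, as the Pluecker
  relation demands. Repeated indices fit the same formula: for x = y two terms fire together and
  give 2/3 + 1/3 of \<beta>, while distinct indices give 2/3 \<beta> = \<gamma> or half of it, up to
  sign.\<close>

lemma mixed_moment_eq:
  assumes "j < n" "x < n" "y < n" "z < n" "x' < n" "y' < n" "z' < n"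
    and j: "j \<notin> {x, y, z, x', y', z'}"
  shows "mixed_moment j x y z x' y' z' = \<beta> / 3 *
    (2 * of_bool (x = x') * (of_bool (y = y' \<and> z = z') - of_bool (y = z' \<and> z = y'))
      + of_bool (x = y') * (of_bool (y = x' \<and> z = z') - of_bool (y = z' \<and> z = x'))
      - of_bool (x = z') * (of_bool (y = x' \<and> z = y') - of_bool (y = y' \<and> z = x')))"
proof -
  have \<beta>: "\<beta> = 3 / 2 * \<gamma>" using \<gamma>_eq by simp
  have l: "mixed_moment j x y y x' y' z' = 0" for y using mixed_moment_swap_left[of j x y y] by simp
  have r: "mixed_moment j x y z x' z' z' = 0" for z' using mixed_moment_swap_right[of j x y z x' z' z'] by simp
  consider "y = z" | "y' = z'"
    | m where "of_bool (x = m) + of_bool (y = m) + of_bool (z = m) \<noteq>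
      (of_bool (x' = m) + of_bool (y' = m) + of_bool (z' = m) :: real)"
    | "y \<noteq> z" "(x', y', z') \<in> {(x, y, z), (x, z, y), (y, x, z), (y, z, x), (z, x, y), (z, y, x)}" "y' \<noteq> z'"
    using triple_match_cases[of y z y' z' x x'] by blast
  then show ?thesis
  proof cases
    case 3
    then have "mixed_moment j x y z x' y' z' = 0" by (rule mixed_moment_unmatched[OF assms(1-7)])
    moreover note f = triple_mismatch[of "\<lambda>x. of_bool (x = m)", OF 3]
    have "of_bool P * (of_bool Q - of_bool R) = (0 :: complex)" if "\<not> (P \<and> Q)" "\<not> (P \<and> R)" for P Q R
      using that by (cases P) auto
    note z = this[OF f(1,2)] this[OF f(3,4)] this[OF f(5,6)]
    ultimately show ?thesis by (simp only: mult.assoc z) simp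
  next
    case 4
    have ne: "z \<noteq> y" "x \<noteq> j" "y \<noteq> j" "z \<noteq> j" using 4 j by auto
    consider "x = y" | "x = z" | "x \<noteq> y" "x \<noteq> z" by blast
    then show ?thesis
    proof cases
      case 1
      then have m: "mixed_moment j x x z x x z = \<beta>" using assms 4 by (intro mixed_moment_pair) auto
      have "x' = x \<and> y' = x \<and> z' = z \<or> x' = x \<and> y' = z \<and> z' = x" using 1 4 by auto
      then show ?thesis
        by (elim disjE conjE) (simp_all add: 1[symmetric] ne(1)[unfolded 1[symmetric]] m
            mixed_moment_swap_right[of j x x z x z x])
    next
      case 2
      then have m: "mixed_moment j x x y x x y = \<beta>" using assms 4 by (intro mixed_moment_pair) auto
      have "x' = x \<and> y' = y \<and> z' = x \<or> x' = x \<and> y' = x \<and> z' = y" using 2 4 by auto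
      then show ?thesis
        by (elim disjE conjE) (simp_all add: 2[symmetric] ne(1)[unfolded 2[symmetric]] m
            mixed_moment_swap_left[of j x y x] mixed_moment_swap_right[of j x x y x y x])
    next
      case 3
      then have d: "distinct [j, x, y, z]" "distinct [j, x, z, y]" using 4 ne by auto
      have m: "mixed_moment j x y z x y z = \<gamma>" "mixed_moment j x y z y x z = \<gamma> / 2"
        "mixed_moment j x z y z x y = \<gamma> / 2"
        using mixed_moment_diag[OF assms(1-4) d(1)] mixed_moment_cross[OF assms(1-4) d(1)]
          mixed_moment_cross[OF assms(1,2,4,3) d(2)] by (auto simp: field_simps)
      note m' = mixed_moment_swap_right[of j x y z x z y, unfolded m(1)]
        mixed_moment_swap_right[of j x y z y z x, unfolded m(2)]
        mixed_moment_swap_left[of j x y z z x y, unfolded m(3)]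
      note m'' = mixed_moment_swap_right[of j x y z z y x, unfolded m'(3)]
      have "x' = x \<and> y' = y \<and> z' = z \<or> x' = x \<and> y' = z \<and> z' = y \<or> x' = y \<and> y' = x \<and> z' = z \<or>
        x' = y \<and> y' = z \<and> z' = x \<or> x' = z \<and> y' = x \<and> z' = y \<or> x' = z \<and> y' = y \<and> z' = x"
        using 4(2) by blast
      then show ?thesis
        using 3 ne(1)
        by (elim disjE conjE) (simp_all add: 3[symmetric] ne(1)[symmetric] m m' m'' \<beta>)
    qed
  qed (auto simp: l r)
qed

text \<open>The charge-one part of a quadratic form in the minors: each term contains mode
  \<open>j\<close> once, in the unconjugated factor. The division by 2 compensates for the ordered
  pairs \<open>a\<close>, \<open>b\<close>. The coefficients stay arbitrary until
  \<open>grad_kernel\<close> supplies those of the gradient.\<close>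

definition antidiag_obs :: "nat \<Rightarrow> (nat \<Rightarrow> nat \<Rightarrow> nat \<Rightarrow> complex) \<Rightarrow> complex mat \<Rightarrow> complex" where
  "antidiag_obs j R W = (\<Sum>d\<in>{..<n} - {j}. \<Sum>a\<in>{..<n} - {j}. \<Sum>b\<in>{..<n} - {j}.
     R d a b * (minor W j d * cnj (minor W a b))) / 2"

lemma bounded_obs_divide: "bounded_obs F \<Longrightarrow> bounded_obs (\<lambda>W. F W / c)"
  using bounded_obs_mult[OF _ bounded_obs_const[of "1 / c"], of F] by simp

lemma bounded_obs_antidiag: "j < n \<Longrightarrow> bounded_obs (antidiag_obs j R)"
  unfolding antidiag_obs_def[abs_def] by (intro bounded_obs_divide bounded_obs_intros) auto

lemma antidiag_obs_phase:
  assumes "W \<in> unitary_group n" "j < n"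
  shows "antidiag_obs j R (W * phase_diag n (\<lambda>i. if i = j then s else 0)) =
    exp (- \<i> * complex_of_real s) * antidiag_obs j R W"
proof -
  let ?W = "W * phase_diag n (\<lambda>i. if i = j then s else 0)"
  have "minor ?W j d * cnj (minor ?W a b) = exp (- \<i> * complex_of_real s) * (minor W j d * cnj (minor W a b))"
    if "d \<in> {..<n} - {j}" "a \<in> {..<n} - {j}" "b \<in> {..<n} - {j}" for d a b
    using that assms by (simp add: minor_phase_at del: mult_minus_left)
  then have "antidiag_obs j R ?W = (\<Sum>d\<in>{..<n} - {j}. \<Sum>a\<in>{..<n} - {j}. \<Sum>b\<in>{..<n} - {j}.
      exp (- \<i> * complex_of_real s) * (R d a b * (minor W j d * cnj (minor W a b)))) / 2"
    unfolding antidiag_obs_def by (intro arg_cong2[where f="(/)"] sum.cong refl) (simp only: mult.left_commute)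
  then show ?thesis
    unfolding antidiag_obs_def by (simp only: sum_distrib_left[symmetric] times_divide_eq_right)
qed

lemma integral_antidiag_obs: "j < n \<Longrightarrow> integral\<^sup>L \<mu> (antidiag_obs j R) = 0"
  by (rule integral_phase_zero[where z = "- 1" and t = "\<lambda>i. if i = j then pi else 0"])
    (auto intro!: bounded_obs_antidiag simp: antidiag_obs_phase exp_quarters(2)[simplified])

text \<open>The square carries charge two, so a quarter turn gives (-i)^2 = -1; the half turn that
  serves for the mean would give +1.\<close>

lemma integral_antidiag_obs_sq:
  assumes "j < n" shows "integral\<^sup>L \<mu> (\<lambda>W. (antidiag_obs j R W)\<^sup>2) = 0"
proof (rule integral_phase_zero[where z = "- 1" and t = "\<lambda>i. if i = j then pi / 2 else 0"])
  fix W assume W: "W \<in> unitary_group n"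
  show "(antidiag_obs j R (W * phase_diag n (\<lambda>i. if i = j then pi / 2 else 0)))\<^sup>2 = - 1 * (antidiag_obs j R W)\<^sup>2"
    unfolding antidiag_obs_phase[OF W assms] exp_quarters by (simp add: power_mult_distrib)
qed (auto intro!: bounded_obs_power bounded_obs_antidiag assms)

text \<open>In \<open>mixed_moment_eq\<close> the first bracket reproduces \<open>R\<close>, while
  the other two identify \<open>d\<close> with \<open>a\<close> or \<open>b\<close> and thereby
  produce the contraction \<open>G\<close>. This is how the partial trace of B enters the
  variance.\<close>

lemma integral_antidiag_obs_norm:
  assumes j: "j < n" and R: "\<And>d a b. R d b a = - R d a b"
  defines "J \<equiv> {..<n} - {j}"
  defines "G \<equiv> \<lambda>b. \<Sum>d\<in>J. R d d b"
  shows "integral\<^sup>L \<mu> (\<lambda>W. antidiag_obs j R W * cnj (antidiag_obs j R W)) =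
    \<beta> / 3 * ((\<Sum>d\<in>J. \<Sum>a\<in>J. \<Sum>b\<in>J. R d a b * cnj (R d a b)) + (\<Sum>b\<in>J. G b * cnj (G b)))"
proof -
  have J: "finite J" "\<And>i. i \<in> J \<Longrightarrow> i < n" "\<And>i. i \<in> J \<Longrightarrow> i \<noteq> j" by (auto simp: J_def)
  define h where "h = (\<lambda>(d, a, b) W. R d a b * (minor W j d * cnj (minor W a b)))"
  have g: "antidiag_obs j R W = (\<Sum>t\<in>J \<times> J \<times> J. h t W) / 2" for W
    unfolding antidiag_obs_def J_def[symmetric] h_def by (simp add: sum.cartesian_product split_def)
  have bh: "bounded_obs (h t)" if "t \<in> J \<times> J \<times> J" for t
    using that J j by (auto simp: h_def split_def intro!: bounded_obs_intros)
  have m: "integral\<^sup>L \<mu> (\<lambda>W. h (d, a, b) W * cnj (h (d', a', b') W)) =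
      R d a b * (cnj (R d' a' b') * mixed_moment j d a' b' d' a b)" for d a b d' a' b'
  proof -
    have "integral\<^sup>L \<mu> (\<lambda>W. h (d, a, b) W * cnj (h (d', a', b') W)) =
      integral\<^sup>L \<mu> (\<lambda>W. (R d a b * cnj (R d' a' b')) * (minor W j d * minor W a' b' * cnj (minor W j d' * minor W a b)))"
      by (simp add: h_def mult_ac)
    then show ?thesis by (simp add: mixed_moment_def mult.assoc)
  qed
  have mm: "mixed_moment j d a' b' d' a b = \<beta> / 3 *
      (2 * of_bool (d = d') * (of_bool (a' = a \<and> b' = b) - of_bool (a' = b \<and> b' = a))
      + of_bool (d = a) * (of_bool (a' = d' \<and> b' = b) - of_bool (a' = b \<and> b' = d'))
      - of_bool (d = b) * (of_bool (a' = d' \<and> b' = a) - of_bool (a' = a \<and> b' = d')))"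
    if "d \<in> J" "a \<in> J" "b \<in> J" "d' \<in> J" "a' \<in> J" "b' \<in> J" for d a b d' a' b'
    by (rule mixed_moment_eq) (use that j in \<open>auto simp: J_def\<close>)
  \<comment> \<open>Antisymmetry of \<open>R\<close> merges the two deltas of each bracket, which
    doubles the coefficients to 4, 2 and 2.\<close>
  have inner: "(\<Sum>a'\<in>J. \<Sum>b'\<in>J. cnj (R d' a' b') * mixed_moment j d a' b' d' a b) = \<beta> / 3 *
      (4 * of_bool (d = d') * cnj (R d' a b) + 2 * of_bool (d = a) * cnj (R d' d' b) - 2 * of_bool (d = b) * cnj (R d' d' a))"
    if "d \<in> J" "a \<in> J" "b \<in> J" "d' \<in> J" for d a b d'
  proof -
    have "(\<Sum>a'\<in>J. \<Sum>b'\<in>J. cnj (R d' a' b') * mixed_moment j d a' b' d' a b) = (\<Sum>a'\<in>J. \<Sum>b'\<in>J.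
       (\<beta> / 3 * (2 * of_bool (d = d'))) * (cnj (R d' a' b') * of_bool (a' = a \<and> b' = b))
       - (\<beta> / 3 * (2 * of_bool (d = d'))) * (cnj (R d' a' b') * of_bool (a' = b \<and> b' = a))
       + (\<beta> / 3 * of_bool (d = a)) * (cnj (R d' a' b') * of_bool (a' = d' \<and> b' = b))
       - (\<beta> / 3 * of_bool (d = a)) * (cnj (R d' a' b') * of_bool (a' = b \<and> b' = d'))
       - (\<beta> / 3 * of_bool (d = b)) * (cnj (R d' a' b') * of_bool (a' = d' \<and> b' = a))
       + (\<beta> / 3 * of_bool (d = b)) * (cnj (R d' a' b') * of_bool (a' = a \<and> b' = d')))"
      by (intro sum.cong refl, subst mm) (use that in \<open>simp_all only: ring_distribs mult_ac\<close>, simp_all)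
    also have "\<dots> = (\<beta> / 3 * (2 * of_bool (d = d'))) * cnj (R d' a b) - (\<beta> / 3 * (2 * of_bool (d = d'))) * cnj (R d' b a)
       + (\<beta> / 3 * of_bool (d = a)) * cnj (R d' d' b) - (\<beta> / 3 * of_bool (d = a)) * cnj (R d' b d')
       - (\<beta> / 3 * of_bool (d = b)) * cnj (R d' d' a) + (\<beta> / 3 * of_bool (d = b)) * cnj (R d' a d')"
      using that by (simp only: sum.distrib sum_subtractf sum_distrib_left[symmetric] sum_of_bool_pair[OF J(1)])
    also have "\<dots> = \<beta> / 3 *
      (4 * of_bool (d = d') * cnj (R d' a b) + 2 * of_bool (d = a) * cnj (R d' d' b) - 2 * of_bool (d = b) * cnj (R d' d' a))"
      unfolding R[of d' a b] R[of d' d' b] R[of d' d' a] complex_cnj_minus by (simp add: algebra_simps)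
    finally show ?thesis .
  qed
  have inner': "(\<Sum>d'\<in>J. \<Sum>a'\<in>J. \<Sum>b'\<in>J. cnj (R d' a' b') * mixed_moment j d a' b' d' a b) = \<beta> / 3 *
      (4 * cnj (R d a b) + 2 * of_bool (d = a) * cnj (G b) - 2 * of_bool (d = b) * cnj (G a))"
    if "d \<in> J" "a \<in> J" "b \<in> J" for d a b
  proof -
    have "(\<Sum>d'\<in>J. of_bool (d = d') * cnj (R d' a b)) = (\<Sum>d'\<in>J. if d' = d then cnj (R d a b) else 0)"
      by (intro sum.cong) auto
    then have e: "(\<Sum>d'\<in>J. of_bool (d = d') * cnj (R d' a b)) = cnj (R d a b)" using that J by simp
    show ?thesis
      using that
      by (simp only: inner cong: sum.cong)
        (simp only: sum.distrib sum_subtractf sum_distrib_left[symmetric] mult.assoc e G_def cnj_sum)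
  qed
  have "integral\<^sup>L \<mu> (\<lambda>W. antidiag_obs j R W * cnj (antidiag_obs j R W)) =
     integral\<^sup>L \<mu> (\<lambda>W. \<Sum>t\<in>J \<times> J \<times> J. \<Sum>t'\<in>J \<times> J \<times> J. 1 / 4 * (h t W * cnj (h t' W)))"
    unfolding g by (simp add: sum_product sum_divide_distrib)
  also have "\<dots> = (\<Sum>t\<in>J \<times> J \<times> J. \<Sum>t'\<in>J \<times> J \<times> J. integral\<^sup>L \<mu> (\<lambda>W. 1 / 4 * (h t W * cnj (h t' W))))"
    by (intro integral_sum2 bounded_obs_intros bh)
  also have "\<dots> = (\<Sum>t\<in>J \<times> J \<times> J. \<Sum>t'\<in>J \<times> J \<times> J. 1 / 4 * integral\<^sup>L \<mu> (\<lambda>W. h t W * cnj (h t' W)))"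
    by (intro sum.cong refl) simp
  also have "\<dots> = (\<Sum>d\<in>J. \<Sum>a\<in>J. \<Sum>b\<in>J. \<Sum>d'\<in>J. \<Sum>a'\<in>J. \<Sum>b'\<in>J.
      1 / 4 * (R d a b * (cnj (R d' a' b') * mixed_moment j d a' b' d' a b)))"
    by (simp only: sum.cartesian_product' m)
  also have "\<dots> = 1 / 4 * (\<Sum>d\<in>J. \<Sum>a\<in>J. \<Sum>b\<in>J. R d a b * (\<Sum>d'\<in>J. \<Sum>a'\<in>J. \<Sum>b'\<in>J.
      cnj (R d' a' b') * mixed_moment j d a' b' d' a b))"
    by (simp only: sum_distrib_left)
  also have "(\<Sum>d\<in>J. \<Sum>a\<in>J. \<Sum>b\<in>J. R d a b * (\<Sum>d'\<in>J. \<Sum>a'\<in>J. \<Sum>b'\<in>J.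
      cnj (R d' a' b') * mixed_moment j d a' b' d' a b)) =
    (\<Sum>d\<in>J. \<Sum>a\<in>J. \<Sum>b\<in>J. \<beta> / 3 * (4 * (R d a b * cnj (R d a b))) +
       (\<beta> / 3 * 2) * (of_bool (d = a) * R d a b * cnj (G b)) - (\<beta> / 3 * 2) * (of_bool (d = b) * R d a b * cnj (G a)))"
    by (intro sum.cong refl) (simp add: inner' algebra_simps)
  also have "\<dots> = \<beta> / 3 * (4 * (\<Sum>d\<in>J. \<Sum>a\<in>J. \<Sum>b\<in>J. R d a b * cnj (R d a b)))
    + (\<beta> / 3 * 2) * (\<Sum>d\<in>J. \<Sum>a\<in>J. \<Sum>b\<in>J. of_bool (d = a) * R d a b * cnj (G b))
    - (\<beta> / 3 * 2) * (\<Sum>d\<in>J. \<Sum>a\<in>J. \<Sum>b\<in>J. of_bool (d = b) * R d a b * cnj (G a))"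
    by (simp only: sum.distrib sum_subtractf sum_distrib_left[symmetric])
  also have "(\<Sum>d\<in>J. \<Sum>a\<in>J. \<Sum>b\<in>J. of_bool (d = a) * R d a b * cnj (G b)) = (\<Sum>b\<in>J. G b * cnj (G b))"
  proof -
    have "(\<Sum>a\<in>J. \<Sum>b\<in>J. of_bool (d = a) * R d a b * cnj (G b)) = (\<Sum>b\<in>J. R d d b * cnj (G b))" if "d \<in> J" for d
    proof -
      have "(\<Sum>a\<in>J. \<Sum>b\<in>J. of_bool (d = a) * R d a b * cnj (G b)) =
          (\<Sum>a\<in>J. if a = d then \<Sum>b\<in>J. R d d b * cnj (G b) else 0)"
        by (intro sum.cong) auto
      then show ?thesis using that J by simp
    qed
    then have "(\<Sum>d\<in>J. \<Sum>a\<in>J. \<Sum>b\<in>J. of_bool (d = a) * R d a b * cnj (G b)) = (\<Sum>d\<in>J. \<Sum>b\<in>J. R d d b * cnj (G b))"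
      by (rule sum.cong[OF refl])
    also have "\<dots> = (\<Sum>b\<in>J. \<Sum>d\<in>J. R d d b * cnj (G b))" by (rule sum.swap)
    finally show ?thesis by (simp only: sum_distrib_right[symmetric] G_def)
  qed
  also have "(\<Sum>d\<in>J. \<Sum>a\<in>J. \<Sum>b\<in>J. of_bool (d = b) * R d a b * cnj (G a)) = - (\<Sum>b\<in>J. G b * cnj (G b))"
  proof -
    have "(\<Sum>b\<in>J. of_bool (d = b) * R d a b * cnj (G a)) = - (R d d a * cnj (G a))" if "d \<in> J" for d a
    proof -
      have "(\<Sum>b\<in>J. of_bool (d = b) * R d a b * cnj (G a)) = (\<Sum>b\<in>J. if b = d then R d a d * cnj (G a) else 0)"
        by (intro sum.cong) auto
      then show ?thesis using that J R[of d d a] by simp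
    qed
    then have "(\<Sum>d\<in>J. \<Sum>a\<in>J. \<Sum>b\<in>J. of_bool (d = b) * R d a b * cnj (G a)) = (\<Sum>d\<in>J. \<Sum>a\<in>J. - (R d d a * cnj (G a)))"
      by (intro sum.cong refl)
    also have "\<dots> = - (\<Sum>a\<in>J. \<Sum>d\<in>J. R d d a * cnj (G a))" by (subst sum.swap) (simp add: sum_negf)
    finally show ?thesis by (simp only: sum_distrib_right[symmetric] G_def)
  qed
  \<comment> \<open>The 1/4 stems from the two halves in \<open>antidiag_obs\<close>. The
    contractions \<open>d = a\<close> and \<open>d = b\<close> add up, because their signs differ
    both here and in the value of the sum.\<close>
  also have "1 / 4 * (\<beta> / 3 * (4 * S) + \<beta> / 3 * 2 * X - \<beta> / 3 * 2 * (- X)) = \<beta> / 3 * (S + X)" for S X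
    by (simp add: field_simps)
  finally show ?thesis .
qed

text \<open>The prefactor is 2 \<beta> / 3, where the 2 comes from (2 Re g)^2 = 2 Re (g^2 +
  |g|^2).\<close>

lemma moments_re_antidiag_obs:
  assumes j: "j < n" and R: "\<And>d a b. R d b a = - R d a b"
  defines "J \<equiv> {..<n} - {j}"
  defines "f \<equiv> \<lambda>W. 2 * Re (antidiag_obs j R W)"
  shows "integrable \<mu> f" "integrable \<mu> (\<lambda>W. (f W)\<^sup>2)" "integral\<^sup>L \<mu> f = 0"
    "integral\<^sup>L \<mu> (\<lambda>W. (f W)\<^sup>2) = 4 / (real n ^ 2 * (real n ^ 2 - 1)) *
      ((\<Sum>d\<in>J. \<Sum>a\<in>J. \<Sum>b\<in>J. (cmod (R d a b))\<^sup>2) + (\<Sum>b\<in>J. (cmod (\<Sum>d\<in>J. R d d b))\<^sup>2))"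
proof -
  let ?g = "antidiag_obs j R"
  note bo = bounded_obs_antidiag[OF j, of R]
  have sq: "(f W)\<^sup>2 = Re (2 * (?g W)\<^sup>2 + 2 * (?g W * cnj (?g W)))" for W
    by (simp add: f_def power2_eq_square)
  have bo2: "bounded_obs (\<lambda>W. 2 * (?g W)\<^sup>2)" "bounded_obs (\<lambda>W. 2 * (?g W * cnj (?g W)))"
    by (intro bounded_obs_intros bo)+
  show "integrable \<mu> f" unfolding f_def
    using bounded_obs_integrable[OF bo] by (intro integrable_mult_right integrable_Re)
  show "integrable \<mu> (\<lambda>W. (f W)\<^sup>2)" unfolding sq
    by (intro integrable_Re bounded_obs_integrable bounded_obs_add bo2)
  show "integral\<^sup>L \<mu> f = 0"
    using integral_antidiag_obs[OF j, of R] bounded_obs_integrable[OF bo]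
    by (simp add: f_def integral_Re)
  have "integral\<^sup>L \<mu> (\<lambda>W. (f W)\<^sup>2) = Re (integral\<^sup>L \<mu> (\<lambda>W. 2 * (?g W)\<^sup>2 + 2 * (?g W * cnj (?g W))))"
    unfolding sq by (intro integral_Re bounded_obs_integrable bounded_obs_add bo2)
  also have "integral\<^sup>L \<mu> (\<lambda>W. 2 * (?g W)\<^sup>2 + 2 * (?g W * cnj (?g W))) =
      2 * integral\<^sup>L \<mu> (\<lambda>W. (?g W)\<^sup>2) + 2 * integral\<^sup>L \<mu> (\<lambda>W. ?g W * cnj (?g W))"
    by (simp only: integral_add[OF bo2] integral_mult_right_zero)
  also have "\<dots> = 2 * (\<beta> / 3 * ((\<Sum>d\<in>J. \<Sum>a\<in>J. \<Sum>b\<in>J. R d a b * cnj (R d a b))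
      + (\<Sum>b\<in>J. (\<Sum>d\<in>J. R d d b) * cnj (\<Sum>d\<in>J. R d d b))))"
    unfolding integral_antidiag_obs_sq[OF j] integral_antidiag_obs_norm[OF j R] J_def by simp
  also have "\<dots> = complex_of_real (4 / (real n ^ 2 * (real n ^ 2 - 1)) *
      ((\<Sum>d\<in>J. \<Sum>a\<in>J. \<Sum>b\<in>J. (cmod (R d a b))\<^sup>2) + (\<Sum>b\<in>J. (cmod (\<Sum>d\<in>J. R d d b))\<^sup>2)))"
    unfolding \<beta>_value complex_norm_square[symmetric] of_real_sum[symmetric] of_real_add[symmetric]
    by simp
  finally show "integral\<^sup>L \<mu> (\<lambda>W. (f W)\<^sup>2) = 4 / (real n ^ 2 * (real n ^ 2 - 1)) *
      ((\<Sum>d\<in>J. \<Sum>a\<in>J. \<Sum>b\<in>J. (cmod (R d a b))\<^sup>2) + (\<Sum>b\<in>J. (cmod (\<Sum>d\<in>J. R d d b))\<^sup>2))"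
    by (simp only: Re_complex_of_real)
qed

end

subsection \<open>Loss and gradient as two-body expectations\<close>

text \<open>For distinct modes n_q commutes with f_p, so the product is normal ordered without a
  one-body correction and its expectation is a squared norm.\<close>

lemma fock_inner_num_ops:
  assumes "p < n" "q < n" "p \<noteq> q"
  shows "fock_inner n \<chi> (num_op p (num_op q \<chi>)) = fock_inner n (annih q (annih p \<chi>)) (annih q (annih p \<chi>))"
proof -
  have "num_op p (num_op q \<chi>) = create p (create q (annih q (annih p \<chi>)))"
  proof
    fix S
    have "create p (num_op q (annih p \<chi>)) S = num_op p (num_op q \<chi>) S"
      using assms(3) by (auto simp: num_op_apply create_def annih_def insert_absorb jw_sign_remove)
    then show "num_op p (num_op q \<chi>) S = create p (create q (annih q (annih p \<chi>))) S"
      by (simp add: num_op_def)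
  qed
  then show ?thesis using assms by (simp add: fock_inner_create)
qed

text \<open>Exchanging \<open>c\<close> and \<open>d\<close> flips the sign of f_d f_c, so only the
  antisymmetric part of the coefficients survives. With rows \<open>p\<close> and \<open>q\<close>
  of a matrix for \<open>w\<close> and \<open>u\<close>, that part consists of the minors.\<close>

lemma annih_vec_annih_vec:
  "annih_vec n u (annih_vec n w \<psi>) S =
    (\<Sum>c<n. \<Sum>d<n. (w c * u d - w d * u c) * annih d (annih c \<psi>) S) / 2"
proof -
  have "annih_vec n u (annih_vec n w \<psi>) S = (\<Sum>d<n. \<Sum>c<n. w c * u d * annih d (annih c \<psi>) S)"
    unfolding annih_vec_def[of n u] annih_vec_def[of n w, abs_def] annih_sum
    by (simp add: sum_distrib_left mult_ac)
  then have 1: "annih_vec n u (annih_vec n w \<psi>) S = (\<Sum>c<n. \<Sum>d<n. w c * u d * annih d (annih c \<psi>) S)"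
    by (subst sum.swap) simp
  have "(\<Sum>c<n. \<Sum>d<n. w d * u c * annih d (annih c \<psi>) S) = (\<Sum>c<n. \<Sum>d<n. w c * u d * annih c (annih d \<psi>) S)"
    by (rule sum.swap)
  also have "\<dots> = (\<Sum>c<n. \<Sum>d<n. - (w c * u d * annih d (annih c \<psi>) S))"
    by (intro sum.cong refl) (subst annih_annih, simp)
  finally show ?thesis
    unfolding 1 by (simp add: left_diff_distrib sum_subtractf sum_negf)
qed

lemma fock_inner_annih_vec2:
  "fock_inner n (annih_vec n u (annih_vec n w \<psi>)) (annih_vec n u (annih_vec n w \<psi>)) =
    (\<Sum>a<n. \<Sum>b<n. \<Sum>c<n. \<Sum>d<n. cnj (w a * u b - w b * u a) * (w c * u d - w d * u c) *
       fock_inner n (annih b (annih a \<psi>)) (annih d (annih c \<psi>))) / 4"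
proof -
  define m where "m = (\<lambda>(c, d). (w c * u d - w d * u c) / 2)"
  define \<phi> where "\<phi> = (\<lambda>(c, d). annih d (annih c \<psi>))"
  have *: "annih_vec n u (annih_vec n w \<psi>) = (\<lambda>S. \<Sum>x\<in>{..<n} \<times> {..<n}. m x * \<phi> x S)"
    by (rule ext) (simp add: annih_vec_annih_vec m_def \<phi>_def sum.cartesian_product' sum_divide_distrib)
  have "fock_inner n (annih_vec n u (annih_vec n w \<psi>)) (annih_vec n u (annih_vec n w \<psi>)) =
    (\<Sum>x\<in>{..<n} \<times> {..<n}. \<Sum>y\<in>{..<n} \<times> {..<n}. cnj (m x) * (m y * fock_inner n (\<phi> x) (\<phi> y)))"
    unfolding * fock_inner_sum_left fock_inner_sum_right by (simp add: sum_distrib_left)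
  also have "\<dots> = (\<Sum>a<n. \<Sum>b<n. \<Sum>c<n. \<Sum>d<n. cnj (w a * u b - w b * u a) * (w c * u d - w d * u c) *
       fock_inner n (annih b (annih a \<psi>)) (annih d (annih c \<psi>)) / 4)"
    unfolding sum.cartesian_product' by (intro sum.cong refl) (simp add: m_def \<phi>_def)
  finally show ?thesis by (simp add: sum_divide_distrib)
qed

text \<open>A Gram matrix of the vectors f_q f_p psi; hermiticity, the partial trace and the norm
  bound all start from this form.\<close>

lemma rho2_eq_inner:
  assumes "r < n" "s < n"
  shows "rho2 n k a p q r s = fock_inner n (annih s (annih r (psi n k a))) (annih q (annih p (psi n k a)))"
  using assms by (simp add: rho2_def fock_inner_create)

lemma rho1_entry:
  assumes "p < n" "q < n"
  shows "rho1 n k a $$ (p, q) = fock_inner n (annih q (psi n k a)) (annih p (psi n k a))"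
  using assms by (simp add: rho1_def fock_inner_create)

lemma psi_supp: "fock_supp n k (psi n k a)"
  unfolding psi_def by (rule ext_power_supp)

lemma rho2_antisym_upper: "rho2 n k a q p r s = - rho2 n k a p q r s"
proof -
  have "annih p (annih q (psi n k a)) = (\<lambda>S. \<Sum>x\<in>{0::nat}. - 1 * annih q (annih p (psi n k a)) S)"
    by (rule ext) (subst annih_annih, simp)
  then show ?thesis
    unfolding rho2_def by (simp only: create_sum[abs_def] fock_inner_sum_right) simp
qed

lemma rho2_antisym_lower: "rho2 n k a p q s r = - rho2 n k a p q r s"
proof -
  have "create s (create r \<chi>) = (\<lambda>S. \<Sum>x\<in>{0::nat}. - 1 * create r (create s \<chi>) S)" for \<chi>
    by (rule ext) (subst create_create, simp)
  then show ?thesis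
    unfolding rho2_def by (simp only: fock_inner_sum_right) simp
qed

lemma cnj_rho2:
  assumes "p < n" "q < n" "r < n" "s < n"
  shows "cnj (rho2 n k a p q r s) = rho2 n k a r s p q"
  using assms by (simp add: rho2_eq_inner cnj_fock_inner)

lemma rho2_diag_upper [simp]: "rho2 n k a p p r s = 0"
  using rho2_antisym_upper[of n k a p p r s] by simp

lemma rho2_diag_lower [simp]: "rho2 n k a p q r r = 0"
  using rho2_antisym_lower[of n k a p q r r] by simp

text \<open>Summing over \<open>q\<close> puts the number operator on the (k - 1)-particle vector
  f_p psi.\<close>

lemma rho2_contraction:
  assumes "p < n" "r < n" "k > 0"
  shows "(\<Sum>q<n. rho2 n k a p q r q) = of_nat (k - 1) * rho1 n k a $$ (p, r)"
proof -
  have "fock_supp n (k - 1) (annih p (psi n k a))"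
    using annih_supp[of n "k - 1" "psi n k a" p] psi_supp[of n k a] assms(3) by simp
  then show ?thesis
    using assms by (simp add: rho2_eq_inner rho1_entry fock_inner_number)
qed

text \<open>Both annihilators pass through the exterior power. What is left of it is an isometry on
  k - 2 particles, so \<open>W\<close> survives only through its rows \<open>p\<close> and
  \<open>q\<close>.\<close>

lemma loss_eq_rho2:
  assumes W: "W \<in> unitary_group n" and "p < n" "q < n" "p \<noteq> q" "2 \<le> k"
  shows "complex_of_real (loss n k a p q W) =
    (\<Sum>c<n. \<Sum>d<n. \<Sum>b<n. \<Sum>e<n. row_minor p q W c d * cnj (row_minor p q W b e) * rho2 n k a c d b e) / 4"
proof -
  have Wc: "W \<in> carrier_mat n n" using W by (simp add: unitary_group_def)
  obtain m where k: "k = Suc (Suc m)" using assms(5) by (metis Suc_le_D numeral_2_eq_2 Suc_le_mono)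
  let ?\<psi> = "psi n k a"
  let ?a = "\<lambda>p. annih_vec n (\<lambda>a. W $$ (p, a))"
  have "annih p (ext_power n k W ?\<psi>) = ext_power n (Suc m) W (?a p ?\<psi>)"
    unfolding k by (rule ext, rule annih_ext_power) (use assms Wc in auto)
  moreover have "annih q (ext_power n (Suc m) W (?a p ?\<psi>)) = ext_power n m W (?a q (?a p ?\<psi>))"
    by (rule ext, rule annih_ext_power) (use assms Wc in auto)
  moreover have "fock_supp n m (?a q (?a p ?\<psi>))"
    using psi_supp[of n k a] unfolding k by (intro annih_vec_supp)
  then have "fock_inner n (ext_power n m W (?a q (?a p ?\<psi>))) (ext_power n m W (?a q (?a p ?\<psi>))) =
      fock_inner n (?a q (?a p ?\<psi>)) (?a q (?a p ?\<psi>))"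
    using W by (intro fock_inner_ext_power[OF Wc]) (auto simp: unitary_group_iff)
  ultimately have "complex_of_real (loss n k a p q W) = fock_inner n (?a q (?a p ?\<psi>)) (?a q (?a p ?\<psi>))"
    using assms by (simp add: of_real_loss fock_inner_num_ops)
  also have "\<dots> = (\<Sum>x\<in>{..<n} \<times> {..<n}. \<Sum>y\<in>{..<n} \<times> {..<n}.
      row_minor p q W (fst y) (snd y) * cnj (row_minor p q W (fst x) (snd x)) *
        rho2 n k a (fst y) (snd y) (fst x) (snd x)) / 4"
    unfolding fock_inner_annih_vec2 sum.cartesian_product'
    by (intro arg_cong2[where f = "(/)"] sum.cong refl) (simp add: rho2_eq_inner row_minor_def mult_ac)
  also have "(\<Sum>x\<in>{..<n} \<times> {..<n}. \<Sum>y\<in>{..<n} \<times> {..<n}.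
      row_minor p q W (fst y) (snd y) * cnj (row_minor p q W (fst x) (snd x)) *
        rho2 n k a (fst y) (snd y) (fst x) (snd x)) =
     (\<Sum>y\<in>{..<n} \<times> {..<n}. \<Sum>x\<in>{..<n} \<times> {..<n}.
      row_minor p q W (fst y) (snd y) * cnj (row_minor p q W (fst x) (snd x)) *
        rho2 n k a (fst y) (snd y) (fst x) (snd x))"
    by (rule sum.swap)
  finally show ?thesis unfolding sum.cartesian_product' by simp
qed

text \<open>The weight of a kernel entry under conjugation by a phase on mode \<open>j\<close>; \<open>B\<close> is \<open>charge * \<rho>\<^sub>2\<close>.\<close>

definition charge :: "nat \<Rightarrow> nat \<Rightarrow> nat \<Rightarrow> nat \<Rightarrow> nat \<Rightarrow> real" where
  "charge j p q r s = of_bool (p = j) + of_bool (q = j) - of_bool (r = j) - of_bool (s = j)"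

lemma sum_pairs_split:
  fixes f :: "nat \<Rightarrow> nat \<Rightarrow> 'a::comm_ring_1"
  assumes "j < n" "\<And>a b. f a b = f b a" "f j j = 0"
  defines "J \<equiv> {..<n} - {j}"
  shows "(\<Sum>a<n. \<Sum>b<n. f a b) = (\<Sum>a\<in>J. \<Sum>b\<in>J. f a b) + 2 * (\<Sum>b\<in>J. f j b)"
proof -
  have r: "(\<Sum>a<n. g a) = g j + (\<Sum>a\<in>J. g a)" for g :: "nat \<Rightarrow> 'a"
    unfolding J_def using assms(1) by (intro sum.remove) auto
  have "(\<Sum>a<n. \<Sum>b<n. f a b) = (f j j + (\<Sum>b\<in>J. f j b)) + (\<Sum>a\<in>J. f a j + (\<Sum>b\<in>J. f a b))"
    unfolding r ..
  also have "\<dots> = (\<Sum>a\<in>J. \<Sum>b\<in>J. f a b) + 2 * (\<Sum>b\<in>J. f j b)"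
  proof -
    have "(\<Sum>a\<in>J. f a j) = (\<Sum>b\<in>J. f j b)" by (intro sum.cong refl assms(2))
    then show ?thesis using assms(3) by (simp add: sum.distrib)
  qed
  finally show ?thesis .
qed

text \<open>Only the sectors with \<open>j\<close> in exactly one of the two pairs carry charge.\<close>

lemma sum_charged:
  fixes T :: "nat \<Rightarrow> nat \<Rightarrow> nat \<Rightarrow> nat \<Rightarrow> 'a::comm_ring_1"
  assumes j: "j < n"
    and up: "\<And>p q r s. T p q r s = T q p r s" and lo: "\<And>p q r s. T p q r s = T p q s r"
    and up0: "\<And>p r s. T p p r s = 0" and lo0: "\<And>p q r. T p q r r = 0"
    and neutral: "\<And>p q r s. charge j p q r s = 0 \<Longrightarrow> T p q r s = 0"
  defines "J \<equiv> {..<n} - {j}"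
  shows "(\<Sum>p<n. \<Sum>q<n. \<Sum>r<n. \<Sum>s<n. T p q r s) =
    2 * (\<Sum>q\<in>J. \<Sum>r\<in>J. \<Sum>s\<in>J. T j q r s) + 2 * (\<Sum>q\<in>J. \<Sum>r\<in>J. \<Sum>s\<in>J. T r s j q)"
proof -
  have inner: "(\<Sum>r<n. \<Sum>s<n. T p q r s) = (\<Sum>r\<in>J. \<Sum>s\<in>J. T p q r s) + 2 * (\<Sum>s\<in>J. T p q j s)" for p q
    unfolding J_def using j lo lo0 by (intro sum_pairs_split)
  have "(\<Sum>p<n. \<Sum>q<n. \<Sum>r<n. \<Sum>s<n. T p q r s) =
    (\<Sum>p\<in>J. \<Sum>q\<in>J. \<Sum>r<n. \<Sum>s<n. T p q r s) + 2 * (\<Sum>q\<in>J. \<Sum>r<n. \<Sum>s<n. T j q r s)"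
    unfolding J_def
  proof (rule sum_pairs_split[OF j])
    show "(\<Sum>r<n. \<Sum>s<n. T p q r s) = (\<Sum>r<n. \<Sum>s<n. T q p r s)" for p q
      by (intro sum.cong refl up)
  qed (simp add: up0)
  also have "(\<Sum>p\<in>J. \<Sum>q\<in>J. \<Sum>r<n. \<Sum>s<n. T p q r s) = (\<Sum>p\<in>J. \<Sum>q\<in>J. 2 * (\<Sum>s\<in>J. T p q j s))"
  proof (intro sum.cong refl)
    fix p q assume "p \<in> J" "q \<in> J"
    then have "T p q r s = 0" if "r \<in> J" "s \<in> J" for r s
      using that by (intro neutral) (simp add: J_def charge_def)
    then show "(\<Sum>r<n. \<Sum>s<n. T p q r s) = 2 * (\<Sum>s\<in>J. T p q j s)" by (simp add: inner)
  qed
  also have "\<dots> = 2 * (\<Sum>q\<in>J. \<Sum>r\<in>J. \<Sum>s\<in>J. T r s j q)"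
  proof -
    have "(\<Sum>p\<in>J. \<Sum>q\<in>J. \<Sum>s\<in>J. T p q j s) = (\<Sum>p\<in>J. \<Sum>s\<in>J. \<Sum>q\<in>J. T p q j s)"
      by (intro sum.cong refl sum.swap)
    also have "\<dots> = (\<Sum>s\<in>J. \<Sum>p\<in>J. \<Sum>q\<in>J. T p q j s)" by (rule sum.swap)
    finally show ?thesis by (simp only: sum_distrib_left[symmetric])
  qed
  also have "(\<Sum>q\<in>J. \<Sum>r<n. \<Sum>s<n. T j q r s) = (\<Sum>q\<in>J. \<Sum>r\<in>J. \<Sum>s\<in>J. T j q r s)"
  proof (rule sum.cong[OF refl])
    fix q assume "q \<in> J"
    then have "T j q j s = 0" if "s \<in> J" for s
      using that by (intro neutral) (simp add: J_def charge_def)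
    then show "(\<Sum>r<n. \<Sum>s<n. T j q r s) = (\<Sum>r\<in>J. \<Sum>s\<in>J. T j q r s)" by (simp add: inner)
  qed
  finally show ?thesis by (simp add: add.commute)
qed

text \<open>Each monomial rotates with a frequency equal to its charge. The two charged sectors are
  complex conjugates of each other, so the derivative is a single real part.\<close>

lemma loss_phase_has_derivative:
  fixes a :: "nat \<Rightarrow> real"
  assumes W: "W \<in> unitary_group n" and j: "j < n" and pq: "p < n" "q < n" "p \<noteq> q" and k: "2 \<le> k"
  defines "R \<equiv> \<lambda>d b c. - \<i> * rho2 n k a j d b c"
  defines "J \<equiv> {..<n} - {j}"
  shows "((\<lambda>s. loss n k a p q (W * phase_diag n (\<lambda>i. if i = j then s else 0))) has_real_derivative
      2 * Re ((\<Sum>d\<in>J. \<Sum>b\<in>J. \<Sum>c\<in>J. R d b c * (row_minor p q W j d * cnj (row_minor p q W b c))) / 2)) (at 0)"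
proof -
  let ?v = "row_minor p q W"
  define X where "X = (\<lambda>c d b e. ?v c d * cnj (?v b e) * rho2 n k a c d b e / 4)"
  define T where "T = (\<lambda>c d b e. - \<i> * of_real (charge j c d b e) * X c d b e)"
  have Wc: "W \<in> carrier_mat n n" using W by (simp add: unitary_group_def)
  \<comment> \<open>Separating real and imaginary parts turns the loss into a finite real
    trigonometric sum, which is differentiated termwise.\<close>
  have "loss n k a p q (W * phase_diag n (\<lambda>i. if i = j then s else 0)) =
     (\<Sum>c<n. \<Sum>d<n. \<Sum>b<n. \<Sum>e<n. Re (X c d b e) * cos (charge j c d b e * s) + Im (X c d b e) * sin (charge j c d b e * s))" for s
  proof -
    let ?t = "\<lambda>i. if i = j then s else 0"
    have t: "?t i = s * of_bool (i = j)" for i by simp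
    have v: "row_minor p q (W * phase_diag n ?t) c d * cnj (row_minor p q (W * phase_diag n ?t) b e) * rho2 n k a c d b e / 4
        = cis (- (charge j c d b e * s)) * X c d b e"
      if "c < n" "d < n" "b < n" "e < n" for b c d e
    proof -
      have "exp (- \<i> * complex_of_real (?t c + ?t d)) * cnj (exp (- \<i> * complex_of_real (?t b + ?t e)))
          = exp (- \<i> * complex_of_real (?t c + ?t d - (?t b + ?t e)))"
        by (simp add: exp_cnj mult_exp_exp algebra_simps)
      also have "?t c + ?t d - (?t b + ?t e) = charge j c d b e * s"
        unfolding t charge_def by (simp add: algebra_simps)
      also have "exp (- \<i> * complex_of_real (charge j c d b e * s)) = cis (- (charge j c d b e * s))"
        by (simp add: cis_conv_exp)
      finally have e: "exp (- \<i> * complex_of_real (?t c + ?t d)) * cnj (exp (- \<i> * complex_of_real (?t b + ?t e)))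
          = cis (- (charge j c d b e * s))" .
      show ?thesis
        unfolding e[symmetric] row_minor_phase[OF Wc pq(1,2) that(1,2)] row_minor_phase[OF Wc pq(1,2) that(3,4)] X_def
          complex_cnj_mult by (simp only: mult_ac times_divide_eq_right times_divide_eq_left)
    qed
    have "complex_of_real (loss n k a p q (W * phase_diag n ?t)) =
      (\<Sum>c<n. \<Sum>d<n. \<Sum>b<n. \<Sum>e<n. row_minor p q (W * phase_diag n ?t) c d *
        cnj (row_minor p q (W * phase_diag n ?t) b e) * rho2 n k a c d b e / 4)"
      using loss_eq_rho2[OF unitary_group_mult[OF W phase_diag_unitary] pq k] by (simp add: sum_divide_distrib)
    also have "\<dots> = (\<Sum>c<n. \<Sum>d<n. \<Sum>b<n. \<Sum>e<n. cis (- (charge j c d b e * s)) * X c d b e)"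
      by (intro sum.cong refl v) auto
    finally have "loss n k a p q (W * phase_diag n ?t) =
        Re (\<Sum>c<n. \<Sum>d<n. \<Sum>b<n. \<Sum>e<n. cis (- (charge j c d b e * s)) * X c d b e)"
      by (metis Re_complex_of_real)
    then show ?thesis by (simp add: mult.commute)
  qed
  moreover have "((\<lambda>s. \<Sum>c<n. \<Sum>d<n. \<Sum>b<n. \<Sum>e<n. Re (X c d b e) * cos (charge j c d b e * s) + Im (X c d b e) * sin (charge j c d b e * s))
    has_real_derivative (\<Sum>c<n. \<Sum>d<n. \<Sum>b<n. \<Sum>e<n. Re (T c d b e))) (at 0)"
    by (rule derivative_eq_intros refl sum.cong | simp add: T_def)+
  moreover have "(\<Sum>c<n. \<Sum>d<n. \<Sum>b<n. \<Sum>e<n. Re (T c d b e)) =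
    2 * Re ((\<Sum>d\<in>J. \<Sum>b\<in>J. \<Sum>c\<in>J. R d b c * (?v j d * cnj (?v b c))) / 2)"
  proof -
    have "(\<Sum>c<n. \<Sum>d<n. \<Sum>b<n. \<Sum>e<n. T c d b e) =
      2 * (\<Sum>q\<in>J. \<Sum>r\<in>J. \<Sum>s\<in>J. T j q r s) + 2 * (\<Sum>q\<in>J. \<Sum>r\<in>J. \<Sum>s\<in>J. T r s j q)"
      unfolding J_def
    proof (rule sum_charged[OF j])
      fix c d b e
      show "T c d b e = T d c b e"
        using rho2_antisym_upper[of n k a c d b e] by (simp add: T_def X_def charge_def row_minor_def algebra_simps)
      show "T c d b e = T c d e b"
        using rho2_antisym_lower[of n k a c d b e] by (simp add: T_def X_def charge_def row_minor_def algebra_simps)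
    qed (auto simp: T_def X_def)
    also have "(\<Sum>q\<in>J. \<Sum>r\<in>J. \<Sum>s\<in>J. T j q r s) = (\<Sum>d\<in>J. \<Sum>b\<in>J. \<Sum>c\<in>J. R d b c * (?v j d * cnj (?v b c))) / 4" (is "_ = ?G / 4")
      unfolding sum_divide_distrib by (intro sum.cong refl) (auto simp: T_def X_def R_def J_def charge_def)
    also have "(\<Sum>q\<in>J. \<Sum>r\<in>J. \<Sum>s\<in>J. T r s j q) = cnj (?G / 4)"
      unfolding sum_divide_distrib cnj_sum
      by (intro sum.cong refl) (use j in \<open>auto simp: T_def X_def R_def J_def charge_def cnj_rho2\<close>)
    finally have e: "(\<Sum>c<n. \<Sum>d<n. \<Sum>b<n. \<Sum>e<n. T c d b e) = 2 * (?G / 4) + 2 * cnj (?G / 4)" .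
    \<comment> \<open>The quadratic form has weight 1/4 and each sector occurs twice.\<close>
    have "Re (2 * (G / 4) + 2 * cnj (G / 4)) = 2 * Re (G / 2)" for G :: complex by simp
    then show ?thesis unfolding Re_sum[symmetric] e .
  qed
  ultimately show ?thesis by simp
qed

subsection \<open>The circuit and the commutator with a mode projection\<close>

lemma mat_diag_power: "mat_diag n f ^\<^sub>m m = mat_diag n (\<lambda>i. f i ^ m :: 'a::comm_semiring_1)"
proof (induction m)
  case 0
  then show ?case by (simp add: mat_diag_def one_mat_def)
next
  case (Suc m)
  then show ?case by (simp add: mat_diag_diag mult.commute)
qed

lemma mat_exp_diag: "mat_exp (mat_diag n f) = mat_diag n (\<lambda>i. exp (f i))"
proof (rule eq_matI)
  fix i l assume "i < dim_row (mat_diag n (\<lambda>i. exp (f i)))" "l < dim_col (mat_diag n (\<lambda>i. exp (f i)))"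
  then have il: "i < n" "l < n" by (simp_all add: mat_diag_def)
  have "mat_exp (mat_diag n f) $$ (i, l) = (\<Sum>m. (if i = l then f l ^ m else 0) / fact m)"
    using il by (simp add: mat_exp_def mat_diag_power) (simp add: mat_diag_def)
  also have "\<dots> = (if i = l then exp (f l) else 0)"
  proof (cases "i = l")
    case True
    have "(\<lambda>m. f l ^ m / fact m) sums exp (f l)"
      using exp_converges[of "f l"] by (simp add: scaleR_conv_of_real divide_inverse mult.commute)
    then show ?thesis using True by (simp add: sums_unique[symmetric])
  qed simp
  finally show "mat_exp (mat_diag n f) $$ (i, l) = mat_diag n (\<lambda>i. exp (f i)) $$ (i, l)"
    using il by (simp add: mat_diag_def)
qed (simp_all add: mat_exp_def mat_diag_def)

lemma mat_exp_proj_mode: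
  "mat_exp ((- \<i> * complex_of_real s) \<cdot>\<^sub>m proj_mode n j) = phase_diag n (\<lambda>i. if i = j then s else 0)"
proof -
  have "(- \<i> * complex_of_real s) \<cdot>\<^sub>m proj_mode n j =
      mat_diag n (\<lambda>i. - \<i> * complex_of_real (if i = j then s else 0))"
    by (rule eq_matI) (auto simp: proj_mode_def mat_diag_def)
  then show ?thesis by (simp only: mat_exp_diag phase_diag_def)
qed

lemma phase_diag_mult: "phase_diag n f * phase_diag n g = phase_diag n (\<lambda>i. f i + g i)"
  unfolding phase_diag_def mat_diag_diag by (simp add: mult_exp_exp distrib_left)

lemma foldr_mult_unitary:
  "(\<And>V. V \<in> set Vs \<Longrightarrow> V \<in> unitary_group n) \<Longrightarrow> foldr (*) Vs (1\<^sub>m n) \<in> unitary_group n"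
proof (induction Vs)
  case Nil
  have "(\<Sum>i<n. cnj (if i = a then 1 else 0) * (if i = b then 1 else 0)) = (of_bool (a = b) :: complex)" if "a < n" for a b
  proof -
    have "(\<Sum>i<n. cnj (if i = a then 1 else 0) * (if i = b then 1 else 0)) =
        (\<Sum>i<n. if i = a then of_bool (a = b) else (0 :: complex))"
      by (intro sum.cong) auto
    then show ?thesis using that by simp
  qed
  then show ?case by (simp add: unitary_group_iff)
qed (auto intro: unitary_group_mult)

lemma rotation_column_unitary:
  assumes "2 \<le> n" shows "rotation_column n \<omega> l \<in> unitary_group n"
  unfolding rotation_column_def
proof (rule foldr_mult_unitary)
  fix V assume "V \<in> set (map (\<lambda>m. case brick_pair n l m of (a, b) \<Rightarrow> rotation n a b (fst \<omega> l m)) [0..<n div 2])"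
  then obtain m where m: "m < n div 2" "V = (case brick_pair n l m of (a, b) \<Rightarrow> rotation n a b (fst \<omega> l m))" by auto
  have "2 * m + 1 < n" using m(1) by auto
  \<comment> \<open>In an even column the last pair closes the ring: for
    \<open>2 * m + 2 = n\<close> its second mode is 0.\<close>
  moreover have "(2 * m + 2) mod n \<noteq> 2 * m + 1 \<and> (2 * m + 2) mod n < n"
    using \<open>2 * m + 1 < n\<close> by (cases "2 * m + 2 = n") auto
  ultimately show "V \<in> unitary_group n"
    unfolding m(2) brick_pair_def by (auto intro!: rotation_unitary)
qed

lemma column_unitary: "2 \<le> n \<Longrightarrow> column n \<omega> l \<in> unitary_group n"
  unfolding column_def by (intro unitary_group_mult rotation_column_unitary phase_diag_unitary)

lemma columns_unitary: "2 \<le> n \<Longrightarrow> columns n \<omega> l \<in> unitary_group n"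
  using foldr_mult_unitary[of "[]" n] by (induction l) (auto intro: unitary_group_mult column_unitary)

lemma unitary_group_carrier: "V \<in> unitary_group n \<Longrightarrow> V \<in> carrier_mat n n"
  by (simp add: unitary_group_def)

lemma rotation_column_set_front_phase: "rotation_column n (set_front_phase j t \<omega>) l = rotation_column n \<omega> l"
  by (simp add: rotation_column_def set_front_phase_def)

text \<open>Column 1 is the rightmost factor and its phase layer is rightmost within it, so the
  shift splits off on the right and stays there while later columns are multiplied on the left.
  Counting by \<open>Suc l\<close> ensures that column 1 is present.\<close>

lemma columns_set_front_phase:
  assumes "2 \<le> n"
  shows "columns n (set_front_phase j t \<omega>) (Suc l) =
    columns n \<omega> (Suc l) * phase_diag n (\<lambda>i. if i = j then t - snd \<omega> 1 j else 0)"
proof (induction l)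
  case 0
  have "phase_diag n (snd (set_front_phase j t \<omega>) 1) =
      phase_diag n (snd \<omega> 1) * phase_diag n (\<lambda>i. if i = j then t - snd \<omega> 1 j else 0)"
    unfolding phase_diag_mult by (rule arg_cong[where f = "phase_diag n"]) (auto simp: set_front_phase_def)
  then show ?case
    using unitary_group_carrier[OF rotation_column_unitary[OF assms, of \<omega> 1]]
    by (simp add: column_def rotation_column_set_front_phase assoc_mult_mat[of _ n n _ n _ n]
        right_mult_one_mat[of _ n n] mult_carrier_mat[of _ n n])
next
  case (Suc l)
  have "column n (set_front_phase j t \<omega>) (Suc (Suc l)) = column n \<omega> (Suc (Suc l))"
    unfolding column_def rotation_column_set_front_phase by (simp add: set_front_phase_def)
  then show ?case
    using Suc unitary_group_carrier[OF column_unitary[OF assms]] unitary_group_carrier[OF columns_unitary[OF assms]]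
    by (simp add: assoc_mult_mat[of _ n n _ n _ n] del: columns.simps add: columns.simps(2)[of n _ "Suc l"])
qed

lemma circuit_set_front_phase:
  assumes "2 \<le> n"
  shows "circuit n (set_front_phase j t \<omega>) =
    circuit n \<omega> * phase_diag n (\<lambda>i. if i = j then t - snd \<omega> 1 j else 0)"
  using columns_set_front_phase[OF assms, of j t \<omega> "n - 1"] assms by (simp add: circuit_def)

lemma circuit_unitary: "2 \<le> n \<Longrightarrow> circuit n \<omega> \<in> unitary_group n"
  by (simp add: circuit_def columns_unitary)

text \<open>The coefficients of \<open>antidiag_obs\<close> that belong to the gradient; the factor
  -i is the derivative of exp (- i s) at 0.\<close>

definition grad_kernel :: "nat \<Rightarrow> nat \<Rightarrow> (nat \<Rightarrow> real) \<Rightarrow> nat \<Rightarrow> nat \<Rightarrow> nat \<Rightarrow> nat \<Rightarrow> complex" where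
  "grad_kernel n k a j d b c = - \<i> * rho2 n k a j d b c"

text \<open>Both curves are one function of the shift: the first takes the angle, which is the shift
  plus its current value, the second the shift itself.\<close>

lemma loss_derivatives:
  fixes a :: "nat \<Rightarrow> real"
  assumes "2 \<le> n" and j: "j < n" and pq: "p < n" "q < n" "p \<noteq> q" and k: "2 \<le> k"
  defines "D \<equiv> \<lambda>W. 2 * Re ((\<Sum>d\<in>{..<n} - {j}. \<Sum>b\<in>{..<n} - {j}. \<Sum>c\<in>{..<n} - {j}.
    grad_kernel n k a j d b c * (row_minor p q W j d * cnj (row_minor p q W b c))) / 2)"
  shows "(loss_front_phase n k a p q j \<omega> has_real_derivative D (circuit n \<omega>)) (at (snd \<omega> 1 j))"
    and "(loss_along_mode n k a p q j (circuit n \<omega>) has_real_derivative D (circuit n \<omega>)) (at 0)"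
proof -
  let ?L = "\<lambda>s. loss n k a p q (circuit n \<omega> * phase_diag n (\<lambda>i. if i = j then s else 0))"
  have L: "(?L has_real_derivative D (circuit n \<omega>)) (at 0)"
    unfolding D_def grad_kernel_def
    by (rule loss_phase_has_derivative[OF circuit_unitary[OF assms(1)] j pq k])
  have "loss_along_mode n k a p q j (circuit n \<omega>) = ?L"
    by (rule ext) (simp only: loss_along_mode_def mat_exp_proj_mode)
  then show "(loss_along_mode n k a p q j (circuit n \<omega>) has_real_derivative D (circuit n \<omega>)) (at 0)"
    using L by simp
  have "loss_front_phase n k a p q j \<omega> = (\<lambda>t. ?L (t - snd \<omega> 1 j))"
    by (rule ext) (simp only: loss_front_phase_def circuit_set_front_phase[OF assms(1)])
  moreover have "((\<lambda>t. ?L (t - snd \<omega> 1 j)) has_real_derivative D (circuit n \<omega>) * 1) (at (snd \<omega> 1 j))"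
    by (rule DERIV_chain2[where f = ?L]) (use L in \<open>auto intro!: derivative_eq_intros\<close>)
  ultimately show "(loss_front_phase n k a p q j \<omega> has_real_derivative D (circuit n \<omega>)) (at (snd \<omega> 1 j))"
    by simp
qed

section \<open>The commutator with a mode projection in coordinates\<close>

lemma k2_id_antisym_upper: "k2_id q p r s = - k2_id p q r s"
  by (simp add: k2_id_def conj_commute)

lemma k2_id_antisym_lower: "k2_id p q s r = - k2_id p q r s"
  by (simp add: k2_id_def)

lemma dLambda2_proj_mode:
  assumes "p < n" "q < n" "r < n" "s < n"
  shows "dLambda2 n (proj_mode n j) p q r s = (of_bool (r = j) + of_bool (s = j)) * k2_id p q r s"
proof -
  have "(proj_mode n j *\<^sub>v unit_vec n t) $ i = of_bool (i = j \<and> t = j)" if "i < n" "t < n" for i t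
    using that by (simp add: proj_mode_def)
  then show ?thesis
    using assms by (auto simp: dLambda2_def wedge2_def k2_id_def)
qed

lemma k2_id_transpose: "k2_id p q r s = k2_id r s p q"
  unfolding k2_id_def by (intro arg_cong2[where f = "(-)"] arg_cong[where f = of_bool]) auto

lemma sum_k2_id_left:
  assumes "p < n" "q < n"
  shows "(\<Sum>c<n. \<Sum>d<n. f c d * k2_id p q c d) = f p q - f q p"
proof -
  have "(\<Sum>c<n. \<Sum>d<n. f c d * k2_id p q c d) =
    (\<Sum>c<n. \<Sum>d<n. f c d * of_bool (c = p \<and> d = q)) - (\<Sum>c<n. \<Sum>d<n. f c d * of_bool (c = q \<and> d = p))"
    unfolding sum_subtractf[symmetric]
    by (intro sum.cong refl, subst k2_id_transpose) (simp add: k2_id_def right_diff_distrib)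
  then show ?thesis using assms by (simp only: sum_of_bool_pair finite_lessThan lessThan_iff)
qed

text \<open>The generator is diagonal in the basis e_p wedge e_q and counts occurrences of
  \<open>j\<close>, so the commutator multiplies each entry by a difference of counts. The multiple
  of the identity subtracted in \<open>rho2_g2\<close> drops out, because the identity kernel has no
  charged entries.\<close>

lemma B_op_entry:
  assumes "p < n" "q < n" "r < n" "s < n"
  shows "B_op n k a j p q r s = charge j p q r s * rho2 n k a p q r s"
proof -
  let ?Y = "rho2_g2 n k a" and ?g = "dLambda2 n (proj_mode n j)"
  have up: "?Y q p r s = - ?Y p q r s" for p q r s
    using rho2_antisym_upper[of n k a q p r s] k2_id_antisym_upper[of q p r s] by (simp add: rho2_g2_def)
  have lo: "?Y p q s r = - ?Y p q r s" for p q r s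
    using rho2_antisym_lower[of n k a p q s r] k2_id_antisym_lower[of p q s r] by (simp add: rho2_g2_def)
  have "(\<Sum>c<n. \<Sum>d<n. ?g p q c d * ?Y c d r s) =
      (\<Sum>c<n. \<Sum>d<n. ((of_bool (c = j) + of_bool (d = j)) * ?Y c d r s) * k2_id p q c d)"
    using assms by (intro sum.cong refl) (simp add: dLambda2_proj_mode)
  also have "\<dots> = 2 * (of_bool (p = j) + of_bool (q = j)) * ?Y p q r s"
    unfolding sum_k2_id_left[OF assms(1,2)] up[of q p] by (simp only: ring_distribs mult_2 mult_minus_right minus_minus diff_conv_add_uminus add_ac)
  finally have 1: "k2_mult n ?g ?Y p q r s = (of_bool (p = j) + of_bool (q = j)) * ?Y p q r s"
    by (simp add: k2_mult_def)
  have "(\<Sum>c<n. \<Sum>d<n. ?Y p q c d * ?g c d r s) =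
      (\<Sum>c<n. \<Sum>d<n. ((of_bool (r = j) + of_bool (s = j)) * ?Y p q c d) * k2_id r s c d)"
    using assms by (intro sum.cong refl) (simp add: dLambda2_proj_mode k2_id_transpose[of r s])
  also have "\<dots> = 2 * (of_bool (r = j) + of_bool (s = j)) * ?Y p q r s"
    unfolding sum_k2_id_left[OF assms(3,4)] lo[of p q s r] by (simp only: mult_minus_right diff_minus_eq_add mult.assoc mult_2 distrib_right)
  finally have 2: "k2_mult n ?Y ?g p q r s = (of_bool (r = j) + of_bool (s = j)) * ?Y p q r s"
    by (simp add: k2_mult_def)
  have "charge j p q r s * k2_id p q r s = 0"
  proof -
    have "charge j p q p q = 0" "charge j p q q p = 0" for p q
      by (simp_all add: charge_def)
    then have "charge j p q r s = 0" if "p = r \<and> q = s \<or> p = s \<and> q = r" using that by blast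
    moreover have "k2_id p q r s = 0" if "\<not> (p = r \<and> q = s \<or> p = s \<and> q = r)"
      using that unfolding k2_id_def by (simp only: de_Morgan_disj) simp
    ultimately show ?thesis by auto
  qed
  then have "charge j p q r s * ?Y p q r s = charge j p q r s * rho2 n k a p q r s"
    by (auto simp: rho2_g2_def right_diff_distrib)
  moreover have "B_op n k a j p q r s = charge j p q r s * ?Y p q r s"
    unfolding B_op_def k2_comm_def 1 2 left_diff_distrib[symmetric]
    by (simp add: charge_def diff_diff_eq)
  ultimately show ?thesis by simp
qed

text \<open>The traced index occurs once above and once below, so its share of the charge
  cancels.\<close>

lemma contraction_B_op_entry:
  assumes "p < n" "r < n" "k > 0"
  shows "contraction n (B_op n k a j) $$ (p, r) =
    of_nat (k - 1) * ((of_bool (p = j) - of_bool (r = j)) * rho1 n k a $$ (p, r))"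
proof -
  have "contraction n (B_op n k a j) $$ (p, r) =
      (\<Sum>q<n. (of_bool (p = j) - of_bool (r = j)) * rho2 n k a p q r q)"
    using assms by (simp add: contraction_def B_op_entry charge_def)
  then show ?thesis
    unfolding sum_distrib_left[symmetric] rho2_contraction[OF assms] by (simp only: mult.left_commute)
qed

lemma contraction_B_op:
  assumes "k > 0"
  shows "contraction n (B_op n k a j) =
    of_nat (k - 1) \<cdot>\<^sub>m (proj_mode n j * rho1 n k a - rho1 n k a * proj_mode n j)" (is "_ = ?R")
proof (rule eq_matI)
  have c: "proj_mode n j \<in> carrier_mat n n" "rho1 n k a \<in> carrier_mat n n"
    by (simp_all add: proj_mode_def rho1_def)
  fix p r assume "p < dim_row ?R" "r < dim_col ?R"
  then have pr: "p < n" "r < n" using c by auto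
  have "(proj_mode n j * rho1 n k a) $$ (p, r) = (\<Sum>c<n. if c = p then of_bool (p = j) * rho1 n k a $$ (p, r) else 0)"
    unfolding mat_mult_entry[OF c pr] using pr by (intro sum.cong) (auto simp: proj_mode_def)
  moreover have "(rho1 n k a * proj_mode n j) $$ (p, r) = (\<Sum>c<n. if c = r then of_bool (r = j) * rho1 n k a $$ (p, r) else 0)"
    unfolding mat_mult_entry[OF c(2,1) pr] using pr by (intro sum.cong) (auto simp: proj_mode_def)
  ultimately show "contraction n (B_op n k a j) $$ (p, r) = ?R $$ (p, r)"
    using pr c by (simp add: contraction_B_op_entry[OF pr assms] algebra_simps del: index_mult_mat(1))
qed (simp_all add: contraction_def proj_mode_def rho1_def)

text \<open>A charge of modulus 2 requires a repeated index, where the kernel vanishes, so the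
  relevant squared charges are 1. The two charged sectors are adjoint to each other and each is
  counted twice, which cancels the 1/4 of the trace.\<close>

lemma k2_frobenius_B_op:
  assumes "j < n"
  shows "(k2_frobenius n (B_op n k a j))\<^sup>2 =
    (\<Sum>d\<in>{..<n} - {j}. \<Sum>b\<in>{..<n} - {j}. \<Sum>c\<in>{..<n} - {j}. (cmod (rho2 n k a j d b c))\<^sup>2)"
proof -
  let ?J = "{..<n} - {j}"
  define T where "T = (\<lambda>p q r s. (charge j p q r s)\<^sup>2 * (cmod (rho2 n k a p q r s))\<^sup>2)"
  have "k2_trace_prod n (k2_adjoint (B_op n k a j)) (B_op n k a j) =
      (\<Sum>p<n. \<Sum>q<n. \<Sum>r<n. \<Sum>s<n. complex_of_real (T r s p q)) / 4"
    unfolding k2_trace_prod_def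
  proof (intro arg_cong2[where f = "(/)"] sum.cong refl)
    fix p q r s assume "p \<in> {..<n}" "q \<in> {..<n}" "r \<in> {..<n}" "s \<in> {..<n}"
    moreover have "complex_of_real (T r s p q) =
        (complex_of_real (charge j r s p q))\<^sup>2 * (rho2 n k a r s p q * cnj (rho2 n k a r s p q))"
      unfolding T_def of_real_mult complex_norm_square by simp
    ultimately show "k2_adjoint (B_op n k a j) p q r s * B_op n k a j r s p q = complex_of_real (T r s p q)"
      by (simp add: k2_adjoint_def B_op_entry power2_eq_square mult_ac)
  qed
  also have "(\<Sum>p<n. \<Sum>q<n. \<Sum>r<n. \<Sum>s<n. complex_of_real (T r s p q)) =
     complex_of_real (\<Sum>p<n. \<Sum>q<n. \<Sum>r<n. \<Sum>s<n. T r s p q)" by simp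
  also have "(\<Sum>p<n. \<Sum>q<n. \<Sum>r<n. \<Sum>s<n. T r s p q) =
    2 * (\<Sum>q\<in>?J. \<Sum>r\<in>?J. \<Sum>s\<in>?J. T r s j q) + 2 * (\<Sum>q\<in>?J. \<Sum>r\<in>?J. \<Sum>s\<in>?J. T j q r s)"
  proof (rule sum_charged[OF assms])
    fix p q r s
    show "T r s p q = T r s q p" "T r s p q = T s r p q"
      using rho2_antisym_lower[of n k a r s q p] rho2_antisym_upper[of n k a s r p q]
      by (simp_all add: T_def charge_def algebra_simps)
    show "charge j p q r s = 0 \<Longrightarrow> T r s p q = 0"
      by (simp add: T_def charge_def)
  qed (simp_all add: T_def)
  also have "(\<Sum>q\<in>?J. \<Sum>r\<in>?J. \<Sum>s\<in>?J. T r s j q) = (\<Sum>q\<in>?J. \<Sum>r\<in>?J. \<Sum>s\<in>?J. (cmod (rho2 n k a j q r s))\<^sup>2)"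
  proof (intro sum.cong refl)
    fix q r s assume "q \<in> ?J" "r \<in> ?J" "s \<in> ?J"
    then show "T r s j q = (cmod (rho2 n k a j q r s))\<^sup>2"
      using assms cnj_rho2[of j n q r s k a] complex_mod_cnj[of "rho2 n k a j q r s"] by (simp add: T_def charge_def)
  qed
  also have "(\<Sum>q\<in>?J. \<Sum>r\<in>?J. \<Sum>s\<in>?J. T j q r s) = (\<Sum>q\<in>?J. \<Sum>r\<in>?J. \<Sum>s\<in>?J. (cmod (rho2 n k a j q r s))\<^sup>2)"
    by (intro sum.cong refl) (auto simp: T_def charge_def)
  finally have "Re (k2_trace_prod n (k2_adjoint (B_op n k a j)) (B_op n k a j)) =
    (\<Sum>q\<in>?J. \<Sum>r\<in>?J. \<Sum>s\<in>?J. (cmod (rho2 n k a j q r s))\<^sup>2)" (is "_ = ?S")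
    by simp
  moreover have "0 \<le> ?S" by (intro sum_nonneg) simp
  ultimately show ?thesis by (simp add: k2_frobenius_def)
qed

lemma cnj_rho1: "p < n \<Longrightarrow> q < n \<Longrightarrow> cnj (rho1 n k a $$ (p, q)) = rho1 n k a $$ (q, p)"
  by (simp add: rho1_entry cnj_fock_inner)

text \<open>Only row and column \<open>j\<close> survive, without their common entry, and
  hermiticity of \<open>rho1\<close> makes them contribute equally; hence the factor 2.\<close>

lemma mat_frobenius_contraction_B_op:
  assumes "j < n" "k > 0"
  shows "(mat_frobenius (contraction n (B_op n k a j)))\<^sup>2 =
    2 * (real (k - 1))\<^sup>2 * (\<Sum>b\<in>{..<n} - {j}. (cmod (rho1 n k a $$ (j, b)))\<^sup>2)"
proof -
  let ?J = "{..<n} - {j}"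
  define f where "f = (\<lambda>p r. (real (k - 1))\<^sup>2 * ((of_bool (p = j) - of_bool (r = j))\<^sup>2 * (cmod (rho1 n k a $$ (p, r)))\<^sup>2))"
  have r: "(\<Sum>a<n. g a) = g j + (\<Sum>a\<in>?J. g a)" for g :: "nat \<Rightarrow> real"
    using assms(1) by (intro sum.remove) auto
  have d: "dim_row (contraction n (B_op n k a j)) = n" "dim_col (contraction n (B_op n k a j)) = n"
    by (simp_all add: contraction_def)
  have "(\<Sum>i<dim_row (contraction n (B_op n k a j)). \<Sum>l<dim_col (contraction n (B_op n k a j)).
      (cmod (contraction n (B_op n k a j) $$ (i, l)))\<^sup>2) = (\<Sum>i<n. \<Sum>l<n. f i l)"
    unfolding d
  proof (intro sum.cong refl)
    fix i l assume "i \<in> {..<n}" "l \<in> {..<n}"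
    then have "i < n" "l < n" by simp_all
    moreover have "cmod (of_bool P - of_bool Q) ^ 2 = (of_bool P - of_bool Q :: real)\<^sup>2" for P Q by auto
    ultimately show "(cmod (contraction n (B_op n k a j) $$ (i, l)))\<^sup>2 = f i l"
      by (simp add: contraction_B_op_entry[OF _ _ assms(2)] f_def norm_mult power_mult_distrib)
  qed
  also have "\<dots> = (f j j + (\<Sum>l\<in>?J. f j l)) + (\<Sum>i\<in>?J. f i j + (\<Sum>l\<in>?J. f i l))" unfolding r ..
  also have "\<dots> = (\<Sum>l\<in>?J. f j l) + (\<Sum>i\<in>?J. f i j)"
    by (simp add: f_def)
  also have "(\<Sum>l\<in>?J. f j l) = (real (k - 1))\<^sup>2 * (\<Sum>b\<in>?J. (cmod (rho1 n k a $$ (j, b)))\<^sup>2)"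
    unfolding sum_distrib_left by (intro sum.cong refl) (auto simp: f_def)
  also have "(\<Sum>i\<in>?J. f i j) = (real (k - 1))\<^sup>2 * (\<Sum>b\<in>?J. (cmod (rho1 n k a $$ (j, b)))\<^sup>2)"
    unfolding sum_distrib_left
  proof (intro sum.cong refl)
    fix i assume "i \<in> ?J"
    then show "f i j = (real (k - 1))\<^sup>2 * (cmod (rho1 n k a $$ (j, i)))\<^sup>2"
      using assms cnj_rho1[of j n i k a] complex_mod_cnj[of "rho1 n k a $$ (j, i)"] by (simp add: f_def)
  qed
  finally have "(\<Sum>i<dim_row (contraction n (B_op n k a j)). \<Sum>l<dim_col (contraction n (B_op n k a j)).
      (cmod (contraction n (B_op n k a j) $$ (i, l)))\<^sup>2) =
      2 * (real (k - 1))\<^sup>2 * (\<Sum>b\<in>?J. (cmod (rho1 n k a $$ (j, b)))\<^sup>2)" (is "_ = ?S")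
    by simp
  moreover have "0 \<le> ?S" by (intro mult_nonneg_nonneg sum_nonneg) simp_all
  ultimately show ?thesis by (simp add: mat_frobenius_def)
qed

subsection \<open>The encoded state\<close>

definition walsh :: "nat \<Rightarrow> nat \<Rightarrow> int" where
  "walsh p q = (- 1) ^ card {b. bit p b \<and> bit q b}"

text \<open>The exponent in \<open>walsh\<close> is a cardinality, which counts common bits only
  when their set is finite.\<close>

lemma finite_bits: "finite {b. bit (p :: nat) b \<and> bit (q :: nat) b}"
proof (rule finite_subset)
  show "{b. bit p b \<and> bit q b} \<subseteq> {..<p}"
  proof
    fix b assume "b \<in> {b. bit p b \<and> bit q b}"
    then have "p div 2 ^ b \<noteq> 0" by (cases "p div 2 ^ b = 0") (auto simp: bit_iff_odd)
    then have "2 ^ b \<le> p" by (auto simp: div_eq_0_iff)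
    then have "b < p" by (rule order.strict_trans2[OF less_exp])
    then show "b \<in> {..<p}" by simp
  qed
qed simp

lemma walsh_rec: "walsh p q = (if odd p \<and> odd q then - 1 else 1) * walsh (p div 2) (q div 2)"
proof -
  let ?S = "{b. bit (p div 2) b \<and> bit (q div 2) b}"
  have "{b. bit p b \<and> bit q b} = (if odd p \<and> odd q then {0} else {}) \<union> Suc ` ?S"
  proof (rule Set.set_eqI)
    fix b show "b \<in> {b. bit p b \<and> bit q b} \<longleftrightarrow> b \<in> (if odd p \<and> odd q then {0} else {}) \<union> Suc ` ?S"
      by (cases b) (auto simp: bit_0 bit_Suc)
  qed
  moreover have "card (Suc ` ?S) = card ?S" by (simp add: card_image)
  ultimately show ?thesis
    using finite_bits[of "p div 2" "q div 2"] by (simp add: walsh_def)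
qed

lemma sum_even_odd: "(\<Sum>i<2 * M. f i) = (\<Sum>i<M. f (2 * i) + f (2 * i + 1 :: nat) :: 'a::comm_monoid_add)"
  by (induction M) (simp_all add: add.assoc)

text \<open>Sylvester's recursion: even and odd \<open>i\<close> contribute the same sum one bit
  lower, with weight 1 and with the product of the two low-bit signs, so indices that differ in the
  low bit cancel.\<close>

lemma walsh_orthogonal:
  assumes "a < 2 ^ K" "b < 2 ^ K"
  shows "(\<Sum>i<2 ^ K. walsh i a * walsh i b) = (if a = b then 2 ^ K else 0)"
  using assms
proof (induction K arbitrary: a b)
  case 0
  then show ?case by (simp add: walsh_def)
next
  case (Suc K)
  let ?e = "\<lambda>a b. (if odd a then - 1 else 1) * (if odd b then - 1 else 1) :: int"
  have "(\<Sum>i<2 ^ Suc K. walsh i a * walsh i b) =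
      (\<Sum>i<2 ^ K. walsh (2 * i) a * walsh (2 * i) b + walsh (2 * i + 1) a * walsh (2 * i + 1) b)"
    by (simp only: power_Suc sum_even_odd)
  also have "\<dots> = (\<Sum>i<2 ^ K. walsh i (a div 2) * walsh i (b div 2)) * (1 + ?e a b)"
    unfolding sum_distrib_right
  proof (intro sum.cong refl)
    fix i
    show "walsh (2 * i) a * walsh (2 * i) b + walsh (2 * i + 1) a * walsh (2 * i + 1) b =
        walsh i (a div 2) * walsh i (b div 2) * (1 + ?e a b)"
      unfolding walsh_rec[of "2 * i"] walsh_rec[of "2 * i + 1"] by (simp add: algebra_simps)
  qed
  also have "\<dots> = (if a div 2 = b div 2 then 2 ^ K else 0) * (1 + ?e a b)"
    using Suc by (subst Suc.IH) auto
  also have "\<dots> = (if a = b then 2 ^ Suc K else 0)"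
  proof (cases "a div 2 = b div 2 \<and> (odd a \<longleftrightarrow> odd b)")
    case True
    then have "a = b" by (metis bit_eq_rec)
    then show ?thesis by simp
  qed auto
  finally show ?case .
qed

lemma hadamard_entry:
  "p < n \<Longrightarrow> q < n \<Longrightarrow> hadamard n $$ (p, q) = of_int (walsh p q) / complex_of_real (sqrt (real n))"
  by (simp add: hadamard_def walsh_def)

lemma hadamard_unitary:
  assumes n: "n = 2 ^ K"
  shows "hadamard n \<in> unitary_group n"
proof -
  have "(\<Sum>i<n. cnj (hadamard n $$ (i, a)) * hadamard n $$ (i, b)) = of_bool (a = b)" if ab: "a < n" "b < n" for a b
  proof -
    have "complex_of_real (sqrt (real n)) * complex_of_real (sqrt (real n)) = of_nat n"
      by (metis of_real_mult of_real_of_nat_eq real_sqrt_mult_self abs_of_nat)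
    then have "(\<Sum>i<n. cnj (hadamard n $$ (i, a)) * hadamard n $$ (i, b)) = (\<Sum>i<n. of_int (walsh i a * walsh i b) / of_nat n)"
      using ab by (intro sum.cong refl) (simp add: hadamard_entry)
    also have "\<dots> = of_int (\<Sum>i<n. walsh i a * walsh i b) / of_nat n"
      by (simp add: sum_divide_distrib)
    finally show ?thesis using walsh_orthogonal[of a K b] ab n by simp
  qed
  then show ?thesis by (simp add: unitary_group_iff) (simp add: hadamard_def)
qed

definition encoding :: "nat \<Rightarrow> (nat \<Rightarrow> real) \<Rightarrow> complex mat" where
  "encoding n a = phase_diag n a * hadamard n"

lemma encoding_unitary: "n = 2 ^ K \<Longrightarrow> encoding n a \<in> unitary_group n"
  unfolding encoding_def by (intro unitary_group_mult phase_diag_unitary hadamard_unitary)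

text \<open>The data phases drop out of the modulus; this is why the diagonal of \<open>rho1\<close>
  will not depend on \<open>a\<close>.\<close>

lemma encoding_flat:
  assumes "n = 2 ^ K" "p < n" "q < n"
  shows "encoding n a $$ (p, q) * cnj (encoding n a $$ (p, q)) = 1 / of_nat n"
proof -
  have "hadamard n \<in> carrier_mat n n" by (simp add: hadamard_def)
  then have e: "encoding n a $$ (p, q) = exp (- \<i> * complex_of_real (a p)) * hadamard n $$ (p, q)"
    using assms by (simp add: encoding_def phase_diag_def mat_diag_mult_left)
  have "cmod (hadamard n $$ (p, q)) = 1 / sqrt (real n)"
    using assms by (simp add: hadamard_entry norm_divide walsh_def norm_power)
  then have "(cmod (encoding n a $$ (p, q)))\<^sup>2 = 1 / real n"
    by (simp add: e norm_mult power_divide)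
  then show ?thesis unfolding complex_norm_square[symmetric] by simp
qed

text \<open>The occupation sets that occur in the product over blocks i, ..., m - 1: every block of
  four modes has exactly one of its two neighbouring pairs filled. The lower end varies so that
  blocks can be peeled off.\<close>

definition paired :: "nat \<Rightarrow> nat \<Rightarrow> nat set \<Rightarrow> bool" where
  "paired i m S \<longleftrightarrow> S \<subseteq> {4 * i..<4 * m} \<and> (\<forall>b\<in>{i..<m}. (4 * b \<in> S \<longleftrightarrow> 4 * b + 1 \<in> S) \<and>
     (4 * b + 2 \<in> S \<longleftrightarrow> 4 * b + 3 \<in> S) \<and> (4 * b \<in> S \<longleftrightarrow> 4 * b + 2 \<notin> S))"

lemma paired_bounds: "paired i m S \<Longrightarrow> x \<in> S \<Longrightarrow> 4 * i \<le> x \<and> x < 4 * m"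
  by (auto simp: paired_def)

text \<open>The leftmost factor has the smallest modes, so everything to its right is occupied only
  above the block and no Jordan-Wigner sign appears.\<close>

lemma pair_factor_apply:
  fixes \<psi> :: fock
  assumes "\<And>T. \<psi> T \<noteq> 0 \<Longrightarrow> T \<subseteq> {4 * b + 4..}"
  shows "pair_factor b \<psi> S = 1 / sqrt 2 *
    ((if 4 * b \<in> S \<and> 4 * b + 1 \<in> S then \<psi> (S - {4 * b, 4 * b + 1}) else 0)
     + (if 4 * b + 2 \<in> S \<and> 4 * b + 3 \<in> S then \<psi> (S - {4 * b + 2, 4 * b + 3}) else 0))"
proof -
  have sgn: "jw_sign i T = 1" if "\<And>x. x \<in> T \<Longrightarrow> i \<le> x" for i T
  proof -
    have "{x \<in> T. x < i} = {}" using that by fastforce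
    then show ?thesis by (simp only: jw_sign_def card.empty power_0)
  qed
  have pair: "create c (create (c + 1) \<psi>) S = (if c \<in> S \<and> c + 1 \<in> S then \<psi> (S - {c, c + 1}) else 0)"
    if c: "c = 4 * b \<or> c = 4 * b + 2" for c
  proof (cases "c \<in> S \<and> c + 1 \<in> S \<and> \<psi> (S - {c, c + 1}) \<noteq> 0")
    case True
    then have "S - {c, c + 1} \<subseteq> {4 * b + 4..}" using assms by blast
    then have le: "c \<le> x" "x \<noteq> c \<longrightarrow> c + 1 \<le> x" if "x \<in> S" for x using that c by auto
    have "jw_sign c S = 1" "jw_sign (c + 1) (S - {c}) = 1" using le by (auto intro!: sgn)
    then show ?thesis using True by (simp add: create_def Diff_insert2[symmetric])
  next
    case False
    then show ?thesis by (auto simp: create_def Diff_insert2[symmetric])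
  qed
  show ?thesis
    using pair[of "4 * b"] pair[of "4 * b + 2"] by (simp add: pair_factor_def numeral_eq_Suc)
qed

lemma paired_step:
  assumes "i < m"
  shows "paired i m S \<longleftrightarrow> (4 * i \<in> S \<and> 4 * i + 1 \<in> S \<and> paired (Suc i) m (S - {4 * i, 4 * i + 1})) \<or>
    (4 * i + 2 \<in> S \<and> 4 * i + 3 \<in> S \<and> paired (Suc i) m (S - {4 * i + 2, 4 * i + 3}))" (is "_ \<longleftrightarrow> ?L \<or> ?H")
proof
  assume p: "paired i m S"
  then have sub: "S \<subseteq> {4 * i..<4 * m}" and at: "(4 * i \<in> S \<longleftrightarrow> 4 * i + 1 \<in> S) \<and>
     (4 * i + 2 \<in> S \<longleftrightarrow> 4 * i + 3 \<in> S) \<and> (4 * i \<in> S \<longleftrightarrow> 4 * i + 2 \<notin> S)"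
    using assms by (auto simp: paired_def)
  have cases: "x = 4 * i \<or> x = 4 * i + 1 \<or> x = 4 * i + 2 \<or> x = 4 * i + 3 \<or> 4 * Suc i \<le> x" if "x \<in> S" for x
    using that sub by fastforce
  show "?L \<or> ?H"
  proof (cases "4 * i \<in> S")
    case True
    then have "S - {4 * i, 4 * i + 1} \<subseteq> {4 * Suc i..<4 * m}" using at cases sub by fastforce
    then have ?L using True at p by (auto simp: paired_def)
    then show ?thesis ..
  next
    case False
    then have "S - {4 * i + 2, 4 * i + 3} \<subseteq> {4 * Suc i..<4 * m}" using at cases sub by fastforce
    then have ?H using False at p by (auto simp: paired_def)
    then show ?thesis ..
  qed
next
  have dec: "{i..<m} = insert i {Suc i..<m}" using assms by auto
  assume "?L \<or> ?H"
  then show "paired i m S"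
  proof
    assume L: ?L
    then have "S \<subseteq> {4 * i..<4 * m}" using assms by (fastforce simp: paired_def)
    moreover have "4 * i + 2 \<notin> S" "4 * i + 3 \<notin> S"
      using L paired_bounds[of "Suc i" m "S - {4 * i, 4 * i + 1}"] by fastforce+
    ultimately show ?thesis using L unfolding paired_def dec by auto
  next
    assume H: ?H
    then have "S \<subseteq> {4 * i..<4 * m}" using assms by (fastforce simp: paired_def)
    moreover have "4 * i \<notin> S" "4 * i + 1 \<notin> S"
      using H paired_bounds[of "Suc i" m "S - {4 * i + 2, 4 * i + 3}"] by fastforce+
    ultimately show ?thesis using H unfolding paired_def dec by auto
  qed
qed

text \<open>A block offers two mutually exclusive fillings with amplitude 1/sqrt 2 each, so patterns
  never interfere and all have the same amplitude.\<close>

lemma pair_product_apply: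
  "i \<le> m \<Longrightarrow> foldr pair_factor [i..<m] vac S = (if paired i m S then (1 / sqrt 2) ^ (m - i) else 0)"
proof (induction arbitrary: S rule: inc_induct)
  case base
  have "paired m m S \<longleftrightarrow> S = {}" by (simp add: paired_def)
  then show ?case by (simp add: vac_def)
next
  case (step i)
  let ?\<psi> = "foldr pair_factor [Suc i..<m] vac"
  have sup: "T \<subseteq> {4 * i + 4..}" if "?\<psi> T \<noteq> 0" for T
    using that unfolding step.IH by (auto simp: paired_def split: if_splits)
  have excl: "\<not> (4 * i + 2 \<in> S \<and> 4 * i + 3 \<in> S \<and> paired (Suc i) m (S - {4 * i + 2, 4 * i + 3}))"
    if "4 * i \<in> S"
    using that paired_bounds[of "Suc i" m "S - {4 * i + 2, 4 * i + 3}" "4 * i"] by auto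
  have excl': "\<not> (4 * i + 2 \<in> S)" if "paired (Suc i) m (S - {4 * i, 4 * i + 1})"
    using paired_bounds[OF that, of "4 * i + 2"] by auto
  have "foldr pair_factor [i..<m] vac S = pair_factor i ?\<psi> S"
    using step.hyps by (simp add: upt_conv_Cons)
  also have "\<dots> = (if paired i m S then (1 / sqrt 2) * (1 / sqrt 2) ^ (m - Suc i) else 0)"
    by (subst pair_factor_apply, erule sup)
      (unfold step.IH paired_step[OF step.hyps(2)], use excl excl' in auto)
  also have "1 / sqrt 2 * (1 / sqrt 2) ^ (m - Suc i) = (1 / sqrt 2) ^ (m - i)"
    using step.hyps by (metis Suc_diff_Suc power_Suc)
  finally show ?case by simp
qed

lemma psi_in_apply:
  "psi_in k S = (if paired 0 (k div 2) S then complex_of_real ((1 / sqrt 2) ^ (k div 2)) else 0)"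
  using pair_product_apply[of 0 "k div 2" S] by (simp add: psi_in_def)

lemma finite_paired: "finite {S. paired i m S}"
  by (rule finite_subset[of _ "Pow {..<4 * m}"]) (auto simp: paired_def)

lemma paired_Suc_image:
  assumes "i < m"
  shows "{S. paired i m S} = (\<lambda>T. T \<union> {4 * i, 4 * i + 1}) ` {T. paired (Suc i) m T} \<union>
    (\<lambda>T. T \<union> {4 * i + 2, 4 * i + 3}) ` {T. paired (Suc i) m T}" (is "_ = ?f ` ?P \<union> ?g ` ?P")
proof (intro equalityI subsetI)
  fix S assume "S \<in> {S. paired i m S}"
  then consider "4 * i \<in> S" "4 * i + 1 \<in> S" "paired (Suc i) m (S - {4 * i, 4 * i + 1})"
    | "4 * i + 2 \<in> S" "4 * i + 3 \<in> S" "paired (Suc i) m (S - {4 * i + 2, 4 * i + 3})"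
    using paired_step[OF assms] by blast
  then show "S \<in> ?f ` ?P \<union> ?g ` ?P"
  proof cases
    case 1
    then have "S = ?f (S - {4 * i, 4 * i + 1})" by auto
    then show ?thesis using 1 by blast
  next
    case 2
    then have "S = ?g (S - {4 * i + 2, 4 * i + 3})" by auto
    then show ?thesis using 2 by blast
  qed
next
  fix S assume "S \<in> ?f ` ?P \<union> ?g ` ?P"
  then obtain T where T: "paired (Suc i) m T" "S = ?f T \<or> S = ?g T" by blast
  have "x \<notin> T" if "x < 4 * Suc i" for x using paired_bounds[OF T(1), of x] that by auto
  then have "4 * i \<notin> T" "4 * i + 1 \<notin> T" "4 * i + 2 \<notin> T" "4 * i + 3 \<notin> T" by auto
  then have "?f T - {4 * i, 4 * i + 1} = T" "?g T - {4 * i + 2, 4 * i + 3} = T" by auto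
  then have "paired i m (?f T)" "paired i m (?g T)"
    unfolding paired_step[OF assms] using T(1) by auto
  then show "S \<in> {S. paired i m S}" using T(2) by auto
qed

text \<open>Each block doubles the number of patterns and adds two particles.\<close>

lemma card_paired:
  "i \<le> m \<Longrightarrow> card {S. paired i m S} = 2 ^ (m - i) \<and> (\<forall>S. paired i m S \<longrightarrow> card S = 2 * (m - i))"
proof (induction rule: inc_induct)
  case base
  have "paired m m S \<longleftrightarrow> S = {}" for S by (simp add: paired_def)
  then show ?case by simp
next
  case (step i)
  let ?P = "{T. paired (Suc i) m T}"
  let ?f = "\<lambda>T. T \<union> {4 * i, 4 * i + 1}" and ?g = "\<lambda>T. T \<union> {4 * i + 2, 4 * i + 3}"
  have nin: "4 * i \<notin> T" "4 * i + 1 \<notin> T" "4 * i + 2 \<notin> T" "4 * i + 3 \<notin> T" if "T \<in> ?P" for T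
    using that paired_bounds[of "Suc i" m T] by fastforce+
  have "T = ?f T - {4 * i, 4 * i + 1}" "T = ?g T - {4 * i + 2, 4 * i + 3}" if "T \<in> ?P" for T
    using nin[OF that] by auto
  then have inj: "inj_on ?f ?P" "inj_on ?g ?P" by (metis (no_types, lifting) inj_onI)+
  have disj: "?f ` ?P \<inter> ?g ` ?P = {}" using nin by fastforce
  have "card {S. paired i m S} = card (?f ` ?P) + card (?g ` ?P)"
    unfolding paired_Suc_image[OF step.hyps(2)]
    by (rule card_Un_disjoint) (use disj finite_paired in auto)
  also have "\<dots> = 2 * 2 ^ (m - Suc i)" using step.IH unfolding card_image[OF inj(1)] card_image[OF inj(2)] by simp
  also have "\<dots> = 2 ^ (m - i)" using step.hyps by (metis Suc_diff_Suc power_Suc)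
  finally have c: "card {S. paired i m S} = 2 ^ (m - i)" .
  have "card S = 2 * (m - i)" if S: "paired i m S" for S
  proof -
    obtain T where T: "T \<in> ?P" "S = ?f T \<or> S = ?g T"
      using S paired_Suc_image[OF step.hyps(2)] by blast
    have "finite T" using T(1) by (auto simp: paired_def intro: finite_subset)
    then have "card (?f T) = card T + 2" "card (?g T) = card T + 2" using nin[OF T(1)] by auto
    then have "card S = card T + 2" using T(2) by auto
    also have "card T = 2 * (m - Suc i)" using step.IH T(1) by auto
    finally show ?thesis using step.hyps by simp
  qed
  with c show ?case by blast
qed

lemma psi_in_supp:
  assumes "even k" "2 * k \<le> n"
  shows "fock_supp n k (psi_in k)"
proof -
  have k: "2 * (k div 2) = k" "4 * (k div 2) \<le> n" using assms by auto
  show ?thesis unfolding fock_supp_def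
  proof (intro allI impI)
    fix S assume "psi_in k S \<noteq> 0"
    then have p: "paired 0 (k div 2) S" by (simp add: psi_in_apply split: if_splits)
    then have "card S = k" using card_paired[of 0 "k div 2"] k by auto
    moreover have "S \<subseteq> {..<n}" using paired_bounds[OF p] k by fastforce
    ultimately show "S \<subseteq> {..<n} \<and> card S = k" by blast
  qed
qed

lemma psi_in_norm:
  assumes "even k" "2 * k \<le> n"
  shows "fock_inner n (psi_in k) (psi_in k) = 1"
proof -
  have k: "4 * (k div 2) \<le> n" using assms by auto
  have sq: "(1 / sqrt 2) ^ m * (1 / sqrt 2) ^ m = (1 / 2) ^ m" for m
    by (simp flip: power_mult_distrib)
  have sub: "{S. paired 0 (k div 2) S} \<subseteq> Pow {..<n}" using k by (fastforce simp: paired_def)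
  have "fock_inner n (psi_in k) (psi_in k) = (\<Sum>S\<in>{S. paired 0 (k div 2) S}. complex_of_real ((1 / 2) ^ (k div 2)))"
    unfolding fock_inner_def
  proof (rule sum.mono_neutral_cong_right)
    fix S assume "S \<in> {S. paired 0 (k div 2) S}"
    then have "cnj (psi_in k S) * psi_in k S = complex_of_real ((1 / sqrt 2) ^ (k div 2) * (1 / sqrt 2) ^ (k div 2))"
      by (simp add: psi_in_apply)
    then show "cnj (psi_in k S) * psi_in k S = complex_of_real ((1 / 2) ^ (k div 2))" unfolding sq .
  qed (use sub in \<open>auto simp: psi_in_apply\<close>)
  also have "\<dots> = 1" using card_paired[of 0 "k div 2"] by (simp add: power_divide)
  finally show ?thesis .
qed

section \<open>One-body densities of the input and encoded states\<close>

definition flip_block :: "nat \<Rightarrow> nat set \<Rightarrow> nat set" where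
  "flip_block c T = {x. (x \<in> T) \<noteq> (x div 4 = c)}"

lemma flip_block_flip_block [simp]: "flip_block c (flip_block c T) = T"
  by (auto simp: flip_block_def)

lemma paired_flip_block:
  assumes "c < m" "paired 0 m T"
  shows "paired 0 m (flip_block c T)"
proof -
  have sub: "flip_block c T \<subseteq> {4 * 0..<4 * m}"
    using assms by (auto simp: flip_block_def paired_def)
  have mem: "4 * b \<in> flip_block c T \<longleftrightarrow> (4 * b \<in> T) \<noteq> (b = c)"
    "4 * b + 1 \<in> flip_block c T \<longleftrightarrow> (4 * b + 1 \<in> T) \<noteq> (b = c)"
    "4 * b + 2 \<in> flip_block c T \<longleftrightarrow> (4 * b + 2 \<in> T) \<noteq> (b = c)"
    "4 * b + 3 \<in> flip_block c T \<longleftrightarrow> (4 * b + 3 \<in> T) \<noteq> (b = c)" for b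
  proof -
    have "4 * b div 4 = b" "(4 * b + 1) div 4 = b" "(4 * b + 2) div 4 = b" "(4 * b + 3) div 4 = b" by presburger+
    then show "4 * b \<in> flip_block c T \<longleftrightarrow> (4 * b \<in> T) \<noteq> (b = c)"
      "4 * b + 1 \<in> flip_block c T \<longleftrightarrow> (4 * b + 1 \<in> T) \<noteq> (b = c)"
      "4 * b + 2 \<in> flip_block c T \<longleftrightarrow> (4 * b + 2 \<in> T) \<noteq> (b = c)"
      "4 * b + 3 \<in> flip_block c T \<longleftrightarrow> (4 * b + 3 \<in> T) \<noteq> (b = c)"
      unfolding flip_block_def mem_Collect_eq by (simp_all only:)
  qed
  show ?thesis
    unfolding paired_def
  proof (intro conjI ballI sub)
    fix b assume "b \<in> {0..<m}"
    then have T: "4 * b \<in> T \<longleftrightarrow> 4 * b + 1 \<in> T" "4 * b + 2 \<in> T \<longleftrightarrow> 4 * b + 3 \<in> T" "4 * b \<in> T \<longleftrightarrow> 4 * b + 2 \<notin> T"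
      using assms(2) unfolding paired_def by blast+
    show "4 * b \<in> flip_block c T \<longleftrightarrow> 4 * b + 1 \<in> flip_block c T" unfolding mem using T(1) by blast
    show "4 * b + 2 \<in> flip_block c T \<longleftrightarrow> 4 * b + 3 \<in> flip_block c T" unfolding mem using T(2) by blast
    show "4 * b \<in> flip_block c T \<longleftrightarrow> 4 * b + 2 \<notin> flip_block c T" unfolding mem using T(3) by blast
  qed
qed

lemma psi_in_flip_block: "c < k div 2 \<Longrightarrow> psi_in k (flip_block c T) = psi_in k T"
  using paired_flip_block[of c "k div 2" T] paired_flip_block[of c "k div 2" "flip_block c T"]
  by (auto simp: psi_in_apply)

lemma paired_even_odd:
  assumes "paired 0 m T" shows "2 * y \<in> T \<longleftrightarrow> 2 * y + 1 \<in> T"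
proof (cases "y div 2 < m")
  case True
  let ?b = "y div 2"
  have "(4 * ?b \<in> T \<longleftrightarrow> 4 * ?b + 1 \<in> T) \<and> (4 * ?b + 2 \<in> T \<longleftrightarrow> 4 * ?b + 3 \<in> T)"
    using assms True unfolding paired_def by auto
  moreover have "2 * y = 4 * ?b \<and> 2 * y + 1 = 4 * ?b + 1 \<or> 2 * y = 4 * ?b + 2 \<and> 2 * y + 1 = 4 * ?b + 3" by presburger
  ultimately show ?thesis by metis
next
  case False
  then show ?thesis using paired_bounds[OF assms, of "2 * y"] paired_bounds[OF assms, of "2 * y + 1"] by auto
qed

text \<open>In a paired set the modes come in couples 2y, 2y + 1, so the mode missing from
  \<open>S\<close> is identified by the partner left alone there.\<close>

lemma paired_unique_completion:
  assumes "paired 0 m (insert a S)" "paired 0 m (insert b S)" "a \<notin> S" "b \<notin> S"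
  shows "a = b"
proof -
  obtain y where y: "a = 2 * y \<or> a = 2 * y + 1" by (meson oddE evenE)
  then have "2 * y \<in> insert a S \<longleftrightarrow> 2 * y + 1 \<in> insert a S" "2 * y \<in> insert b S \<longleftrightarrow> 2 * y + 1 \<in> insert b S"
    using paired_even_odd assms by blast+
  then show ?thesis using y assms(3,4) by auto
qed

text \<open>Distinct modes cannot both complete the same set, so off-diagonal entries vanish. On the
  diagonal, complementing the block of \<open>a\<close> exchanges its two fillings, preserves
  amplitudes and toggles the occupation of \<open>a\<close>, so occupied and empty carry the same
  weight.\<close>

lemma psi_in_one_body:
  assumes "even k" "2 * k \<le> n" "a < n" "b < n"
  shows "fock_inner n (annih a (psi_in k)) (annih b (psi_in k)) = of_bool (a = b \<and> a < 2 * k) / 2"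
proof (cases "a = b")
  case False
  have "cnj (annih a (psi_in k) S) * annih b (psi_in k) S = 0" for S
    using paired_unique_completion[of "k div 2" a S b] False by (auto simp: annih_def psi_in_apply)
  then show ?thesis using False by (simp add: fock_inner_def)
next
  case True
  let ?w = "\<lambda>S. cnj (psi_in k S) * psi_in k S"
  have occ: "fock_inner n (annih a (psi_in k)) (annih a (psi_in k)) = (\<Sum>S\<in>Pow {..<n}. if a \<in> S then ?w S else 0)"
  proof -
    have "fock_inner n (annih a (psi_in k)) (annih a (psi_in k)) = fock_inner n (psi_in k) (num_op a (psi_in k))"
      using assms(3) by (simp add: num_op_def fock_inner_create)
    then show ?thesis unfolding fock_inner_def num_op_apply by (simp only:) (intro sum.cong, auto)
  qed
  show ?thesis
  proof (cases "a < 2 * k")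
    case True
    define c where "c = a div 4"
    obtain h where h: "k = 2 * h" using assms(1) by (rule evenE)
    have "a < h * 4" using True h by simp
    then have "c < h" unfolding c_def by (rule less_mult_imp_div_less)
    then have c: "c < k div 2" "4 * c + 4 \<le> n" using assms(2) h by auto
    have flip: "flip_block c S \<in> Pow {..<n}" if "S \<in> Pow {..<n}" for S
      using that c(2) by (auto simp: flip_block_def)
    have "(\<Sum>S\<in>Pow {..<n}. if a \<in> S then ?w S else 0) = (\<Sum>S\<in>Pow {..<n}. if a \<notin> S then ?w S else 0)"
      by (rule sum.reindex_bij_witness[of _ "flip_block c" "flip_block c"])
        (use flip psi_in_flip_block[OF c(1)] in \<open>simp_all, auto simp: flip_block_def c_def\<close>)
    moreover have "(\<Sum>S\<in>Pow {..<n}. if a \<in> S then ?w S else 0) + (\<Sum>S\<in>Pow {..<n}. if a \<notin> S then ?w S else 0) = (\<Sum>S\<in>Pow {..<n}. ?w S)"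
      unfolding sum.distrib[symmetric] by (intro sum.cong) auto
    moreover have "(\<Sum>S\<in>Pow {..<n}. ?w S) = 1" using psi_in_norm[OF assms(1,2)] by (simp add: fock_inner_def)
    moreover have "x = 1 / 2" if "x = y" "x + y = z" "z = 1" for x y z :: complex
    proof -
      have "x = (x + y) / 2" using that(1) by simp
      then show ?thesis using that(2,3) by simp
    qed
    ultimately have "(\<Sum>S\<in>Pow {..<n}. if a \<in> S then ?w S else 0) = 1 / 2" by blast
    then show ?thesis using occ True \<open>a = b\<close> by simp
  next
    case False
    have "psi_in k S = 0" if "a \<in> S" for S
      using paired_bounds[of 0 "k div 2" S a] that False assms(1) by (auto simp: psi_in_apply)
    then show ?thesis using occ False \<open>a = b\<close> by (simp cong: if_cong)
  qed
qed

lemma annih_psi: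
  assumes "n = 2 ^ K" "p < n"
  shows "annih p (psi n (Suc m) a) = ext_power n m (encoding n a) (annih_vec n (\<lambda>c. encoding n a $$ (p, c)) (psi_in (Suc m)))"
  unfolding psi_def encoding_def[symmetric]
  by (rule ext, rule annih_ext_power[OF assms(2)])
    (use encoding_unitary[OF assms(1)] in \<open>simp add: unitary_group_def\<close>)

text \<open>Pulling the annihilators back conjugates the one-body matrix of the input, which is 1/2
  on the first 2k modes and 0 elsewhere, by the encoding.\<close>

lemma rho1_eq:
  assumes n: "n = 2 ^ K" and k: "even k" "2 \<le> k" "2 * k \<le> n" and pq: "p < n" "q < n"
  shows "rho1 n k a $$ (p, q) = (\<Sum>c<2 * k. encoding n a $$ (p, c) * cnj (encoding n a $$ (q, c))) / 2"
proof -
  let ?U = "encoding n a"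
  obtain m where m: "k = Suc m" using k(2) by (cases k) auto
  have U: "?U \<in> unitary_group n" by (rule encoding_unitary[OF n])
  have s: "fock_supp n m (annih_vec n w (psi_in k))" for w
    using psi_in_supp[OF k(1,3)] unfolding m by (rule annih_vec_supp)
  have "rho1 n k a $$ (p, q) =
      fock_inner n (annih_vec n (\<lambda>c. ?U $$ (q, c)) (psi_in k)) (annih_vec n (\<lambda>c. ?U $$ (p, c)) (psi_in k))"
    unfolding rho1_entry[OF pq] unfolding m annih_psi[OF n pq(1)] annih_psi[OF n pq(2)]
    using U s unfolding m by (intro fock_inner_ext_power) (auto simp: unitary_group_iff)
  also have "\<dots> = (\<Sum>c<n. \<Sum>d<n. cnj (?U $$ (q, c)) * ?U $$ (p, d) * (of_bool (c = d \<and> c < 2 * k) / 2))"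
    unfolding fock_inner_annih_vec using k by (intro sum.cong refl) (simp add: psi_in_one_body)
  also have "\<dots> = (\<Sum>c<n. \<Sum>d<n. if d = c then (if c < 2 * k then ?U $$ (p, c) * cnj (?U $$ (q, c)) / 2 else 0) else 0)"
    by (intro sum.cong refl) auto
  also have "\<dots> = (\<Sum>c<n. if c < 2 * k then ?U $$ (p, c) * cnj (?U $$ (q, c)) / 2 else 0)"
    by simp
  also have "\<dots> = (\<Sum>c<2 * k. ?U $$ (p, c) * cnj (?U $$ (q, c)) / 2)"
    using k(3) by (intro sum.mono_neutral_cong_right) auto
  finally show ?thesis by (simp add: sum_divide_distrib)
qed

lemma rho1_diag:
  assumes n: "n = 2 ^ K" and k: "even k" "2 \<le> k" "2 * k \<le> n" and p: "p < n"
  shows "rho1 n k a $$ (p, p) = of_real (real k / real n)"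
proof -
  have "(\<Sum>c<2 * k. encoding n a $$ (p, c) * cnj (encoding n a $$ (p, c))) = (\<Sum>c<2 * k. 1 / of_nat n)"
    using k p by (intro sum.cong refl encoding_flat[OF n]) auto
  then show ?thesis unfolding rho1_eq[OF n k p p] by simp
qed

text \<open>As \<open>rho1\<close> is P / 2 for a projection P, the squared norm of a row is P_jj /
  4, and flatness gives P_jj = 2k / n.\<close>

lemma rho1_row_norm:
  assumes n: "n = 2 ^ K" and k: "even k" "2 \<le> k" "2 * k \<le> n" and j: "j < n"
  shows "(\<Sum>b<n. (cmod (rho1 n k a $$ (j, b)))\<^sup>2) = real k / (2 * real n)"
proof -
  let ?U = "encoding n a"
  have U: "?U \<in> unitary_group n" by (rule encoding_unitary[OF n])
  have "complex_of_real (\<Sum>b<n. (cmod (rho1 n k a $$ (j, b)))\<^sup>2) =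
      (\<Sum>b<n. rho1 n k a $$ (j, b) * cnj (rho1 n k a $$ (j, b)))"
    unfolding of_real_sum complex_norm_square ..
  also have "\<dots> = (\<Sum>b<n. \<Sum>c<2 * k. \<Sum>d<2 * k.
      ?U $$ (j, c) * cnj (?U $$ (j, d)) / 4 * (cnj (?U $$ (b, c)) * ?U $$ (b, d)))"
  proof (intro sum.cong[OF refl])
    fix b assume "b \<in> {..<n}"
    then have "rho1 n k a $$ (j, b) * cnj (rho1 n k a $$ (j, b)) =
        (\<Sum>c<2 * k. ?U $$ (j, c) * cnj (?U $$ (b, c))) * (\<Sum>d<2 * k. cnj (?U $$ (j, d)) * ?U $$ (b, d)) / 4"
      by (simp add: rho1_eq[OF n k] j)
    then show "rho1 n k a $$ (j, b) * cnj (rho1 n k a $$ (j, b)) = (\<Sum>c<2 * k. \<Sum>d<2 * k.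
        ?U $$ (j, c) * cnj (?U $$ (j, d)) / 4 * (cnj (?U $$ (b, c)) * ?U $$ (b, d)))"
      unfolding sum_product sum_divide_distrib by (simp add: mult_ac)
  qed
  also have "\<dots> = (\<Sum>c<2 * k. \<Sum>d<2 * k. ?U $$ (j, c) * cnj (?U $$ (j, d)) / 4 *
      (\<Sum>b<n. cnj (?U $$ (b, c)) * ?U $$ (b, d)))"
    unfolding sum_distrib_left by (subst sum.swap) (intro sum.cong refl sum.swap)
  also have "\<dots> = (\<Sum>c<2 * k. \<Sum>d<2 * k. if d = c then 1 / of_nat n / 4 else 0)"
  proof (intro sum.cong refl)
    fix c d assume "c \<in> {..<2 * k}" "d \<in> {..<2 * k}"
    then have cd: "c < n" "d < n" using k by auto
    then have "(\<Sum>b<n. cnj (?U $$ (b, c)) * ?U $$ (b, d)) = of_bool (c = d)"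
      using U by (simp add: unitary_group_iff)
    then show "?U $$ (j, c) * cnj (?U $$ (j, d)) / 4 * (\<Sum>b<n. cnj (?U $$ (b, c)) * ?U $$ (b, d)) =
        (if d = c then 1 / of_nat n / 4 else 0)"
      using encoding_flat[OF n j cd(1), of a] by auto
  qed
  also have "\<dots> = complex_of_real (real k / (2 * real n))" by simp
  finally show ?thesis by (simp only: of_real_eq_iff)
qed

subsection \<open>Bounds on the reduced density matrices\<close>

lemma fock_inner_Cauchy_Schwarz:
  "(cmod (fock_inner n \<psi> \<chi>))\<^sup>2 \<le> Re (fock_inner n \<psi> \<psi>) * Re (fock_inner n \<chi> \<chi>)"
proof -
  have "cmod (fock_inner n \<psi> \<chi>) \<le> (\<Sum>S\<in>Pow {..<n}. cmod (\<psi> S) * cmod (\<chi> S))"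
    unfolding fock_inner_def by (rule order_trans[OF norm_sum]) (simp add: norm_mult)
  then have "(cmod (fock_inner n \<psi> \<chi>))\<^sup>2 \<le> (\<Sum>S\<in>Pow {..<n}. cmod (\<psi> S) * cmod (\<chi> S))\<^sup>2"
    by (rule power_mono) simp
  also have "\<dots> \<le> (\<Sum>S\<in>Pow {..<n}. (cmod (\<psi> S))\<^sup>2) * (\<Sum>S\<in>Pow {..<n}. (cmod (\<chi> S))\<^sup>2)"
    by (rule Cauchy_Schwarz_ineq_sum)
  finally show ?thesis unfolding fock_inner_self by simp
qed

lemma fock_inner_self_nonneg: "0 \<le> Re (fock_inner n \<psi> \<psi>)"
  unfolding fock_inner_self by (simp add: sum_nonneg)

lemma fock_inner_annih_CAR:
  assumes "c < n" "d < n"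
  shows "fock_inner n (annih c \<phi>) (annih d \<phi>) =
    of_bool (c = d) * fock_inner n \<phi> \<phi> - fock_inner n (create d \<phi>) (create c \<phi>)"
proof -
  have "annih d (create c \<phi>) = (\<lambda>S. \<Sum>x\<in>{True, False}. (if x then of_bool (c = d) else - 1) *
      (if x then \<phi> else create c (annih d \<phi>)) S)"
    by (rule ext) (auto simp: annih_create)
  then have "fock_inner n \<phi> (annih d (create c \<phi>)) =
      of_bool (c = d) * fock_inner n \<phi> \<phi> - fock_inner n \<phi> (create c (annih d \<phi>))"
    by (simp only: fock_inner_sum_right) simp
  moreover have "fock_inner n \<phi> (annih d (create c \<phi>)) = fock_inner n (create d \<phi>) (create c \<phi>)"
    using fock_inner_create[OF assms(2), of "create c \<phi>" \<phi>]
      cnj_fock_inner[of n "create c \<phi>" "create d \<phi>"] cnj_fock_inner[of n "annih d (create c \<phi>)" \<phi>] by simp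
  ultimately show ?thesis using fock_inner_create[OF assms(1), of \<phi> "annih d \<phi>"] by simp
qed

text \<open>The anticommutation relations give f(w)^dagger f(w) + f(w) f(w)^dagger = |w|^2, and the
  second term is nonnegative. The vector \<open>?y\<close> is the adjoint of f(w) applied to
  \<phi>.\<close>

lemma annih_vec_norm_le:
  "Re (fock_inner n (annih_vec n w \<phi>) (annih_vec n w \<phi>)) \<le> (\<Sum>c<n. (cmod (w c))\<^sup>2) * Re (fock_inner n \<phi> \<phi>)"
proof -
  let ?y = "\<lambda>S. \<Sum>c<n. cnj (w c) * create c \<phi> S"
  have "fock_inner n (annih_vec n w \<phi>) (annih_vec n w \<phi>) =
    (\<Sum>c<n. \<Sum>d<n. cnj (w c) * w d * (of_bool (c = d) * fock_inner n \<phi> \<phi> - fock_inner n (create d \<phi>) (create c \<phi>)))"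
    unfolding fock_inner_annih_vec by (intro sum.cong refl) (simp add: fock_inner_annih_CAR)
  also have "\<dots> = (\<Sum>c<n. \<Sum>d<n. if d = c then cnj (w c) * w c * fock_inner n \<phi> \<phi> else 0) -
      (\<Sum>c<n. \<Sum>d<n. cnj (w c) * w d * fock_inner n (create d \<phi>) (create c \<phi>))"
    unfolding sum_subtractf[symmetric] by (intro sum.cong refl) (auto simp: algebra_simps)
  also have "(\<Sum>c<n. \<Sum>d<n. if d = c then cnj (w c) * w c * fock_inner n \<phi> \<phi> else 0) =
      complex_of_real (\<Sum>c<n. (cmod (w c))\<^sup>2) * fock_inner n \<phi> \<phi>"
    unfolding of_real_sum complex_norm_square sum_distrib_right by (simp add: mult_ac)
  also have "(\<Sum>c<n. \<Sum>d<n. cnj (w c) * w d * fock_inner n (create d \<phi>) (create c \<phi>)) = fock_inner n ?y ?y"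
    unfolding fock_inner_sum_left fock_inner_sum_right by (subst sum.swap) (simp add: sum_distrib_left mult_ac)
  finally have "Re (fock_inner n (annih_vec n w \<phi>) (annih_vec n w \<phi>)) =
      (\<Sum>c<n. (cmod (w c))\<^sup>2) * Re (fock_inner n \<phi> \<phi>) - Re (fock_inner n ?y ?y)"
    by simp
  then show ?thesis using fock_inner_self_nonneg[of n ?y] by simp
qed

text \<open>Test \<open>\<chi>\<close> against \<open>f(w) \<phi>\<close>, with the overlaps themselves as the coefficients \<open>w\<close>.\<close>

lemma sum_annih_overlap_le:
  "(\<Sum>c<n. (cmod (fock_inner n (annih c \<phi>) \<chi>))\<^sup>2) \<le> Re (fock_inner n \<phi> \<phi>) * Re (fock_inner n \<chi> \<chi>)" (is "?G \<le> ?F")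
proof -
  define w where "w = (\<lambda>c. fock_inner n (annih c \<phi>) \<chi>)"
  have G: "?G = (\<Sum>c<n. (cmod (w c))\<^sup>2)" by (simp add: w_def)
  have "fock_inner n (annih_vec n w \<phi>) \<chi> = (\<Sum>c<n. cnj (w c) * w c)"
    unfolding annih_vec_def fock_inner_sum_left by (simp add: w_def)
  also have "\<dots> = complex_of_real ?G"
    unfolding G of_real_sum complex_norm_square by (simp add: mult.commute)
  finally have e: "fock_inner n (annih_vec n w \<phi>) \<chi> = complex_of_real ?G" .
  have "cmod (fock_inner n (annih_vec n w \<phi>) \<chi>) = ?G"
    unfolding e norm_of_real by (intro abs_of_nonneg sum_nonneg) simp
  then have "?G\<^sup>2 \<le> Re (fock_inner n (annih_vec n w \<phi>) (annih_vec n w \<phi>)) * Re (fock_inner n \<chi> \<chi>)"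
    using fock_inner_Cauchy_Schwarz[of n "annih_vec n w \<phi>" \<chi>] by simp
  also have "\<dots> \<le> (?G * Re (fock_inner n \<phi> \<phi>)) * Re (fock_inner n \<chi> \<chi>)"
    unfolding G by (intro mult_right_mono annih_vec_norm_le fock_inner_self_nonneg)
  \<comment> \<open>Cancelling a factor is legitimate unless it is 0, and then the claim is the
    nonnegativity of the right side.\<close>
  finally have "?G * ?G \<le> ?G * ?F" by (simp add: power2_eq_square mult.assoc)
  moreover have "0 \<le> ?G" "0 \<le> ?F" by (simp_all add: sum_nonneg fock_inner_self_nonneg)
  ultimately show ?thesis by (metis mult_le_cancel_left_pos order_le_less)
qed

text \<open>For fixed \<open>d\<close> and \<open>b\<close> the sum over \<open>c\<close> is bounded
  by the overlap estimate for f_b psi and f_d f_j psi. The flat occupation k / n makes the sum over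
  \<open>b\<close> equal to k, and the number operator makes the sum over \<open>d\<close> equal to
  (k - 1) k / n.\<close>

lemma rho2_row_norm_le:
  assumes n: "n = 2 ^ K" and k: "even k" "2 \<le> k" "2 * k \<le> n" and j: "j < n"
  shows "(\<Sum>d<n. \<Sum>b<n. \<Sum>c<n. (cmod (rho2 n k a j d b c))\<^sup>2) \<le> real k ^ 3 / real n"
proof -
  let ?\<psi> = "psi n k a"
  let ?N = "\<lambda>\<phi>. Re (fock_inner n \<phi> \<phi>)"
  have N1: "?N (annih b ?\<psi>) = real k / real n" if "b < n" for b
    using rho1_diag[OF n k that, of a] rho1_entry[OF that that, of k a] by simp
  have n0: "real n > 0" using n by simp
  have "(\<Sum>d<n. \<Sum>b<n. \<Sum>c<n. (cmod (rho2 n k a j d b c))\<^sup>2) \<le>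
      (\<Sum>d<n. \<Sum>b<n. ?N (annih b ?\<psi>) * ?N (annih d (annih j ?\<psi>)))"
    using j by (intro sum_mono) (simp add: rho2_eq_inner sum_annih_overlap_le)
  also have "\<dots> = real k * (\<Sum>d<n. ?N (annih d (annih j ?\<psi>)))"
    using n0 by (simp add: N1 sum_distrib_left)
  also have "(\<Sum>d<n. ?N (annih d (annih j ?\<psi>))) = Re (\<Sum>d<n. fock_inner n (annih d (annih j ?\<psi>)) (annih d (annih j ?\<psi>)))"
    by simp
  also have "\<dots> = Re (of_nat (k - 1) * fock_inner n (annih j ?\<psi>) (annih j ?\<psi>))"
    using annih_supp[of n "k - 1" ?\<psi> j] psi_supp[of n k a] k by (subst fock_inner_number) auto
  also have "\<dots> = real (k - 1) * (real k / real n)" using N1[OF j] by simp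
  also have "real k * (real (k - 1) * (real k / real n)) \<le> real k * (real k * (real k / real n))"
    by (intro mult_left_mono mult_right_mono) auto
  finally show ?thesis by (simp add: power3_eq_cube mult.assoc)
qed

subsection \<open>Moments of the gradient\<close>

text \<open>Antisymmetry in the lower indices turns this trace into the contraction of
  \<open>rho2\<close>; the omitted index \<open>d = j\<close> contributes nothing.\<close>

lemma sum_grad_kernel_diag:
  assumes "j < n" "b < n" "k > 0"
  shows "(cmod (\<Sum>d\<in>{..<n} - {j}. grad_kernel n k a j d d b))\<^sup>2 =
    (real (k - 1))\<^sup>2 * (cmod (rho1 n k a $$ (j, b)))\<^sup>2"
proof -
  have "(\<Sum>d\<in>{..<n} - {j}. grad_kernel n k a j d d b) = (\<Sum>d<n. \<i> * rho2 n k a j d b d)"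
    by (rule sum.mono_neutral_cong_left)
      (auto simp: grad_kernel_def rho2_antisym_lower[of n k a j _ b])
  also have "\<dots> = \<i> * (of_nat (k - 1) * rho1 n k a $$ (j, b))"
    using rho2_contraction[OF assms] by (simp add: sum_distrib_left[symmetric])
  finally show ?thesis by (simp add: norm_mult power_mult_distrib)
qed

text \<open>The derivative depends on the parameters only through the realized matrix, so its
  moments are integrals of \<open>antidiag_obs\<close> over the image measure.\<close>

lemma phase_deriv_moments:
  fixes a :: "nat \<Rightarrow> real"
  assumes P: "haar_initialized n P" and "4 \<le> n" "p < n" "q < n" "p \<noteq> q" "j < n" "2 \<le> k"
  defines "X \<equiv> phase_deriv n k a p q j"
  shows "integrable P X" "integrable P (\<lambda>\<omega>. (X \<omega>)\<^sup>2)" "integral\<^sup>L P X = 0"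
    "integral\<^sup>L P (\<lambda>\<omega>. (X \<omega>)\<^sup>2) = (4 * (k2_frobenius n (B_op n k a j))\<^sup>2
        + 2 * (mat_frobenius (contraction n (B_op n k a j)))\<^sup>2) / (real n ^ 2 * (real n ^ 2 - 1))"
proof -
  let ?\<mu> = "distr P (unitary_borel n) (circuit n)"
  let ?R = "grad_kernel n k a j"
  let ?J = "{..<n} - {j}"
  have meas: "circuit n \<in> measurable P (unitary_borel n)" using P by (simp add: haar_initialized_def)
  interpret haar_minors n ?\<mu> p q
    using assms by unfold_locales (auto simp: haar_initialized_def)
  have X: "X = (\<lambda>\<omega>. 2 * Re (antidiag_obs j ?R (circuit n \<omega>)))"
    unfolding X_def phase_deriv_def antidiag_obs_def
    by (rule ext, rule DERIV_imp_deriv, rule loss_derivatives(1)) (use assms in auto)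
  have "?R d c b = - ?R d b c" for d b c
    using rho2_antisym_lower[of n k a j d c b] by (simp add: grad_kernel_def)
  note m = moments_re_antidiag_obs[of j ?R, OF \<open>j < n\<close> this]
  have dist: "integral\<^sup>L P (\<lambda>\<omega>. f (circuit n \<omega>)) = integral\<^sup>L ?\<mu> f" if "integrable ?\<mu> f" for f :: "complex mat \<Rightarrow> real"
    using borel_measurable_integrable[OF that] by (intro integral_distr[symmetric] meas) simp
  show "integrable P X" "integrable P (\<lambda>\<omega>. (X \<omega>)\<^sup>2)"
    unfolding X using integrable_distr[OF meas m(1)] integrable_distr[OF meas m(2)] by auto
  show "integral\<^sup>L P X = 0" unfolding X using dist[OF m(1)] m(3) by simp
  have "integral\<^sup>L P (\<lambda>\<omega>. (X \<omega>)\<^sup>2) = 4 / (real n ^ 2 * (real n ^ 2 - 1)) *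
      ((\<Sum>d\<in>?J. \<Sum>b\<in>?J. \<Sum>c\<in>?J. (cmod (?R d b c))\<^sup>2) + (\<Sum>b\<in>?J. (cmod (\<Sum>d\<in>?J. ?R d d b))\<^sup>2))"
    unfolding X using dist[OF m(2)] m(4) by simp
  also have "(\<Sum>b\<in>?J. (cmod (\<Sum>d\<in>?J. ?R d d b))\<^sup>2) =
      (real (k - 1))\<^sup>2 * (\<Sum>b\<in>?J. (cmod (rho1 n k a $$ (j, b)))\<^sup>2)"
    unfolding sum_distrib_left using assms by (intro sum.cong refl sum_grad_kernel_diag) auto
  also have "\<dots> = (mat_frobenius (contraction n (B_op n k a j)))\<^sup>2 / 2"
    using mat_frobenius_contraction_B_op[OF \<open>j < n\<close>, of k a] assms by simp
  also have "(\<Sum>d\<in>?J. \<Sum>b\<in>?J. \<Sum>c\<in>?J. (cmod (?R d b c))\<^sup>2) = (k2_frobenius n (B_op n k a j))\<^sup>2"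
    unfolding k2_frobenius_B_op[OF \<open>j < n\<close>] by (simp add: grad_kernel_def norm_mult)
  finally show "integral\<^sup>L P (\<lambda>\<omega>. (X \<omega>)\<^sup>2) = (4 * (k2_frobenius n (B_op n k a j))\<^sup>2
        + 2 * (mat_frobenius (contraction n (B_op n k a j)))\<^sup>2) / (real n ^ 2 * (real n ^ 2 - 1))"
    by (simp add: distrib_left add_divide_distrib)
qed

lemma phase_deriv_variance:
  fixes a :: "nat \<Rightarrow> real"
  assumes "haar_initialized n P" "4 \<le> n" "p < n" "q < n" "p \<noteq> q" "j < n" "2 \<le> k"
  shows "prob_space.variance P (phase_deriv n k a p q j) = (4 * (k2_frobenius n (B_op n k a j))\<^sup>2
        + 2 * (mat_frobenius (contraction n (B_op n k a j)))\<^sup>2) / (real n ^ 2 * (real n ^ 2 - 1))"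
  using phase_deriv_moments(3,4)[OF assms, of a] by simp

text \<open>Removing the diagonal entry from the row leaves k / (2n) - (k / n)^2 = k (n - 2k) /
  (2n^2), the origin of the factor n - 2k.\<close>

lemma mat_frobenius_contraction_value:
  assumes n: "n = 2 ^ K" and k: "even k" "2 \<le> k" "2 * k \<le> n" and j: "j < n"
  shows "(mat_frobenius (contraction n (B_op n k a j)))\<^sup>2 =
    (real (k - 1))\<^sup>2 * (real k * (real n - 2 * real k) / (real n)\<^sup>2)"
proof -
  have n0: "real n > 0" using n by simp
  have "(\<Sum>b<n. (cmod (rho1 n k a $$ (j, b)))\<^sup>2) = (cmod (rho1 n k a $$ (j, j)))\<^sup>2 +
      (\<Sum>b\<in>{..<n} - {j}. (cmod (rho1 n k a $$ (j, b)))\<^sup>2)"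
    by (rule sum.remove) (use j in auto)
  then have "(\<Sum>b\<in>{..<n} - {j}. (cmod (rho1 n k a $$ (j, b)))\<^sup>2) = real k / (2 * real n) - (real k / real n)\<^sup>2"
    unfolding rho1_row_norm[OF n k j] rho1_diag[OF n k j] norm_of_real by simp
  also have "\<dots> = real k * (real n - 2 * real k) / (real n)\<^sup>2 / 2"
    using n0 by (simp add: field_simps power2_eq_square)
  finally show ?thesis using mat_frobenius_contraction_B_op[OF j, of k a] k by simp
qed

lemma k2_frobenius_B_op_le:
  assumes n: "n = 2 ^ K" and k: "even k" "2 \<le> k" "2 * k \<le> n" and j: "j < n"
  shows "(k2_frobenius n (B_op n k a j))\<^sup>2 \<le> real k ^ 3 / real n"
proof -
  have "(\<Sum>d\<in>{..<n} - {j}. \<Sum>b\<in>{..<n} - {j}. \<Sum>c\<in>{..<n} - {j}. (cmod (rho2 n k a j d b c))\<^sup>2) \<le>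
      (\<Sum>d\<in>{..<n} - {j}. \<Sum>b<n. \<Sum>c<n. (cmod (rho2 n k a j d b c))\<^sup>2)"
    by (intro sum_mono order_trans[OF sum_mono[OF sum_mono2] sum_mono2] sum_nonneg) auto
  also have "\<dots> \<le> (\<Sum>d<n. \<Sum>b<n. \<Sum>c<n. (cmod (rho2 n k a j d b c))\<^sup>2)"
    by (intro sum_mono2 sum_nonneg) auto
  finally show ?thesis
    unfolding k2_frobenius_B_op[OF j] using rho2_row_norm_le[OF n k j, of a] by linarith
qed

lemma admissibleE:
  assumes "admissible n k"
  obtains K where "n = 2 ^ K" "even k" "2 \<le> k" "2 * k \<le> n" "4 \<le> n"
  using assms by (auto simp: admissible_def)

text \<open>The lower bound discards B and uses (k - 1)^2 \<ge> k^2 / 4; together with the weight 2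
  of the contraction this gives \<delta> / 2. The upper bound uses k^3 / n for both squared norms,
  with total weight 4 + 2 = 6, doubled because n^2 - 1 \<ge> n^2 / 2.\<close>

lemma phase_deriv_variance_bounds:
  fixes a :: "nat \<Rightarrow> real"
  assumes "0 < \<delta>" and adm: "admissible n k" and \<delta>: "\<delta> * real n \<le> real n - 2 * real k"
    and pq: "p < n" "q < n" "p \<noteq> q" and j: "j < n" and P: "haar_initialized n P"
  defines "V \<equiv> prob_space.variance P (phase_deriv n k a p q j)"
  shows "\<delta> / 2 * (real k ^ 3 / real n ^ 5) \<le> V" "V \<le> 12 * (real k ^ 3 / real n ^ 5)"
proof -
  obtain K where n: "n = 2 ^ K" and k: "even k" "2 \<le> k" "2 * k \<le> n" and n4: "4 \<le> n"
    using adm by (rule admissibleE)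
  define x y where "x = real n" and "y = real k"
  define B where "B = (k2_frobenius n (B_op n k a j))\<^sup>2"
  define G where "G = (real (k - 1))\<^sup>2 * (y * (x - 2 * y) / x\<^sup>2)"
  have V: "V = (4 * B + 2 * G) / (x\<^sup>2 * (x\<^sup>2 - 1))"
    unfolding V_def phase_deriv_variance[OF P n4 pq j k(2)] mat_frobenius_contraction_value[OF n k j]
    by (simp add: B_def G_def x_def y_def)
  have xy: "4 \<le> x" "2 \<le> y" "2 * y \<le> x" using n4 k by (auto simp: x_def y_def)
  have "4\<^sup>2 \<le> x\<^sup>2" using xy by (intro power_mono) auto
  then have x2: "x\<^sup>2 / 2 \<le> x\<^sup>2 - 1" "x\<^sup>2 - 1 \<le> x\<^sup>2" "0 < x\<^sup>2 - 1" by auto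
  have k1: "real (k - 1) = y - 1" using k by (simp add: y_def of_nat_diff)
  have B: "0 \<le> B" "B \<le> y ^ 3 / x"
    using k2_frobenius_B_op_le[OF n k j, of a] by (simp_all add: B_def x_def y_def)
  have w: "0 \<le> y * (x - 2 * y) / x\<^sup>2" using xy by simp
  have sq: "(y / 2)\<^sup>2 \<le> (y - 1)\<^sup>2" "(y - 1)\<^sup>2 \<le> y\<^sup>2" using xy by (auto intro!: power_mono)
  have G1: "(y / 2)\<^sup>2 * (y * (x - 2 * y) / x\<^sup>2) \<le> G" "G \<le> y\<^sup>2 * (y * (x - 2 * y) / x\<^sup>2)"
    unfolding G_def k1 using mult_right_mono[OF sq(1) w] mult_right_mono[OF sq(2) w] by blast+
  have "\<delta> * x * y / x\<^sup>2 \<le> y * (x - 2 * y) / x\<^sup>2"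
    using \<delta> xy by (intro divide_right_mono) (auto simp: x_def y_def mult.commute)
  then have "(y / 2)\<^sup>2 * (\<delta> * x * y / x\<^sup>2) \<le> G"
    using G1(1) by (meson mult_left_mono order_trans zero_le_power2)
  then have Gl: "\<delta> / 4 * (y ^ 3 / x) \<le> G"
    using xy by (simp add: power2_eq_square power3_eq_cube field_simps)
  have "y * (x - 2 * y) / x\<^sup>2 \<le> y * x / x\<^sup>2" using xy by (intro divide_right_mono mult_left_mono) auto
  then have "G \<le> y\<^sup>2 * (y * x / x\<^sup>2)"
    using G1(2) by (meson mult_left_mono order_trans zero_le_power2)
  then have Gu: "G \<le> y ^ 3 / x"
    using xy by (simp add: power2_eq_square power3_eq_cube)
  have "\<delta> / 2 * (y ^ 3 / x ^ 5) = 2 * (\<delta> / 4 * (y ^ 3 / x)) / (x\<^sup>2 * x\<^sup>2)"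
    using xy by (simp add: field_simps eval_nat_numeral)
  also have "\<dots> \<le> (4 * B + 2 * G) / (x\<^sup>2 * (x\<^sup>2 - 1))"
  proof (rule frac_le)
    show "2 * (\<delta> / 4 * (y ^ 3 / x)) \<le> 4 * B + 2 * G" using Gl B by simp
    have "0 \<le> \<delta> / 4 * (y ^ 3 / x)" using xy assms(1) by simp
    then show "0 \<le> 4 * B + 2 * G" using Gl B by linarith
    show "0 < x\<^sup>2 * (x\<^sup>2 - 1)" using x2 xy by simp
    show "x\<^sup>2 * (x\<^sup>2 - 1) \<le> x\<^sup>2 * x\<^sup>2" using x2 by (intro mult_left_mono) auto
  qed
  finally show "\<delta> / 2 * (real k ^ 3 / real n ^ 5) \<le> V" unfolding V x_def y_def .
  have "(4 * B + 2 * G) / (x\<^sup>2 * (x\<^sup>2 - 1)) \<le> 6 * (y ^ 3 / x) / (x\<^sup>2 * (x\<^sup>2 / 2))"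
  proof (rule frac_le)
    show "0 \<le> 6 * (y ^ 3 / x)" using xy by simp
    show "4 * B + 2 * G \<le> 6 * (y ^ 3 / x)" using B Gu by linarith
    show "0 < x\<^sup>2 * (x\<^sup>2 / 2)" using xy by simp
    show "x\<^sup>2 * (x\<^sup>2 / 2) \<le> x\<^sup>2 * (x\<^sup>2 - 1)" using x2 by (intro mult_left_mono) auto
  qed
  also have "\<dots> = 12 * (y ^ 3 / x ^ 5)"
    using xy by (simp add: field_simps eval_nat_numeral)
  finally show "V \<le> 12 * (real k ^ 3 / real n ^ 5)" unfolding V x_def y_def .
qed

theorem corollary11:
  shows "(\<forall>n k p q j. admissible n k \<longrightarrow> p < n \<longrightarrow> q < n \<longrightarrow> p \<noteq> q \<longrightarrow> j < n \<longrightarrow>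
      (\<forall>a::nat \<Rightarrow> real.
        (\<forall>\<omega>::params.
            loss_front_phase n k a p q j \<omega> differentiable (at (snd \<omega> 1 j)) \<and>
            loss_along_mode n k a p q j (circuit n \<omega>) differentiable (at 0) \<and>
            phase_deriv n k a p q j \<omega> = mode_deriv n k a p q j (circuit n \<omega>)) \<and>
        contraction n (B_op n k a j) =
          of_nat (k - 1) \<cdot>\<^sub>m (proj_mode n j * rho1 n k a - rho1 n k a * proj_mode n j) \<and>
        (\<forall>P. haar_initialized n P \<longrightarrow>
            integrable P (phase_deriv n k a p q j) \<and>
            integrable P (\<lambda>\<omega>. (phase_deriv n k a p q j \<omega>)\<^sup>2) \<and>
            prob_space.expectation P (phase_deriv n k a p q j) = 0 \<and>
            prob_space.variance P (phase_deriv n k a p q j) =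
              (4 * (k2_frobenius n (B_op n k a j))\<^sup>2
                + 2 * (mat_frobenius (contraction n (B_op n k a j)))\<^sup>2)
              / (real n ^ 2 * (real n ^ 2 - 1)))))
    \<and>
    (\<forall>\<delta>>0. \<exists>c>0. \<exists>C>0. \<exists>N. \<forall>n k p q j (a::nat \<Rightarrow> real) P.
        N \<le> n \<longrightarrow> admissible n k \<longrightarrow> \<delta> * real n \<le> real n - 2 * real k \<longrightarrow>
        p < n \<longrightarrow> q < n \<longrightarrow> p \<noteq> q \<longrightarrow> j < n \<longrightarrow> haar_initialized n P \<longrightarrow>
          c * (real k ^ 3 / real n ^ 5) \<le> prob_space.variance P (phase_deriv n k a p q j) \<and>
          prob_space.variance P (phase_deriv n k a p q j) \<le> C * (real k ^ 3 / real n ^ 5))"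
proof (intro conjI)
  show "\<forall>n k p q j. admissible n k \<longrightarrow> p < n \<longrightarrow> q < n \<longrightarrow> p \<noteq> q \<longrightarrow> j < n \<longrightarrow>
      (\<forall>a::nat \<Rightarrow> real.
        (\<forall>\<omega>::params.
            loss_front_phase n k a p q j \<omega> differentiable (at (snd \<omega> 1 j)) \<and>
            loss_along_mode n k a p q j (circuit n \<omega>) differentiable (at 0) \<and>
            phase_deriv n k a p q j \<omega> = mode_deriv n k a p q j (circuit n \<omega>)) \<and>
        contraction n (B_op n k a j) =
          of_nat (k - 1) \<cdot>\<^sub>m (proj_mode n j * rho1 n k a - rho1 n k a * proj_mode n j) \<and>
        (\<forall>P. haar_initialized n P \<longrightarrow>
            integrable P (phase_deriv n k a p q j) \<and>
            integrable P (\<lambda>\<omega>. (phase_deriv n k a p q j \<omega>)\<^sup>2) \<and>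
            prob_space.expectation P (phase_deriv n k a p q j) = 0 \<and>
            prob_space.variance P (phase_deriv n k a p q j) =
              (4 * (k2_frobenius n (B_op n k a j))\<^sup>2
                + 2 * (mat_frobenius (contraction n (B_op n k a j)))\<^sup>2)
              / (real n ^ 2 * (real n ^ 2 - 1))))"
  proof (intro allI impI conjI)
    fix n k p q j :: nat and a :: "nat \<Rightarrow> real"
    assume adm: "admissible n k" and pq: "p < n" "q < n" "p \<noteq> q" and j: "j < n"
    have n: "4 \<le> n" "2 \<le> n" "2 \<le> k" "k > 0" using adm by (auto elim!: admissibleE)
    note der = loss_derivatives[OF n(2) j pq n(3), of a]
    show "loss_front_phase n k a p q j \<omega> differentiable (at (snd \<omega> 1 j))"
      "loss_along_mode n k a p q j (circuit n \<omega>) differentiable (at 0)" for \<omega>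
      using der[of \<omega>] by (auto simp: real_differentiable_def)
    show "phase_deriv n k a p q j \<omega> = mode_deriv n k a p q j (circuit n \<omega>)" for \<omega>
      unfolding phase_deriv_def mode_deriv_def
      using DERIV_imp_deriv[OF der(1)[of \<omega>]] DERIV_imp_deriv[OF der(2)[of \<omega>]] by simp
    show "contraction n (B_op n k a j) =
        of_nat (k - 1) \<cdot>\<^sub>m (proj_mode n j * rho1 n k a - rho1 n k a * proj_mode n j)"
      by (rule contraction_B_op[OF n(4)])
    fix P assume P: "haar_initialized n P"
    note m = phase_deriv_moments[OF P n(1) pq j n(3), of a]
    show "integrable P (phase_deriv n k a p q j)" "integrable P (\<lambda>\<omega>. (phase_deriv n k a p q j \<omega>)\<^sup>2)"
      "prob_space.expectation P (phase_deriv n k a p q j) = 0"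
      using m(1-3) by auto
    show "prob_space.variance P (phase_deriv n k a p q j) =
              (4 * (k2_frobenius n (B_op n k a j))\<^sup>2
                + 2 * (mat_frobenius (contraction n (B_op n k a j)))\<^sup>2)
              / (real n ^ 2 * (real n ^ 2 - 1))"
      by (rule phase_deriv_variance[OF P n(1) pq j n(3)])
  qed
next
  show "\<forall>\<delta>>0. \<exists>c>0. \<exists>C>0. \<exists>N. \<forall>n k p q j (a::nat \<Rightarrow> real) P.
        N \<le> n \<longrightarrow> admissible n k \<longrightarrow> \<delta> * real n \<le> real n - 2 * real k \<longrightarrow>
        p < n \<longrightarrow> q < n \<longrightarrow> p \<noteq> q \<longrightarrow> j < n \<longrightarrow> haar_initialized n P \<longrightarrow>
          c * (real k ^ 3 / real n ^ 5) \<le> prob_space.variance P (phase_deriv n k a p q j) \<and>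
          prob_space.variance P (phase_deriv n k a p q j) \<le> C * (real k ^ 3 / real n ^ 5)"
  proof (intro allI impI)
    fix \<delta> :: real assume \<delta>: "0 < \<delta>"
    \<comment> \<open>The constants \<delta> / 2 and 12 work from N = 0 on, since admissibility
      already forces n \<ge> 4.\<close>
    have *: "\<forall>n k p q j (a::nat \<Rightarrow> real) P.
        0 \<le> n \<longrightarrow> admissible n k \<longrightarrow> \<delta> * real n \<le> real n - 2 * real k \<longrightarrow>
        p < n \<longrightarrow> q < n \<longrightarrow> p \<noteq> q \<longrightarrow> j < n \<longrightarrow> haar_initialized n P \<longrightarrow>
          \<delta> / 2 * (real k ^ 3 / real n ^ 5) \<le> prob_space.variance P (phase_deriv n k a p q j) \<and>
          prob_space.variance P (phase_deriv n k a p q j) \<le> 12 * (real k ^ 3 / real n ^ 5)"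
      by (intro allI impI conjI) (rule phase_deriv_variance_bounds[OF \<delta>]; assumption)+
    show "\<exists>c>0. \<exists>C>0. \<exists>N. \<forall>n k p q j (a::nat \<Rightarrow> real) P.
        N \<le> n \<longrightarrow> admissible n k \<longrightarrow> \<delta> * real n \<le> real n - 2 * real k \<longrightarrow>
        p < n \<longrightarrow> q < n \<longrightarrow> p \<noteq> q \<longrightarrow> j < n \<longrightarrow> haar_initialized n P \<longrightarrow>
          c * (real k ^ 3 / real n ^ 5) \<le> prob_space.variance P (phase_deriv n k a p q j) \<and>
          prob_space.variance P (phase_deriv n k a p q j) \<le> C * (real k ^ 3 / real n ^ 5)"
      by (rule exI[of _ "\<delta> / 2"], rule conjI, use \<delta> in simp,
          rule exI[of _ 12], rule conjI, simp, rule exI[of _ 0], rule *)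
  qed
qed

end
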